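(* Assume that, for some $\alpha\in(0,1)$ and some $L$ slowly varying at $+\infty$, $\rho(t)\sim t^\alpha L(t)$ as $t\to\infty$. Then, for each $j\in\mathbb{N}$, $$\limsup_{t\to\infty}\frac{K^*_j(t)-\mathbb{E}K^*_j(t)}{(\mathrm{Var}\,K^*_j(t)\,\log\log \mathrm{Var}\,K^*_j(t))^{1/2}}=2^{1/2}\quad\text{a.s.}$$ and $$\liminf_{t\to\infty}\frac{K^*_j(t)-\mathbb{E}K^*_j(t)}{(\mathrm{Var}\,K^*_j(t)\,\log\log \mathrm{Var}\,K^*_j(t))^{1/2}}=-2^{1/2}\quad\text{a.s.};$$ moreover, as $t\to\infty$, $$\mathbb{E}K^*_j(t)\sim\alpha\frac{\Gamma(j-\alpha)}{j!}t^\alpha L(t)\quad\text{and}\quad \mathrm{Var}\,K^*_j(t)\sim c_{j,\alpha}\,t^\alpha L(t),$$ where $\Gamma$ is the Euler gamma function and $$c_{j,\alpha}:=\alpha\Big(\frac{\Gamma(j-\alpha)}{j!}-\frac{2^{\alpha}\Gamma(2j-\alpha)}{2^{2j}(j!)^2}\Big)>0.$$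
   Context: Let $(p_k)_{k\in\mathbb{N}}$ be a discrete probability distribution with $p_k>0$ for infinitely many $k$, and put $\rho(t):=\#\{k\in\mathbb{N}:1/p_k\le t\}$ for $t>0$. Poissonized Karlin occupancy scheme: balls are thrown at the arrival times $S_1<S_2<\dots$ of a unit-intensity Poisson process on $[0,\infty)$, and, independently of the arrival times, each ball falls independently into box $k$ with probability $p_k$, $k\in\mathbb{N}$. Equivalently, letting $\pi_k(t)$ be the number of balls in box $k$ at time $t$, the processes $(\pi_k(t))_{t\ge0}$, $k\in\mathbb{N}$, are independent Poisson processes with intensities $p_k$. For $j\in\mathbb{N}$ and $t\ge0$, $K^*_j(t):=\sum_{k\ge1}\mathbf{1}_{\{\pi_k(t)=j\}}$ is the number of boxes containing exactly $j$ balls at time $t$. The notation $f(t)\sim g(t)$ means $f(t)/g(t)\to1$. *)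

theory Defs
  imports "HOL-Probability.Probability" "HOL-Library.Landau_Symbols"
begin

definition slowly_varying :: "(real \<Rightarrow> real) \<Rightarrow> bool" where
  "slowly_varying L \<longleftrightarrow>
     (\<exists>a. (\<forall>t\<ge>a. L t > 0) \<and> set_borel_measurable borel {a..} L) \<and>
     (\<forall>c>0. ((\<lambda>t. L (c * t) / L t) \<longlongrightarrow> 1) at_top)"

(* Boxes are indexed by all of nat, starting at 0; this is only a relabelling of {1,2,...}.
   Boxes of probability 0 have 1/p_k = \<infinity> and must be excluded by hand, as 1/0 = 0 in HOL. *)
definition rho :: "nat pmf \<Rightarrow> real \<Rightarrow> nat" where
  "rho p t = card {k. pmf p k > 0 \<and> 1 / pmf p k \<le> t}"

(* S n is the time of the (n+1)-st arrival. *)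
definition arrivals_upto :: "(nat \<Rightarrow> 'a \<Rightarrow> real) \<Rightarrow> real \<Rightarrow> 'a \<Rightarrow> nat" where
  "arrivals_upto S t \<omega> = card {n. S n \<omega> \<le> t}"

(* Divergence of the arrival times makes the sets counted above finite, so that card
   is the true count and the truncated subtraction of natural numbers below is harmless. *)
locale unit_poisson_arrivals = prob_space M for M :: "'a measure" +
  fixes S :: "nat \<Rightarrow> 'a \<Rightarrow> real"
  assumes arrival_measurable: "\<And>n. S n \<in> borel_measurable M"
    and arrival_order:
      "AE \<omega> in M. 0 < S 0 \<omega> \<and> strict_mono (\<lambda>n. S n \<omega>) \<and> filterlim (\<lambda>n. S n \<omega>) at_top sequentially"
    and poisson_increments:
      "\<And>s t. 0 \<le> s \<Longrightarrow> s < t \<Longrightarrow>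
         distr M (count_space UNIV) (\<lambda>\<omega>. arrivals_upto S t \<omega> - arrivals_upto S s \<omega>)
           = measure_pmf (poisson_pmf (t - s))"
    and independent_increments:
      "\<And>t :: nat \<Rightarrow> real. 0 \<le> t 0 \<Longrightarrow> strict_mono t \<Longrightarrow>
         indep_vars (\<lambda>_. count_space UNIV)
           (\<lambda>i \<omega>. arrivals_upto S (t (Suc i)) \<omega> - arrivals_upto S (t i) \<omega>) UNIV"

(* The ball arriving at time S n falls into box X n. The embedding of X n into the reals
   is needed only because indep_var wants both variables to have the same range type. *)
locale poissonized_karlin_scheme = unit_poisson_arrivals M S
  for M :: "'a measure" and S :: "nat \<Rightarrow> 'a \<Rightarrow> real" +
  fixes p :: "nat pmf" and X :: "nat \<Rightarrow> 'a \<Rightarrow> nat"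
  assumes infinitely_many_boxes: "infinite {k. pmf p k > 0}"
    and box_distribution: "\<And>n. distr M (count_space UNIV) (X n) = measure_pmf p"
    and boxes_independent: "indep_vars (\<lambda>_. count_space UNIV) X UNIV"
    and boxes_independent_of_arrivals:
      "indep_var (Pi\<^sub>M UNIV (\<lambda>_. borel)) (\<lambda>\<omega> n. S n \<omega>)
                 (Pi\<^sub>M UNIV (\<lambda>_. borel)) (\<lambda>\<omega> n. real (X n \<omega>))"

definition balls_in_box ::
    "(nat \<Rightarrow> 'a \<Rightarrow> real) \<Rightarrow> (nat \<Rightarrow> 'a \<Rightarrow> nat) \<Rightarrow> nat \<Rightarrow> real \<Rightarrow> 'a \<Rightarrow> nat" where
  "balls_in_box S X k t \<omega> = card {n. S n \<omega> \<le> t \<and> X n \<omega> = k}"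

(* Only meaningful for j \<ge> 1: the set of empty boxes is infinite. *)
definition boxes_with ::
    "(nat \<Rightarrow> 'a \<Rightarrow> real) \<Rightarrow> (nat \<Rightarrow> 'a \<Rightarrow> nat) \<Rightarrow> nat \<Rightarrow> real \<Rightarrow> 'a \<Rightarrow> real" where
  "boxes_with S X j t \<omega> = real (card {k. balls_in_box S X k t \<omega> = j})"

definition mean_boxes ::
    "'a measure \<Rightarrow> (nat \<Rightarrow> 'a \<Rightarrow> real) \<Rightarrow> (nat \<Rightarrow> 'a \<Rightarrow> nat) \<Rightarrow> nat \<Rightarrow> real \<Rightarrow> real" where
  "mean_boxes M S X j t = prob_space.expectation M (boxes_with S X j t)"

definition var_boxes ::
    "'a measure \<Rightarrow> (nat \<Rightarrow> 'a \<Rightarrow> real) \<Rightarrow> (nat \<Rightarrow> 'a \<Rightarrow> nat) \<Rightarrow> nat \<Rightarrow> real \<Rightarrow> real" where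
  "var_boxes M S X j t = prob_space.variance M (boxes_with S X j t)"

definition normalized_boxes ::
    "'a measure \<Rightarrow> (nat \<Rightarrow> 'a \<Rightarrow> real) \<Rightarrow> (nat \<Rightarrow> 'a \<Rightarrow> nat) \<Rightarrow> nat \<Rightarrow> real \<Rightarrow> 'a \<Rightarrow> real" where
  "normalized_boxes M S X j t \<omega> =
     (boxes_with S X j t \<omega> - mean_boxes M S X j t) /
     sqrt (var_boxes M S X j t * ln (ln (var_boxes M S X j t)))"

definition var_const :: "nat \<Rightarrow> real \<Rightarrow> real" where
  "var_const j \<alpha> = \<alpha> * (Gamma (real j - \<alpha>) / fact j
     - 2 powr \<alpha> * Gamma (2 * real j - \<alpha>) / (2 ^ (2 * j) * (fact j)\<^sup>2))"

end

theory Submission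
  imports Defs "HOL-Real_Asymp.Real_Asymp"
begin

text \<open>
  By Poisson marking the counting processes of the boxes are independent, so \<open>K\<^sup>*\<^sub>j(t)\<close> is a sum of
  independent indicators. Writing its mean as \<open>\<integral> f'(y) \<rho>(t / y) dy\<close> with \<open>f y = y\<^sup>j e\<^sup>-\<^sup>y / j!\<close> and dominating
  \<open>\<rho>(t / y) / \<rho>(t)\<close> by powers of \<open>y\<close> gives the mean, and the variance reduces to means because
  the square of a Poisson weight at \<open>j\<close> is a multiple of the weight at \<open>2 j\<close> with doubled rate.

  Upper bound: Chernoff's inequality controls the process along \<open>\<gamma>\<^sup>n\<close>. Between consecutive points,
  \<open>K\<^sup>*\<^sub>j\<close> is a difference of two monotone processes; the tail exponent of an increment is inversely proportional
  to the relative mesh, so that passing through one grid with about \<open>n\<^sup>2\<close> points allows a second,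
  exponentially fine grid, on which monotonicity takes over.

  Lower bound: at time \<open>t\<close> only boxes with \<open>p\<^sub>k t\<close> of order one matter. Along \<open>t\<^sub>n = a\<^sup>2\<^sup>n\<close> these blocks of boxes
  are disjoint, which makes the dominant parts independent over \<open>n\<close>. Kolmogorov's converse of the exponential
  inequality and the second Borel--Cantelli lemma apply to them, and the remainders are negligible.
\<close>

section \<open>Sums of independent indicators\<close>

text \<open>The count \<open>boxes_with\<close> is not monotone in time, and the iterated logarithm
  leaves little room for union bounds: a deviation of the order of the norming over a fixed relative
  distance h has a probability that is only a power of n at time \<open>\<gamma> ^ n\<close>.
  Monotonicity, on the other hand, helps only over time steps whose mean increment is below the
  norming, that is, on a grid with exponentially many points. Neither grid works alone; the
  intermediate one shortens the relative distance to h / n^2, and the resulting factor n^2 in the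
  exponent beats exponentially many points.

  Sharp constants are needed only at single times. There the exponential bounds use the true
  variance, whereas for increments the variance is simply bounded by the mean.

  Independence is used along strictly increasing sequences of times starting from 0, so paths are
  sampled on such sequences only; uncountably many times are reached by monotonicity alone.\<close>

lemma exp_second_order:
  fixes u :: real
  assumes "\<bar>u\<bar> \<le> 1"
  shows "\<bar>exp u - (1 + u + u\<^sup>2 / 2)\<bar> \<le> \<bar>u\<bar> ^ 3 / 2"
proof -
  obtain t where t: "\<bar>t\<bar> \<le> \<bar>u\<bar>" "exp u = (\<Sum>m<3. u ^ m / fact m) + exp t / fact 3 * u ^ 3"
    using Maclaurin_exp_le[of u 3] by auto
  have "exp u - (1 + u + u\<^sup>2 / 2) = exp t / 6 * u ^ 3"
    using t(2) by (simp add: eval_nat_numeral)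
  moreover have "exp t \<le> exp 1" using t(1) assms by simp
  \<comment> \<open>The Taylor remainder carries the factor exp t / 6 with t at most 1; the bound 3
    for e turns it into 1 / 2.\<close>
  moreover have "exp (1::real) \<le> 3" by (rule exp_le)
  ultimately have "\<bar>exp u - (1 + u + u\<^sup>2 / 2)\<bar> = \<bar>exp t / 6\<bar> * \<bar>u\<bar> ^ 3" "exp t / 6 \<le> 1 / 2"
    by (simp only: abs_mult power_abs, linarith)
  moreover have "\<bar>exp t / 6\<bar> * \<bar>u\<bar> ^ 3 \<le> 1 / 2 * \<bar>u\<bar> ^ 3"
    by (rule mult_right_mono) (use \<open>exp t / 6 \<le> 1 / 2\<close> in auto)
  ultimately show ?thesis by simp
qed

text \<open>The variable is centred, so the linear terms cancel. The cubic remainders are bounded by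
  (1 - q)^3 \<le> 1 - q and q^3 \<le> q, which keeps the error proportional to the variance s; only
  such bounds survive multiplication over many boxes. The remainder costs 2 |l| in the exponent, and
  a third |l| pays for ln (1 + y) \<ge> y - y^2 in the lower bound.\<close>

lemma bernoulli_mgf_bounds:
  fixes q l :: real
  assumes q: "0 \<le> q" "q \<le> 1" and l: "\<bar>l\<bar> \<le> 1"
  defines "\<phi> \<equiv> q * exp (l * (1 - q)) + (1 - q) * exp (- l * q)"
    and "s \<equiv> q * (1 - q)"
  shows "exp (l\<^sup>2 / 2 * (1 - 3 * \<bar>l\<bar>) * s) \<le> \<phi>"
    and "\<phi> \<le> exp (l\<^sup>2 / 2 * (1 + 3 * \<bar>l\<bar>) * s)"
proof -
  define r where "r = (\<lambda>u::real. exp u - (1 + u + u\<^sup>2 / 2))"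
  have phi: "\<phi> = 1 + l\<^sup>2 / 2 * s + (q * r (l * (1 - q)) + (1 - q) * r (- l * q))"
    by (simp add: \<phi>_def r_def s_def power2_eq_square field_simps)
  have s0: "0 \<le> s" using q by (simp add: s_def)
  have s1: "s \<le> 1 / 4"
  proof -
    have "0 \<le> (q - 1/2)\<^sup>2" by simp
    then show ?thesis by (simp add: s_def power2_eq_square algebra_simps)
  qed
  have r1: "\<bar>r (l * (1 - q))\<bar> \<le> \<bar>l\<bar> ^ 3 * (1 - q) / 2"
  proof -
    have le1: "\<bar>l * (1 - q)\<bar> \<le> 1" using q l by (simp add: abs_mult mult_le_one)
    have "\<bar>r (l * (1 - q))\<bar> \<le> \<bar>l * (1 - q)\<bar> ^ 3 / 2"
      unfolding r_def by (rule exp_second_order[OF le1])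
    also have "\<dots> = \<bar>l\<bar> ^ 3 * (1 - q) ^ 3 / 2" using q by (simp add: abs_mult power_mult_distrib)
    also have "\<dots> \<le> \<bar>l\<bar> ^ 3 * (1 - q) / 2"
      using q power_decreasing[of 1 3 "1 - q"] by (intro divide_right_mono mult_left_mono) auto
    finally show ?thesis .
  qed
  have r2: "\<bar>r (- l * q)\<bar> \<le> \<bar>l\<bar> ^ 3 * q / 2"
  proof -
    have le1: "\<bar>- l * q\<bar> \<le> 1" using q l by (simp add: abs_mult mult_le_one)
    have "\<bar>r (- l * q)\<bar> \<le> \<bar>- l * q\<bar> ^ 3 / 2"
      unfolding r_def by (rule exp_second_order[OF le1])
    also have "\<dots> = \<bar>l\<bar> ^ 3 * q ^ 3 / 2" using q by (simp add: abs_mult power_mult_distrib)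
    also have "\<dots> \<le> \<bar>l\<bar> ^ 3 * q / 2"
      using q power_decreasing[of 1 3 q] by (intro divide_right_mono mult_left_mono) auto
    finally show ?thesis .
  qed
  have "\<bar>q * r (l * (1 - q)) + (1 - q) * r (- l * q)\<bar>
      \<le> q * \<bar>r (l * (1 - q))\<bar> + (1 - q) * \<bar>r (- l * q)\<bar>"
    using q by (auto intro!: order_trans[OF abs_triangle_ineq] simp: abs_mult)
  also have "\<dots> \<le> q * (\<bar>l\<bar> ^ 3 * (1 - q) / 2) + (1 - q) * (\<bar>l\<bar> ^ 3 * q / 2)"
    using q r1 r2 by (intro add_mono mult_left_mono) auto
  also have "\<dots> = l\<^sup>2 * \<bar>l\<bar> * s"
    by (simp add: s_def field_simps power2_eq_square power3_eq_cube)
  finally have rem0: "\<bar>q * r (l * (1 - q)) + (1 - q) * r (- l * q)\<bar> \<le> l\<^sup>2 * \<bar>l\<bar> * s" .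
  show "\<phi> \<le> exp (l\<^sup>2 / 2 * (1 + 3 * \<bar>l\<bar>) * s)"
  proof -
    have "\<phi> \<le> 1 + l\<^sup>2 / 2 * s * (1 + 2 * \<bar>l\<bar>)"
      using rem0 unfolding phi by (simp add: field_simps)
    also have "\<dots> \<le> 1 + l\<^sup>2 / 2 * s * (1 + 3 * \<bar>l\<bar>)"
      using s0 by (intro add_left_mono mult_left_mono) auto
    also have "\<dots> = 1 + l\<^sup>2 / 2 * (1 + 3 * \<bar>l\<bar>) * s" by simp
    also have "\<dots> \<le> exp (l\<^sup>2 / 2 * (1 + 3 * \<bar>l\<bar>) * s)" by (rule exp_ge_add_one_self)
    finally show ?thesis .
  qed
  show "exp (l\<^sup>2 / 2 * (1 - 3 * \<bar>l\<bar>) * s) \<le> \<phi>"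
  proof (cases "\<bar>l\<bar> \<le> 1 / 3")
    case True
    define y where "y = l\<^sup>2 / 2 * s * (1 - 2 * \<bar>l\<bar>)"
    have l2: "0 \<le> l\<^sup>2" "l\<^sup>2 \<le> \<bar>l\<bar>"
      using l power_decreasing[of 1 2 "\<bar>l\<bar>"] by auto
    have ls: "0 \<le> l\<^sup>2 / 2 * s" "l\<^sup>2 / 2 * s \<le> \<bar>l\<bar>"
    proof -
      show "0 \<le> l\<^sup>2 / 2 * s" using s0 by simp
      have "l\<^sup>2 / 2 * s \<le> l\<^sup>2 / 2 * 1" using s1 by (intro mult_left_mono) auto
      then show "l\<^sup>2 / 2 * s \<le> \<bar>l\<bar>" using l2 by simp
    qed
    have y0: "0 \<le> y" unfolding y_def using True s0 by (intro mult_nonneg_nonneg) auto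
    have "y \<le> l\<^sup>2 / 2 * s * 1" unfolding y_def using True ls by (intro mult_left_mono) auto
    then have yl: "y \<le> l\<^sup>2 / 2 * s" "y \<le> \<bar>l\<bar>" using ls by auto
    have "l\<^sup>2 / 2 * (1 - 3 * \<bar>l\<bar>) * s = y - l\<^sup>2 / 2 * s * \<bar>l\<bar>"
      by (simp add: y_def field_simps)
    also have "\<dots> \<le> y - y * y" using mult_mono[OF yl] ls y0 by simp
    also have "\<dots> \<le> ln (1 + y)"
      using ln_one_plus_pos_lower_bound[of y] y0 yl l by (simp add: power2_eq_square)
    finally have "exp (l\<^sup>2 / 2 * (1 - 3 * \<bar>l\<bar>) * s) \<le> exp (ln (1 + y))" by simp
    also have "\<dots> = 1 + y" using y0 by simp
    also have "\<dots> \<le> \<phi>" using rem0 unfolding phi y_def by (simp add: field_simps)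
    finally show ?thesis .
  next
    case False
    \<comment> \<open>For |l| > 1 / 3 the claimed lower bound is at most 1, while exp u \<ge> 1 + u
      and centring give \<phi> \<ge> 1.\<close>
    have "l\<^sup>2 / 2 * (1 - 3 * \<bar>l\<bar>) * s = - (l\<^sup>2 / 2 * (3 * \<bar>l\<bar> - 1) * s)" by (simp add: field_simps)
    also have "\<dots> \<le> 0" using False s0 by simp
    finally have "exp (l\<^sup>2 / 2 * (1 - 3 * \<bar>l\<bar>) * s) \<le> 1" by simp
    also have "1 = q * (1 + l * (1 - q)) + (1 - q) * (1 + - l * q)" by (simp add: algebra_simps)
    also have "\<dots> \<le> \<phi>"
      unfolding \<phi>_def using q by (intro add_mono mult_left_mono exp_ge_add_one_self) auto
    finally show ?thesis .
  qed
qed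

text \<open>Instantiated with three kinds of events: a box holds exactly j balls, the count of a box
  reaches j between two times, and a box outside a block holds exactly j balls.\<close>

locale indep_occupancy = prob_space M for M :: "'a measure" +
  fixes E :: "nat \<Rightarrow> 'a \<Rightarrow> bool"
  assumes indep: "indep_vars (\<lambda>_. count_space UNIV) E UNIV"
    and summable_prob: "summable (\<lambda>k. \<P>(\<omega> in M. E k \<omega>))"
begin

definition q :: "nat \<Rightarrow> real" where "q k = \<P>(\<omega> in M. E k \<omega>)"

definition T :: "'a \<Rightarrow> real" where "T \<omega> = real (card {k. E k \<omega>})"

definition m :: real where "m = (\<Sum>k. q k)"

definition v :: real where "v = (\<Sum>k. q k * (1 - q k))"

definition Y :: "nat set \<Rightarrow> 'a \<Rightarrow> real" where
  "Y I \<omega> = (\<Sum>k\<in>I. of_bool (E k \<omega>) - q k)"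

lemma E_measurable [measurable]: "E k \<in> M \<rightarrow>\<^sub>M count_space UNIV"
  using indep by (auto simp: indep_vars_def)

lemma Y_measurable [measurable]: "Y I \<in> borel_measurable M"
  unfolding Y_def by measurable

lemma T_measurable [measurable]: "T \<in> borel_measurable M"
  unfolding T_def by measurable

lemma q_bounds: "0 \<le> q k" "q k \<le> 1"
  by (auto simp: q_def)

lemma summable_q: "summable q"
  using summable_prob by (simp add: q_def[abs_def])

lemma summable_qq: "summable (\<lambda>k. q k * (1 - q k))"
  by (rule summable_comparison_test'[OF summable_q, of 0])
     (use q_bounds in \<open>auto simp: abs_mult intro!: mult_left_le\<close>)

text \<open>First Borel--Cantelli lemma. Since \<open>card\<close> of an infinite set is 0,
  \<open>T\<close> is the true count only on this almost sure event.\<close>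

lemma AE_finite: "AE \<omega> in M. finite {k. E k \<omega>}"
proof -
  have "AE \<omega> in M. eventually (\<lambda>k. \<omega> \<in> space M - {\<omega> \<in> space M. E k \<omega>}) sequentially"
    by (rule borel_cantelli_AE1) (use summable_prob in \<open>auto simp: emeasure_eq_measure\<close>)
  then show ?thesis
  proof eventually_elim
    case (elim \<omega>)
    then obtain N where "\<And>k. k \<ge> N \<Longrightarrow> \<not> E k \<omega>"
      by (auto simp: eventually_sequentially)
    then have "{k. E k \<omega>} \<subseteq> {..<N}" by (auto simp: not_less[symmetric])
    then show ?case by (rule finite_subset) simp
  qed
qed

lemma AE_sums: "AE \<omega> in M. (\<lambda>n. Y {..<n} \<omega>) \<longlonglongrightarrow> T \<omega> - m"
  using AE_finite
proof eventually_elim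
  case (elim \<omega>)
  have "(\<lambda>k. of_bool (E k \<omega>) :: real) sums (\<Sum>k\<in>{k. E k \<omega>}. of_bool (E k \<omega>))"
    by (rule sums_finite[OF elim])
       (simp_all del: sum_of_bool_eq)
  then have "(\<lambda>k. of_bool (E k \<omega>) :: real) sums T \<omega>" by (simp add: T_def)
  from sums_diff[OF this summable_sums[OF summable_q]] show ?case
    by (simp add: sums_def Y_def m_def)
qed

lemma integrable_of_bool [simp]: "integrable M (\<lambda>\<omega>. of_bool (E k \<omega>) :: real)"
  by (rule integrable_const_bound[where B=1]) auto

lemma expectation_of_bool [simp]: "expectation (\<lambda>\<omega>. of_bool (E k \<omega>)) = q k"
proof -
  have "expectation (\<lambda>\<omega>. of_bool (E k \<omega>)) = expectation (indicator {\<omega> \<in> space M. E k \<omega>} :: 'a \<Rightarrow> real)"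
    by (intro Bochner_Integration.integral_cong) (auto simp: indicator_def)
  then show ?thesis by (simp add: q_def Int_absorb2 Collect_restrict)
qed

lemma expectation_pair:
  assumes "i \<noteq> j"
  shows "expectation (\<lambda>\<omega>. of_bool (E i \<omega>) * of_bool (E j \<omega>)) = q i * q j"
proof -
  have "indep_vars (\<lambda>_. borel) (\<lambda>k \<omega>. of_bool (E k \<omega>) :: real) {i, j}"
    by (rule indep_vars_subset[OF indep_vars_compose2[OF indep]]) auto
  from indep_vars_lebesgue_integral[OF _ this] show ?thesis using assms by simp
qed

lemma partial_sum_second_moment:
  "integrable M (\<lambda>\<omega>. (\<Sum>k<n. of_bool (E k \<omega>) :: real)\<^sup>2)"
  "expectation (\<lambda>\<omega>. (\<Sum>k<n. of_bool (E k \<omega>))\<^sup>2) = (\<Sum>k<n. q k * (1 - q k)) + (\<Sum>k<n. q k)\<^sup>2"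
proof -
  have int: "integrable M (\<lambda>\<omega>. of_bool (E i \<omega>) * of_bool (E j \<omega>) :: real)" for i j
    by (rule integrable_const_bound[where B=1]) (auto simp: mult_le_one)
  have sq: "(\<Sum>k<n. of_bool (E k \<omega>) :: real)\<^sup>2 = (\<Sum>i<n. \<Sum>j<n. of_bool (E i \<omega>) * of_bool (E j \<omega>))" for \<omega>
    unfolding power2_eq_square by (rule sum_product)
  show "integrable M (\<lambda>\<omega>. (\<Sum>k<n. of_bool (E k \<omega>) :: real)\<^sup>2)"
    unfolding sq by (intro Bochner_Integration.integrable_sum int)
  have pr: "expectation (\<lambda>\<omega>. of_bool (E i \<omega>) * of_bool (E j \<omega>)) = q i * q j + (if i = j then q i * (1 - q i) else 0)" for i j
  proof (cases "i = j")
    case True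
    have "expectation (\<lambda>\<omega>. of_bool (E i \<omega>) * of_bool (E i \<omega>)) = q i"
      by (subst of_bool_conj[symmetric]) simp
    then show ?thesis using True by (simp add: algebra_simps)
  qed (simp add: expectation_pair)
  have "expectation (\<lambda>\<omega>. (\<Sum>k<n. of_bool (E k \<omega>))\<^sup>2)
      = (\<Sum>i<n. \<Sum>j<n. q i * q j + (if i = j then q i * (1 - q i) else 0))"
    unfolding sq by (simp add: int pr del: sum_of_bool_eq sum_of_bool_mult_eq sum_mult_of_bool_eq)
  also have "\<dots> = (\<Sum>k<n. q k * (1 - q k)) + (\<Sum>k<n. q k)\<^sup>2"
    by (simp add: sum.distrib power2_eq_square sum_product sum.delta')
  finally show "expectation (\<lambda>\<omega>. (\<Sum>k<n. of_bool (E k \<omega>))\<^sup>2) = (\<Sum>k<n. q k * (1 - q k)) + (\<Sum>k<n. q k)\<^sup>2" .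
qed

lemma AE_partial_sums:
  "AE \<omega> in M. (\<lambda>n. \<Sum>k<n. of_bool (E k \<omega>) :: real) \<longlonglongrightarrow> T \<omega>"
  using AE_sums
proof eventually_elim
  case (elim \<omega>)
  from tendsto_add[OF this summable_LIMSEQ[OF summable_q]]
  show ?case by (simp add: Y_def sum_subtractf m_def)
qed

lemma integrable_T: "integrable M T" and expectation_T: "expectation T = m"
proof -
  have lim: "(\<lambda>n. expectation (\<lambda>\<omega>. \<Sum>k<n. of_bool (E k \<omega>))) \<longlonglongrightarrow> m"
    using summable_LIMSEQ[OF summable_q] by (simp add: m_def del: sum_of_bool_eq)
  have mono: "AE \<omega> in M. mono (\<lambda>n. \<Sum>k<n. of_bool (E k \<omega>) :: real)"
    by (auto intro!: AE_I2 monoI sum_mono2 simp del: sum_of_bool_eq)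
  show "integrable M T"
    by (rule integrable_monotone_convergence[OF _ mono AE_partial_sums lim])
       (simp_all del: sum_of_bool_eq)
  show "expectation T = m"
    by (rule integral_monotone_convergence[OF _ mono AE_partial_sums lim])
       (simp_all del: sum_of_bool_eq)
qed

text \<open>Squares of the partial sums increase, because the indicators are nonnegative, so
  monotone convergence carries the second moments to the limit and yields integrability at the same
  time.\<close>

lemma integrable_T_square: "integrable M (\<lambda>\<omega>. (T \<omega>)\<^sup>2)"
  and variance_T: "variance T = v"
proof -
  have lim: "(\<lambda>n. expectation (\<lambda>\<omega>. (\<Sum>k<n. of_bool (E k \<omega>))\<^sup>2)) \<longlonglongrightarrow> v + m\<^sup>2"
    unfolding partial_sum_second_moment m_def v_def
    by (intro tendsto_intros summable_LIMSEQ summable_q summable_qq)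
  have mono: "AE \<omega> in M. mono (\<lambda>n. (\<Sum>k<n. of_bool (E k \<omega>) :: real)\<^sup>2)"
    by (auto intro!: AE_I2 monoI power_mono sum_mono2 sum_nonneg simp del: sum_of_bool_eq)
  have conv: "AE \<omega> in M. (\<lambda>n. (\<Sum>k<n. of_bool (E k \<omega>) :: real)\<^sup>2) \<longlonglongrightarrow> (T \<omega>)\<^sup>2"
    using AE_partial_sums by eventually_elim (intro tendsto_intros)
  show int: "integrable M (\<lambda>\<omega>. (T \<omega>)\<^sup>2)"
    by (rule integrable_monotone_convergence[OF _ mono conv lim])
       (simp_all add: partial_sum_second_moment del: sum_of_bool_eq)
  have "expectation (\<lambda>\<omega>. (T \<omega>)\<^sup>2) = v + m\<^sup>2"
    by (rule integral_monotone_convergence[OF _ mono conv lim])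
       (simp_all add: partial_sum_second_moment del: sum_of_bool_eq)
  then show "variance T = v"
    by (subst variance_eq[OF integrable_T int]) (simp add: expectation_T)
qed

lemma mgf_one:
  "expectation (\<lambda>\<omega>. exp (l * (of_bool (E k \<omega>) - q k)))
    = q k * exp (l * (1 - q k)) + (1 - q k) * exp (- l * q k)"
proof -
  have "expectation (\<lambda>\<omega>. exp (l * (of_bool (E k \<omega>) - q k)))
      = expectation (\<lambda>\<omega>. exp (- l * q k) + (exp (l * (1 - q k)) - exp (- l * q k)) * of_bool (E k \<omega>))"
    by (intro Bochner_Integration.integral_cong) auto
  also have "\<dots> = exp (- l * q k) + (exp (l * (1 - q k)) - exp (- l * q k)) * q k"
    by (subst Bochner_Integration.integral_add)
       (auto intro!: integrable_mult_right integrable_of_bool simp: prob_space)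
  finally show ?thesis by (simp add: algebra_simps)
qed

text \<open>Independence turns the moment generating function into a product, to which the
  one-variable bounds apply; being proportional to the variances, the exponents add up.\<close>

lemma
  assumes I: "finite I" and l: "\<bar>l\<bar> \<le> 1"
  shows mgf_integrable: "integrable M (\<lambda>\<omega>. exp (l * Y I \<omega>))"
    and mgf_lower: "exp (l\<^sup>2 / 2 * (1 - 3 * \<bar>l\<bar>) * (\<Sum>k\<in>I. q k * (1 - q k))) \<le> expectation (\<lambda>\<omega>. exp (l * Y I \<omega>))"
    and mgf_upper: "expectation (\<lambda>\<omega>. exp (l * Y I \<omega>)) \<le> exp (l\<^sup>2 / 2 * (1 + 3 * \<bar>l\<bar>) * (\<Sum>k\<in>I. q k * (1 - q k)))"
proof -
  define f where "f = (\<lambda>k \<omega>. exp (l * (of_bool (E k \<omega>) - q k)))"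
  have eq: "exp (l * Y I \<omega>) = (\<Prod>k\<in>I. f k \<omega>)" for \<omega>
    using I by (simp add: f_def Y_def sum_distrib_left exp_sum)
  have ind: "indep_vars (\<lambda>_. borel) f I"
    unfolding f_def
    by (rule indep_vars_subset[OF indep_vars_compose2[OF indep]]) auto
  have int: "integrable M (f k)" for k
    unfolding f_def
  proof (rule integrable_const_bound[where B="exp \<bar>l\<bar>"])
    have "l * (of_bool (E k \<omega>) - q k) \<le> \<bar>l\<bar>" for \<omega>
    proof -
      have "l * (of_bool (E k \<omega>) - q k) \<le> \<bar>l\<bar> * \<bar>of_bool (E k \<omega>) - q k\<bar>"
        unfolding abs_mult[symmetric] by (rule abs_ge_self)
      also have "\<dots> \<le> \<bar>l\<bar> * 1"
        by (rule mult_left_mono) (use q_bounds[of k] in auto)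
      finally show ?thesis by simp
    qed
    then show "AE \<omega> in M. norm (exp (l * (of_bool (E k \<omega>) - q k))) \<le> exp \<bar>l\<bar>" by simp
  qed measurable
  show "integrable M (\<lambda>\<omega>. exp (l * Y I \<omega>))"
    unfolding eq by (rule indep_vars_integrable[OF I ind int])
  have E: "expectation (\<lambda>\<omega>. exp (l * Y I \<omega>))
      = (\<Prod>k\<in>I. q k * exp (l * (1 - q k)) + (1 - q k) * exp (- l * q k))"
    unfolding eq indep_vars_lebesgue_integral[OF I ind int] by (simp add: f_def mgf_one)
  show "exp (l\<^sup>2 / 2 * (1 - 3 * \<bar>l\<bar>) * (\<Sum>k\<in>I. q k * (1 - q k))) \<le> expectation (\<lambda>\<omega>. exp (l * Y I \<omega>))"
    unfolding E sum_distrib_left exp_sum[OF I]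
    using bernoulli_mgf_bounds(1)[OF q_bounds l] by (intro prod_mono) auto
  show "expectation (\<lambda>\<omega>. exp (l * Y I \<omega>)) \<le> exp (l\<^sup>2 / 2 * (1 + 3 * \<bar>l\<bar>) * (\<Sum>k\<in>I. q k * (1 - q k)))"
    unfolding E sum_distrib_left exp_sum[OF I]
    using bernoulli_mgf_bounds(2)[OF q_bounds l] q_bounds by (intro prod_mono) auto
qed

text \<open>Fatou's lemma suffices, as only the upper bound is carried over to infinitely many
  indicators; the lower bound is applied to finite blocks.\<close>

lemma mgf_upper_T:
  assumes l: "\<bar>l\<bar> \<le> 1"
  shows "(\<integral>\<^sup>+\<omega>. exp (l * (T \<omega> - m)) \<partial>M) \<le> ennreal (exp (l\<^sup>2 / 2 * (1 + 3 * \<bar>l\<bar>) * v))"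
proof -
  have "(\<integral>\<^sup>+\<omega>. exp (l * (T \<omega> - m)) \<partial>M) = (\<integral>\<^sup>+\<omega>. liminf (\<lambda>n. ennreal (exp (l * Y {..<n} \<omega>))) \<partial>M)"
  proof (rule nn_integral_cong_AE)
    show "AE \<omega> in M. ennreal (exp (l * (T \<omega> - m))) = liminf (\<lambda>n. ennreal (exp (l * Y {..<n} \<omega>)))"
      using AE_sums
    proof eventually_elim
      case (elim \<omega>)
      have "(\<lambda>n. ennreal (exp (l * Y {..<n} \<omega>))) \<longlonglongrightarrow> ennreal (exp (l * (T \<omega> - m)))"
        by (intro tendsto_ennrealI tendsto_intros elim)
      then show ?case by (intro lim_imp_Liminf[symmetric]) auto
    qed
  qed
  also have "\<dots> \<le> liminf (\<lambda>n. \<integral>\<^sup>+\<omega>. ennreal (exp (l * Y {..<n} \<omega>)) \<partial>M)"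
    by (rule nn_integral_liminf) measurable
  also have "\<dots> \<le> ennreal (exp (l\<^sup>2 / 2 * (1 + 3 * \<bar>l\<bar>) * v))"
  proof (rule Liminf_le)
    show "\<forall>\<^sub>F n in sequentially. (\<integral>\<^sup>+\<omega>. ennreal (exp (l * Y {..<n} \<omega>)) \<partial>M)
        \<le> ennreal (exp (l\<^sup>2 / 2 * (1 + 3 * \<bar>l\<bar>) * v))"
    proof (rule always_eventually, rule allI)
      fix n
      have "(\<integral>\<^sup>+\<omega>. ennreal (exp (l * Y {..<n} \<omega>)) \<partial>M) = ennreal (expectation (\<lambda>\<omega>. exp (l * Y {..<n} \<omega>)))"
        by (rule nn_integral_eq_integral) (use l in \<open>auto intro: mgf_integrable\<close>)
      also have "\<dots> \<le> ennreal (exp (l\<^sup>2 / 2 * (1 + 3 * \<bar>l\<bar>) * (\<Sum>k<n. q k * (1 - q k))))"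
        by (intro ennreal_leI mgf_upper l) simp
      also have "\<dots> \<le> ennreal (exp (l\<^sup>2 / 2 * (1 + 3 * \<bar>l\<bar>) * v))"
        unfolding v_def
        by (intro ennreal_leI) (use q_bounds summable_qq in \<open>auto intro!: mult_left_mono sum_le_suminf\<close>)
      finally show "(\<integral>\<^sup>+\<omega>. ennreal (exp (l * Y {..<n} \<omega>)) \<partial>M) \<le> ennreal (exp (l\<^sup>2 / 2 * (1 + 3 * \<bar>l\<bar>) * v))" .
    qed
  qed simp
  finally show ?thesis .
qed

text \<open>Markov's inequality for exp (l * s * (T - m)). The sign s covers both tails, and l stays
  free: the level estimate needs a nearly optimal choice, increments a cruder one.\<close>

lemma chernoff:
  assumes l: "0 \<le> l" "l \<le> 1" and s: "\<bar>s\<bar> = 1"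
  shows "\<P>(\<omega> in M. x \<le> s * (T \<omega> - m)) \<le> exp (- l * x + l\<^sup>2 / 2 * (1 + 3 * l) * v)"
proof -
  have "emeasure M {\<omega> \<in> space M. x \<le> s * (T \<omega> - m)}
      = (\<integral>\<^sup>+\<omega>. indicator {\<omega> \<in> space M. x \<le> s * (T \<omega> - m)} \<omega> \<partial>M)" by simp
  also have "\<dots> \<le> (\<integral>\<^sup>+\<omega>. ennreal (exp (- l * x)) * ennreal (exp ((l * s) * (T \<omega> - m))) \<partial>M)"
    by (intro nn_integral_mono)
       (use l in \<open>auto simp: indicator_def ennreal_mult[symmetric] exp_add[symmetric] mult.assoc intro!: mult_left_mono\<close>)
  also have "\<dots> = ennreal (exp (- l * x)) * (\<integral>\<^sup>+\<omega>. ennreal (exp ((l * s) * (T \<omega> - m))) \<partial>M)"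
    by (rule nn_integral_cmult) measurable
  also have "\<dots> \<le> ennreal (exp (- l * x)) * ennreal (exp ((l * s)\<^sup>2 / 2 * (1 + 3 * \<bar>l * s\<bar>) * v))"
    by (intro mult_left_mono mgf_upper_T) (use l s in \<open>auto simp: abs_mult\<close>)
  also have "(l * s)\<^sup>2 = l\<^sup>2"
    using s by (metis mult_1_right power2_abs power_mult_distrib power_one)
  also have "\<bar>l * s\<bar> = l" using l s by (simp add: abs_mult)
  finally show ?thesis
    by (simp add: emeasure_eq_measure ennreal_mult[symmetric] exp_add[symmetric])
qed

lemma v_nonneg: "0 \<le> v" and v_le_m: "v \<le> m"
  unfolding v_def m_def
  using q_bounds summable_qq summable_q
  by (auto intro!: suminf_nonneg suminf_le mult_left_le)

end

section \<open>A lower bound of Kolmogorov type for tail probabilities\<close>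

context prob_space
begin

text \<open>Tilting by \<open>exp (l * Y)\<close> concentrates \<open>Y\<close> near \<open>l * v\<close>; the parts outside
  \<open>[(1 - d) * l * v, (1 + d) * l * v]\<close> are removed by Chernoff's bound.\<close>

lemma kolmogorov_lower_tail:
  fixes Y :: "'a \<Rightarrow> real" and v d l :: real
  assumes [measurable]: "Y \<in> borel_measurable M"
    and int: "\<And>l. \<bar>l\<bar> \<le> 1 \<Longrightarrow> integrable M (\<lambda>\<omega>. exp (l * Y \<omega>))"
    and lower: "\<And>l. \<bar>l\<bar> \<le> 1 \<Longrightarrow> exp (l\<^sup>2 / 2 * (1 - 3 * \<bar>l\<bar>) * v) \<le> expectation (\<lambda>\<omega>. exp (l * Y \<omega>))"
    and upper: "\<And>l. \<bar>l\<bar> \<le> 1 \<Longrightarrow> expectation (\<lambda>\<omega>. exp (l * Y \<omega>)) \<le> exp (l\<^sup>2 / 2 * (1 + 3 * \<bar>l\<bar>) * v)"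
    and v: "0 \<le> v" and d: "0 < d" "d \<le> 1" and l: "0 < l" "60 * l \<le> d\<^sup>2"
    and large: "ln 4 \<le> l\<^sup>2 * v * d\<^sup>2 / 4"
  shows "exp (- (l\<^sup>2 / 2 * v * (1 + 3 * d))) / 2 \<le> \<P>(\<omega> in M. (1 - d) * l * v \<le> Y \<omega>)"
proof -
  define a where "a = (1 - d) * l * v"
  define b where "b = (1 + d) * l * v"
  have d2: "d\<^sup>2 \<le> 1" "d\<^sup>2 \<le> d" using d power_decreasing[of 1 2 d] by (auto simp: power_le_one)
  have l1: "60 * l \<le> 1" "60 * l \<le> d" using l d2 by auto
  define w where "w = l\<^sup>2 / 2 * v"
  have w: "0 \<le> w" using v by (simp add: w_def)
  \<comment> \<open>Shifting the tilt from l to l - d * l or l + d * l trades the event Y < a or Y >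
    b for a deterministic factor, so that only the assumed moment bounds are needed.\<close>
  define lo where "lo = l - d * l"
  define hi where "hi = l + d * l"
  have dl: "0 \<le> d * l" "d * l \<le> l" using d l by auto
  have lo: "0 \<le> lo" "lo \<le> l" "\<bar>lo\<bar> \<le> 1" and hi: "0 \<le> hi" "hi \<le> 2 * l" "\<bar>hi\<bar> \<le> 1"
    using dl l l1 unfolding lo_def hi_def by linarith+
  have l': "\<bar>l\<bar> \<le> 1" using l1 l by auto
  \<comment> \<open>The first two terms will each be at most a quarter of the lower bound for the
    expectation of exp (l * Y). Half of it is left for the third term, which comes from replacing Y
    by b on [a, b].\<close>
  have pw: "exp (l * Y \<omega>) \<le> exp (d * l * a) * exp (lo * Y \<omega>)
      + exp (- (d * l * b)) * exp (hi * Y \<omega>) + exp (l * b) * indicator {\<omega> \<in> space M. a \<le> Y \<omega>} \<omega>"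
    if "\<omega> \<in> space M" for \<omega>
  proof -
    consider "Y \<omega> < a" | "b < Y \<omega>" | "a \<le> Y \<omega>" "Y \<omega> \<le> b" by linarith
    then show ?thesis
    proof cases
      case 1
      have "d * l * Y \<omega> \<le> d * l * a" using 1 dl by (intro mult_left_mono) auto
      then have "exp (l * Y \<omega>) \<le> exp (d * l * a) * exp (lo * Y \<omega>)"
        by (simp add: exp_add[symmetric] lo_def algebra_simps)
      then show ?thesis by (simp add: add_increasing2)
    next
      case 2
      have "d * l * b \<le> d * l * Y \<omega>" using 2 dl by (intro mult_left_mono) auto
      then have "exp (l * Y \<omega>) \<le> exp (- (d * l * b)) * exp (hi * Y \<omega>)"
        by (simp add: exp_add[symmetric] hi_def algebra_simps)
      then show ?thesis by (simp add: add_increasing2 add_increasing)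
    next
      case 3
      then have "exp (l * Y \<omega>) \<le> exp (l * b)" using l by simp
      then show ?thesis using 3 that by (simp add: add_increasing)
    qed
  qed
  have indI: "integrable M (indicator {\<omega> \<in> space M. a \<le> Y \<omega>} :: 'a \<Rightarrow> real)"
    by (rule integrable_real_indicator) (auto simp: emeasure_eq_measure)
  have "expectation (\<lambda>\<omega>. exp (l * Y \<omega>)) \<le> expectation (\<lambda>\<omega>. exp (d * l * a) * exp (lo * Y \<omega>)
      + exp (- (d * l * b)) * exp (hi * Y \<omega>) + exp (l * b) * indicator {\<omega> \<in> space M. a \<le> Y \<omega>} \<omega>)"
    by (intro integral_mono pw int l' Bochner_Integration.integrable_add integrable_mult_right lo hi indI)
  also have "\<dots> = exp (d * l * a) * expectation (\<lambda>\<omega>. exp (lo * Y \<omega>))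
      + exp (- (d * l * b)) * expectation (\<lambda>\<omega>. exp (hi * Y \<omega>)) + exp (l * b) * \<P>(\<omega> in M. a \<le> Y \<omega>)"
    using int[OF lo(3)] int[OF hi(3)] by (simp add: indI)
  finally have main: "expectation (\<lambda>\<omega>. exp (l * Y \<omega>)) \<le> \<dots>" .
  have loE: "exp (d * l * a) * expectation (\<lambda>\<omega>. exp (lo * Y \<omega>)) \<le> exp (w * (1 - 3 * l)) / 4"
  proof -
    have "exp (d * l * a) * expectation (\<lambda>\<omega>. exp (lo * Y \<omega>)) \<le> exp (d * l * a) * exp (lo\<^sup>2 / 2 * (1 + 3 * \<bar>lo\<bar>) * v)"
      by (intro mult_left_mono upper lo) auto
    also have "\<dots> = exp (w * (2 * d * (1 - d) + (1 - d)\<^sup>2 * (1 + 3 * lo)))"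
      using lo by (simp add: exp_add[symmetric] a_def lo_def w_def power2_eq_square field_simps)
    also have "\<dots> \<le> exp (w * (1 - 3 * l - d\<^sup>2 / 2))"
    proof -
      have "(1 - d)\<^sup>2 * (1 + 3 * lo) \<le> (1 - d)\<^sup>2 + 1 * (3 * l)"
        unfolding distrib_left using lo d by (intro add_mono mult_mono) (auto simp: power_le_one)
      then have "2 * d * (1 - d) + (1 - d)\<^sup>2 * (1 + 3 * lo) \<le> 1 - d\<^sup>2 + 3 * l"
        by (simp add: power2_eq_square algebra_simps)
      also have "\<dots> \<le> 1 - 3 * l - d\<^sup>2 / 2" using l by simp
      finally show ?thesis using w by (simp add: mult_left_mono)
    qed
    also have "\<dots> \<le> exp (w * (1 - 3 * l) - ln 4)"
      using large by (simp add: w_def field_simps)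
    finally show ?thesis by (simp add: exp_diff)
  qed
  have hiE: "exp (- (d * l * b)) * expectation (\<lambda>\<omega>. exp (hi * Y \<omega>)) \<le> exp (w * (1 - 3 * l)) / 4"
  proof -
    have "exp (- (d * l * b)) * expectation (\<lambda>\<omega>. exp (hi * Y \<omega>)) \<le> exp (- (d * l * b)) * exp (hi\<^sup>2 / 2 * (1 + 3 * \<bar>hi\<bar>) * v)"
      by (intro mult_left_mono upper hi) auto
    also have "\<dots> = exp (w * (- 2 * d * (1 + d) + (1 + d)\<^sup>2 * (1 + 3 * hi)))"
      using hi by (simp add: exp_add[symmetric] b_def hi_def w_def power2_eq_square field_simps)
    also have "\<dots> \<le> exp (w * (1 - 3 * l - d\<^sup>2 / 2))"
    proof -
      have "(1 + d)\<^sup>2 \<le> 2\<^sup>2" using d by (intro power_mono) auto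
      then have "(1 + d)\<^sup>2 * (3 * hi) \<le> 4 * (6 * l)"
        using hi l by (intro mult_mono[of _ 4 "3 * hi" "6 * l"]) auto
      then have "(1 + d)\<^sup>2 * (1 + 3 * hi) \<le> (1 + d)\<^sup>2 + 4 * (6 * l)"
        by (simp add: distrib_left)
      then have "- 2 * d * (1 + d) + (1 + d)\<^sup>2 * (1 + 3 * hi) \<le> 1 - d\<^sup>2 + 24 * l"
        by (simp add: power2_eq_square algebra_simps)
      \<comment> \<open>This needs 27 * l \<le> d^2 / 2, the strictest demand on l and the origin of
        the 60. The remaining w * d^2 / 2 is at least ln 4 by \<open>large\<close>.\<close>
      also have "\<dots> \<le> 1 - 3 * l - d\<^sup>2 / 2" using l by simp
      finally show ?thesis using w by (simp add: mult_left_mono)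
    qed
    also have "\<dots> \<le> exp (w * (1 - 3 * l) - ln 4)"
      using large by (simp add: w_def field_simps)
    finally show ?thesis by (simp add: exp_diff)
  qed
  have "exp (w * (1 - 3 * l)) = exp (l\<^sup>2 / 2 * (1 - 3 * \<bar>l\<bar>) * v)"
    using l by (simp add: w_def mult_ac)
  also have "\<dots> \<le> exp (w * (1 - 3 * l)) / 2 + exp (l * b) * \<P>(\<omega> in M. a \<le> Y \<omega>)"
    using lower[OF l'] main loE hiE by linarith
  finally have "exp (w * (1 - 3 * l)) / 2 \<le> exp (l * b) * \<P>(\<omega> in M. a \<le> Y \<omega>)" by simp
  then have "exp (- (l * b)) * (exp (w * (1 - 3 * l)) / 2)
      \<le> exp (- (l * b)) * (exp (l * b) * \<P>(\<omega> in M. a \<le> Y \<omega>))"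
    by (rule mult_left_mono) simp
  also have "\<dots> = \<P>(\<omega> in M. a \<le> Y \<omega>)" by (simp add: mult.assoc[symmetric] exp_add[symmetric])
  also have "exp (- (l * b)) * (exp (w * (1 - 3 * l)) / 2) = exp (- (w * (1 + 2 * d + 3 * l))) / 2"
    by (simp add: exp_add[symmetric] b_def w_def power2_eq_square field_simps)
  finally have fin: "exp (- (w * (1 + 2 * d + 3 * l))) / 2 \<le> \<P>(\<omega> in M. a \<le> Y \<omega>)" .
  have "w * (1 + 2 * d + 3 * l) \<le> w * (1 + 3 * d)" using l1 w l by (intro mult_left_mono) auto
  then have "exp (- (w * (1 + 3 * d))) / 2 \<le> exp (- (w * (1 + 2 * d + 3 * l))) / 2" by simp
  with fin show ?thesis unfolding a_def w_def by linarith
qed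

end

section \<open>Independence\<close>

context prob_space
begin

lemma indep_vars_finite_subsets:
  assumes "\<And>J. finite J \<Longrightarrow> J \<subseteq> I \<Longrightarrow> indep_vars M' X J"
  shows "indep_vars M' X I"
proof -
  have "random_variable (M' i) (X i)" if "i \<in> I" for i
    using assms[of "{i}"] that by (auto simp: indep_vars_def)
  moreover have "indep_sets (\<lambda>i. sigma_sets (space M) {X i -` A \<inter> space M |A. A \<in> sets (M' i)}) I"
    using assms by (subst indep_sets_finite_index_sets) (auto simp: indep_vars_def)
  ultimately show ?thesis by (auto simp: indep_vars_def)
qed

text \<open>Ball counts equal sums of interval counts only for almost every outcome, so independence
  has to be moved along almost sure equality.\<close>

lemma indep_vars_cong_AE:
  assumes Y: "indep_vars M' Y I"
    and Z: "\<And>i. i \<in> I \<Longrightarrow> random_variable (M' i) (Z i)"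
    and eq: "\<And>i. i \<in> I \<Longrightarrow> AE \<omega> in M. Y i \<omega> = Z i \<omega>"
  shows "indep_vars M' Z I"
  unfolding indep_vars_def2
proof (intro conjI ballI)
  show "random_variable (M' i) (Z i)" if "i \<in> I" for i using Z[OF that] .
  have Ym: "\<And>i. i \<in> I \<Longrightarrow> random_variable (M' i) (Y i)" using Y by (auto simp: indep_vars_def)
  show "indep_sets (\<lambda>i. {Z i -` A \<inter> space M |A. A \<in> sets (M' i)}) I"
  proof (rule indep_setsI)
    fix i assume "i \<in> I"
    then show "{Z i -` A \<inter> space M |A. A \<in> sets (M' i)} \<subseteq> events"
      using Z by (auto intro: measurable_sets)
  next
    fix A J assume J: "J \<noteq> {}" "J \<subseteq> I" "finite J"
      and A: "\<forall>j\<in>J. A j \<in> {Z j -` A \<inter> space M |A. A \<in> sets (M' j)}"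
    then have "\<forall>j\<in>J. \<exists>B. B \<in> sets (M' j) \<and> A j = Z j -` B \<inter> space M" by blast
    then obtain B where B: "\<And>j. j \<in> J \<Longrightarrow> B j \<in> sets (M' j)"
      and AB: "\<And>j. j \<in> J \<Longrightarrow> A j = Z j -` B j \<inter> space M" by metis
    have ms: "Z j -` B j \<inter> space M \<in> events" "Y j -` B j \<inter> space M \<in> events" if "j \<in> J" for j
      using Z Ym B J that by (auto intro!: measurable_sets)
    have AEJ: "AE \<omega> in M. \<forall>j\<in>J. Y j \<omega> = Z j \<omega>"
      using J eq by (intro AE_finite_allI) auto
    have "prob (\<Inter>j\<in>J. A j) = prob (\<Inter>j\<in>J. Z j -` B j \<inter> space M)" using AB by simp
    also have "\<dots> = prob (\<Inter>j\<in>J. Y j -` B j \<inter> space M)"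
      using AEJ by (intro measure_eq_AE sets.finite_INT J ms) (auto elim!: eventually_mono)
    also have "\<dots> = (\<Prod>j\<in>J. prob (Y j -` B j \<inter> space M))"
      by (rule indep_varsD[OF Y J(1,3,2) B])
    also have "\<dots> = (\<Prod>j\<in>J. prob (A j))"
    proof (rule prod.cong[OF refl])
      fix j assume j: "j \<in> J"
      have "prob (Y j -` B j \<inter> space M) = prob (Z j -` B j \<inter> space M)"
        using eq[OF subsetD[OF J(2) j]] j by (intro measure_eq_AE ms) (auto elim!: eventually_mono)
      then show "prob (Y j -` B j \<inter> space M) = prob (A j)" using AB j by simp
    qed
    finally show "prob (\<Inter>j\<in>J. A j) = (\<Prod>j\<in>J. prob (A j))" .
  qed
qed

text \<open>On a countable product a measure is determined by its point masses, so the product form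
  of the joint mass function identifies the joint law. Both conclusions follow from that; in
  particular the marginals need not be known in advance.\<close>

lemma
  fixes C :: "'i \<Rightarrow> 'a \<Rightarrow> 'b::countable" and P :: "'i \<Rightarrow> 'b pmf"
  assumes I: "finite I" and C: "\<And>i. random_variable (count_space UNIV) (C i)"
    and eq: "\<And>x. \<P>(\<omega> in M. \<forall>i\<in>I. C i \<omega> = x i) = (\<Prod>i\<in>I. pmf (P i) (x i))"
  shows indep_vars_discreteI: "indep_vars (\<lambda>_. count_space UNIV) C I"
    and distr_discreteI: "i \<in> I \<Longrightarrow> distr M (count_space UNIV) (C i) = measure_pmf (P i)"
proof -
  let ?\<Pi> = "PiM I (\<lambda>_. count_space UNIV :: 'b measure)"
  interpret P: finite_product_prob_space "\<lambda>i. measure_pmf (P i)" I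
    by unfold_locales (rule I)
  have Ps: "?\<Pi> = count_space (PiE I (\<lambda>_. UNIV))"
    by (rule count_space_PiM_finite) (auto simp: I)
  have sP: "sets (PiM I (\<lambda>i. measure_pmf (P i))) = sets ?\<Pi>" by (intro sets_PiM_cong) auto
  have joint: "distr M ?\<Pi> (\<lambda>\<omega>. \<lambda>i\<in>I. C i \<omega>) = PiM I (\<lambda>i. measure_pmf (P i))"
  proof (rule measure_eqI_countable)
    show "sets (distr M ?\<Pi> (\<lambda>\<omega>. \<lambda>i\<in>I. C i \<omega>)) = Pow (PiE I (\<lambda>_. UNIV))"
      by (simp add: Ps)
    show "sets (PiM I (\<lambda>i. measure_pmf (P i))) = Pow (PiE I (\<lambda>_. UNIV))"
      unfolding sP by (simp add: Ps)
    show "countable (PiE I (\<lambda>_. UNIV :: 'b set))"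
      by (rule countable_PiE) (auto simp: I)
    fix x :: "'i \<Rightarrow> 'b" assume x: "x \<in> PiE I (\<lambda>_. UNIV)"
    have xs: "{x} = PiE I (\<lambda>i. {x i})" using x by (auto simp: PiE_iff extensional_def fun_eq_iff) metis+
    have "emeasure (distr M ?\<Pi> (\<lambda>\<omega>. \<lambda>i\<in>I. C i \<omega>)) {x}
        = emeasure M ((\<lambda>\<omega>. \<lambda>i\<in>I. C i \<omega>) -` {x} \<inter> space M)"
    proof (rule emeasure_distr)
      show "(\<lambda>\<omega>. \<lambda>i\<in>I. C i \<omega>) \<in> M \<rightarrow>\<^sub>M ?\<Pi>" using C by (intro measurable_restrict) auto
      show "{x} \<in> sets ?\<Pi>" using x unfolding Ps by simp
    qed
    also have "(\<lambda>\<omega>. \<lambda>i\<in>I. C i \<omega>) -` {x} \<inter> space M = {\<omega>\<in>space M. \<forall>i\<in>I. C i \<omega> = x i}"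
      using x by (auto simp: PiE_def extensional_def fun_eq_iff)
    also have "emeasure M \<dots> = ennreal (\<Prod>i\<in>I. pmf (P i) (x i))"
      by (simp add: emeasure_eq_measure eq)
    also have "\<dots> = (\<Prod>i\<in>I. emeasure (measure_pmf (P i)) {x i})"
      by (simp add: prod_ennreal emeasure_pmf_single)
    also have "\<dots> = emeasure (PiM I (\<lambda>i. measure_pmf (P i))) {x}"
      unfolding xs by (rule P.measure_times[symmetric]) auto
    finally show "emeasure (distr M ?\<Pi> (\<lambda>\<omega>. \<lambda>i\<in>I. C i \<omega>)) {x} = \<dots>" .
  qed
  show marg: "distr M (count_space UNIV) (C i) = measure_pmf (P i)" if i: "i \<in> I" for i
  proof -
    have "measure_pmf (P i) = distr (PiM I (\<lambda>i. measure_pmf (P i))) (measure_pmf (P i)) (\<lambda>x. x i)"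
      by (rule distr_PiM_component[symmetric]) (use I i in \<open>auto intro: measure_pmf.prob_space_axioms\<close>)
    also have "\<dots> = distr (distr M ?\<Pi> (\<lambda>\<omega>. \<lambda>i\<in>I. C i \<omega>)) (count_space UNIV) (\<lambda>x. x i)"
      unfolding joint by (intro distr_cong) auto
    also have "\<dots> = distr M (count_space UNIV) ((\<lambda>x. x i) \<circ> (\<lambda>\<omega>. \<lambda>i\<in>I. C i \<omega>))"
      by (rule distr_distr) (use i C in auto)
    also have "\<dots> = distr M (count_space UNIV) (C i)"
      by (intro distr_cong) (use i in auto)
    finally show ?thesis by simp
  qed
  show "indep_vars (\<lambda>_. count_space UNIV) C I"
  proof (cases "I = {}")
    case True
    then show ?thesis by (auto simp: indep_vars_def indep_sets_def)
  next
    case False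
    have "(\<Pi>\<^sub>M i\<in>I. distr M (count_space UNIV) (C i)) = PiM I (\<lambda>i. measure_pmf (P i))"
      by (intro PiM_cong) (auto simp: marg)
    with False show ?thesis
      by (subst indep_vars_iff_distr_eq_PiM) (auto simp: C joint)
  qed
qed

text \<open>By 1 - q \<le> exp (- q), the probability that nothing occurs from N on is at most the
  exponential of minus any partial sum from N, and these sums are unbounded.\<close>

lemma borel_cantelli_2:
  fixes E :: "nat \<Rightarrow> 'a \<Rightarrow> bool"
  assumes E: "indep_vars (\<lambda>_. count_space UNIV) E UNIV"
    and div: "\<not> summable (\<lambda>n. \<P>(\<omega> in M. E n \<omega>))"
  shows "AE \<omega> in M. \<exists>\<^sub>F n in sequentially. E n \<omega>"
proof -
  have [measurable]: "E n \<in> M \<rightarrow>\<^sub>M count_space UNIV" for n using E by (auto simp: indep_vars_def)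
  define q where "q n = \<P>(\<omega> in M. E n \<omega>)" for n
  have "AE \<omega> in M. \<exists>n\<ge>N. E n \<omega>" for N
  proof -
    have bound: "\<P>(\<omega> in M. \<forall>n\<ge>N. \<not> E n \<omega>) \<le> exp (- (\<Sum>n=N..<N+k. q n))" if "k > 0" for k
    proof -
      have "\<P>(\<omega> in M. \<forall>n\<ge>N. \<not> E n \<omega>) \<le> prob (\<Inter>n\<in>{N..<N+k}. E n -` {False} \<inter> space M)"
      proof (rule finite_measure_mono)
        show "{\<omega> \<in> space M. \<forall>n\<ge>N. \<not> E n \<omega>} \<subseteq> (\<Inter>n\<in>{N..<N+k}. E n -` {False} \<inter> space M)"
          by (intro subsetI INT_I IntI vimageI2) simp_all
        have "E n -` {False} \<inter> space M \<in> events" for n by (rule measurable_sets[where A="count_space UNIV"]) simp_all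
        then show "(\<Inter>n\<in>{N..<N+k}. E n -` {False} \<inter> space M) \<in> events"
          using that by (intro sets.finite_INT) simp_all
      qed
      also have "\<dots> = (\<Prod>n\<in>{N..<N+k}. prob (E n -` {False} \<inter> space M))"
        by (rule indep_varsD[OF E]) (use that in auto)
      also have "\<dots> = (\<Prod>n\<in>{N..<N+k}. 1 - q n)"
      proof (rule prod.cong[OF refl])
        fix n
        have "E n -` {False} \<inter> space M = space M - {\<omega>\<in>space M. E n \<omega>}" by auto
        then show "prob (E n -` {False} \<inter> space M) = 1 - q n"
          by (simp add: prob_compl q_def)
      qed
      also have "\<dots> \<le> (\<Prod>n\<in>{N..<N+k}. exp (- q n))"
      proof (intro prod_mono conjI)
        fix n show "0 \<le> 1 - q n" by (simp add: q_def)
        show "1 - q n \<le> exp (- q n)" using exp_ge_add_one_self[of "- q n"] by simp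
      qed
      also have "\<dots> = exp (- (\<Sum>n=N..<N+k. q n))" by (subst sum_negf[symmetric]) (simp add: exp_sum del: sum_negf)
      finally show ?thesis .
    qed
    have "\<P>(\<omega> in M. \<forall>n\<ge>N. \<not> E n \<omega>) \<le> 0"
    proof (rule field_le_epsilon)
      fix e :: real assume e: "0 < e"
      have "\<exists>k>0. - ln e < (\<Sum>n=N..<N+k. q n)"
      proof (rule ccontr)
        assume "\<not> ?thesis"
        then have le: "(\<Sum>n=N..<N+k. q n) \<le> - ln e" if "k > 0" for k using that by (auto simp: not_less dest: spec[of _ k])
        have "summable (\<lambda>i. q (i + N))"
        proof (rule bounded_imp_summable)
          show "0 \<le> q (n + N)" for n by (simp add: q_def)
          fix n
          have "(\<Sum>i\<le>n. q (i + N)) = (\<Sum>i=N..<N + Suc n. q i)"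
            by (rule sum.reindex_bij_witness[of _ "\<lambda>i. i - N" "\<lambda>i. i + N"]) auto
          then show "(\<Sum>i\<le>n. q (i + N)) \<le> - ln e"
            using le[of "Suc n"] by simp
        qed
        then have "summable q" by (simp add: summable_iff_shift)
        with div show False by (simp add: q_def[abs_def])
      qed
      then obtain k where k: "k > 0" "- ln e < (\<Sum>n=N..<N+k. q n)" by blast
      have "exp (- (\<Sum>n=N..<N+k. q n)) \<le> exp (ln e)" using k(2) by (subst exp_le_cancel_iff) linarith
      with bound[OF k(1)] e show "\<P>(\<omega> in M. \<forall>n\<ge>N. \<not> E n \<omega>) \<le> 0 + e" by simp
    qed
    then have "\<P>(\<omega> in M. \<forall>n\<ge>N. \<not> E n \<omega>) = 0" by (simp add: measure_le_0_iff)
    moreover have "{\<omega> \<in> space M. \<forall>n\<ge>N. \<not> E n \<omega>} \<in> events" by measurable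
    ultimately have "AE \<omega> in M. \<omega> \<notin> {\<omega> \<in> space M. \<forall>n\<ge>N. \<not> E n \<omega>}"
      by (simp only: prob_eq_0)
    then show ?thesis using AE_space by eventually_elim auto
  qed
  then have "AE \<omega> in M. \<forall>N. \<exists>n\<ge>N. E n \<omega>" unfolding AE_all_countable by blast
  then show ?thesis by (simp only: frequently_sequentially)
qed

end

text \<open>Poisson distributions including rate \<open>0\<close>, needed for boxes of probability \<open>0\<close>.\<close>

definition pois :: "real \<Rightarrow> nat pmf" where
  "pois r = (if r > 0 then poisson_pmf r else return_pmf 0)"

lemma pmf_pois: "0 \<le> r \<Longrightarrow> pmf (pois r) c = r ^ c / fact c * exp (- r)"
  by (cases c) (auto simp: pois_def)

section \<open>Multinomial thinning of Poisson arrivals\<close>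

text \<open>Multinomial probabilities of the counts \<open>c\<close> on \<open>F\<close>; all boxes outside \<open>F\<close> are merged into one class.\<close>

definition multinomial :: "(nat \<Rightarrow> real) \<Rightarrow> nat set \<Rightarrow> nat \<Rightarrow> (nat \<Rightarrow> nat) \<Rightarrow> real" where
  "multinomial q F n c = (if sum c F \<le> n
     then fact n * (\<Prod>k\<in>F. q k ^ c k / fact (c k)) * (1 - sum q F) ^ (n - sum c F) / fact (n - sum c F)
     else 0)"

lemma multinomial_0: "finite F \<Longrightarrow> multinomial q F 0 c = of_bool (\<forall>k\<in>F. c k = 0)"
  by (auto simp: multinomial_def intro!: prod.neutral)

text \<open>Conditioning on the last ball: it lies in some box l of F, whose count was then one
  smaller, or outside F. The case c l = 0 is cut out because c l - 1 is truncated at 0.\<close>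

lemma multinomial_Suc:
  assumes F: "finite F"
  shows "multinomial q F (Suc n) c
    = (\<Sum>l\<in>F. if c l = 0 then 0 else q l * multinomial q F n (c(l := c l - 1)))
      + (1 - sum q F) * multinomial q F n c"
proof -
  define W where "W = (\<Prod>k\<in>F. q k ^ c k / fact (c k))"
  define p0 where "p0 = 1 - sum q F"
  have sum1: "sum (c(l := c l - 1)) F = sum c F - 1" "0 < sum c F" if "l \<in> F" "c l \<noteq> 0" for l
  proof -
    have "sum c F = c l + sum c (F - {l})" using F that by (simp add: sum.remove)
    moreover have "sum (c(l := c l - 1)) F = c l - 1 + sum c (F - {l})"
      using F that by (simp add: sum.remove[of F l] cong: sum.cong_simp)
    ultimately show "sum (c(l := c l - 1)) F = sum c F - 1" "0 < sum c F" using that by auto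
  qed
  \<comment> \<open>Lowering c l by one trades a factor q l for the factor c l; summed over F these
    factors give \<open>sum c F\<close>.\<close>
  have W1: "q l * (\<Prod>k\<in>F. q k ^ (c(l := c l - 1)) k / fact ((c(l := c l - 1)) k)) = real (c l) * W"
    if "l \<in> F" "c l \<noteq> 0" for l
  proof -
    have "\<exists>d. c l = Suc d" using that(2) by (rule not0_implies_Suc)
    then obtain d where d: "c l = Suc d" ..
    define P where "P = (\<Prod>k\<in>F. q k ^ (c(l := c l - 1)) k / fact ((c(l := c l - 1)) k))"
    define R where "R = (\<Prod>k\<in>F - {l}. q k ^ c k / fact (c k))"
    have "P = q l ^ d / fact d * R"
      using F that d by (simp add: P_def R_def prod.remove[of F l] cong: prod.cong_simp)
    moreover have "W = q l ^ Suc d / fact (Suc d) * R"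
      using F that d by (simp add: W_def R_def prod.remove[of F l])
    moreover have "real (Suc d) / fact (Suc d) = (1 / fact d :: real)"
      by (simp add: fact_Suc del: of_nat_Suc)
    then have "real (Suc d) * (q l ^ Suc d / fact (Suc d) * R) = q l ^ Suc d * R * (1 / fact d)"
      by (metis (no_types, lifting) mult.assoc mult.commute times_divide_eq_right)
    ultimately have "q l * P = real (c l) * W" unfolding d by simp
    then show ?thesis unfolding P_def .
  qed
  have S: "(\<Sum>l\<in>F. if c l = 0 then 0 else q l * multinomial q F n (c(l := c l - 1)))
      = (if sum c F \<le> Suc n then real (sum c F) * (fact n * W * p0 ^ (Suc n - sum c F) / fact (Suc n - sum c F)) else 0)"
  proof -
    have "(\<Sum>l\<in>F. if c l = 0 then 0 else q l * multinomial q F n (c(l := c l - 1)))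
        = (\<Sum>l\<in>F. real (c l) * (if sum c F \<le> Suc n then fact n * W * p0 ^ (Suc n - sum c F) / fact (Suc n - sum c F) else 0))"
    proof (rule sum.cong[OF refl])
      fix l assume l: "l \<in> F"
      show "(if c l = 0 then 0 else q l * multinomial q F n (c(l := c l - 1)))
        = real (c l) * (if sum c F \<le> Suc n then fact n * W * p0 ^ (Suc n - sum c F) / fact (Suc n - sum c F) else 0)"
      proof (cases "c l = 0")
        case False
        have e: "n - (sum c F - 1) = Suc n - sum c F" "sum c F - 1 \<le> n \<longleftrightarrow> sum c F \<le> Suc n"
          using sum1(2)[OF l False] by auto
        have "q l * multinomial q F n (c(l := c l - 1))
          = (if sum c F \<le> Suc n then fact n * (q l * (\<Prod>k\<in>F. q k ^ (c(l := c l - 1)) k / fact ((c(l := c l - 1)) k)))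
              * p0 ^ (Suc n - sum c F) / fact (Suc n - sum c F) else 0)"
          unfolding multinomial_def sum1(1)[OF l False] e p0_def by simp
        then show ?thesis unfolding W1[OF l False] using False by simp
      qed simp
    qed
    then show ?thesis by (simp add: sum_distrib_right[symmetric])
  qed
  show ?thesis
  proof (cases "sum c F \<le> Suc n")
    case False
    then show ?thesis unfolding S by (simp add: multinomial_def)
  next
    case True
    show ?thesis
    proof (cases "sum c F = Suc n")
      \<comment> \<open>All n + 1 balls lie in F here, so the term for a last ball outside F must
        vanish; it does by the default value 0 of \<open>multinomial\<close>.\<close>
      case eq: True
      then show ?thesis unfolding S by (simp add: multinomial_def W_def[symmetric])
    next
      case False
      then obtain r where r: "n = sum c F + r" using True le_Suc_ex[of "sum c F" n] by auto
      have R: "multinomial q F n c = fact n * W * p0 ^ r / fact r"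
        using r by (simp add: multinomial_def W_def p0_def)
      have L: "multinomial q F (Suc n) c = fact (Suc n) * W * p0 ^ Suc r / fact (Suc r)"
        using r by (simp add: multinomial_def W_def p0_def)
      define x where "x = real (Suc r)"
      have x: "x \<noteq> 0" by (simp add: x_def)
      \<comment> \<open>After cancellation the claim reads n + 1 = \<open>sum c F\<close> + (r +
        1).\<close>
      have N: "fact (Suc n) = (real (sum c F) + x) * fact n" "fact (Suc r) = x * fact r"
        using r by (simp_all add: x_def)
      have e: "Suc n - sum c F = Suc r" using r by simp
      show ?thesis unfolding S R L p0_def[symmetric] if_P[OF True] e N using x
        by (simp add: field_simps)
    qed
  qed
qed

text \<open>Terms with n below \<open>sum c F\<close> vanish, and the shifted series is the
  exponential series of r * p0. It cancels the part of exp (- r) that belongs to boxes outside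
  F.\<close>

lemma multinomial_poisson_mixture:
  assumes F: "finite F" and q: "\<And>k. 0 \<le> q k" "sum q F \<le> 1" and r: "0 < r"
  shows "(\<integral>\<^sup>+n. ennreal (multinomial q F n c) \<partial>measure_pmf (poisson_pmf r))
    = ennreal (\<Prod>k\<in>F. pmf (pois (q k * r)) (c k))"
proof -
  define W where "W = (\<Prod>k\<in>F. q k ^ c k / fact (c k))"
  define p0 where "p0 = 1 - sum q F"
  define s where "s = sum c F"
  define f where "f n = pmf (poisson_pmf r) n * multinomial q F n c" for n
  have W0: "0 \<le> W" unfolding W_def using q by (intro prod_nonneg) auto
  have m0: "0 \<le> multinomial q F n c" for n
    using W0 q by (simp add: multinomial_def W_def[symmetric])
  have f0: "0 \<le> f n" for n using m0 by (simp add: f_def)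
  have "(\<lambda>n. (r * p0) ^ n /\<^sub>R fact n) sums exp (r * p0)" by (rule exp_converges)
  from sums_mult[OF this, of "exp (- r) * r ^ s * W"]
  have "(\<lambda>n. f (n + s)) sums (exp (- r) * r ^ s * W * exp (r * p0))"
    by (rule sums_cong[THEN iffD1, rotated])
       (use r in \<open>simp add: f_def multinomial_def W_def[symmetric] s_def[symmetric] p0_def[symmetric]
          power_mult_distrib power_add field_simps scaleR_conv_of_real\<close>)
  then have S: "f sums (exp (- r) * r ^ s * W * exp (r * p0))"
    by (subst (asm) sums_zero_iff_shift) (auto simp: f_def multinomial_def s_def)
  have "(\<integral>\<^sup>+n. ennreal (multinomial q F n c) \<partial>measure_pmf (poisson_pmf r)) = (\<integral>\<^sup>+n. ennreal (f n) \<partial>count_space UNIV)"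
    unfolding nn_integral_measure_pmf f_def by (simp add: ennreal_mult' m0 del: pmf_poisson)
  also have "\<dots> = ennreal (exp (- r) * r ^ s * W * exp (r * p0))"
    unfolding nn_integral_count_space_nat by (rule suminf_ennreal_eq[OF f0 S])
  also have "exp (- r) * r ^ s * W * exp (r * p0) = (\<Prod>k\<in>F. pmf (pois (q k * r)) (c k))"
  proof -
    have "(\<Prod>k\<in>F. pmf (pois (q k * r)) (c k)) = (\<Prod>k\<in>F. r ^ c k * (q k ^ c k / fact (c k)) * exp (- (q k * r)))"
      using q r by (intro prod.cong) (auto simp: pmf_pois power_mult_distrib)
    also have "\<dots> = r ^ s * W * exp (- (sum q F * r))"
      unfolding prod.distrib s_def W_def power_sum sum_distrib_right sum_negf[symmetric] exp_sum[OF F] ..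
    also have "exp (- (sum q F * r)) = exp (- r) * exp (r * p0)"
      by (simp add: exp_add[symmetric] p0_def algebra_simps)
    finally show ?thesis by simp
  qed
  finally show ?thesis .
qed

section \<open>Independence of the box counts\<close>

context poissonized_karlin_scheme
begin

abbreviation \<pi> where "\<pi> \<equiv> balls_in_box S X"

lemma S_measurable [measurable]: "S n \<in> borel_measurable M"
  by (rule arrival_measurable)

lemma X_measurable [measurable]: "X n \<in> M \<rightarrow>\<^sub>M count_space UNIV"
  using boxes_independent by (auto simp: indep_vars_def)

lemma arrivals_measurable [measurable]: "arrivals_upto S t \<in> M \<rightarrow>\<^sub>M count_space UNIV"
  unfolding arrivals_upto_def[abs_def] by measurable

lemma balls_measurable [measurable]: "\<pi> k t \<in> M \<rightarrow>\<^sub>M count_space UNIV"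
  unfolding balls_in_box_def[abs_def] by measurable

text \<open>Pathwise statements are made on this almost sure event. Off it, \<open>card\<close> may
  return 0 for infinite sets and counts need not be monotone.\<close>

definition regular :: "'a \<Rightarrow> bool" where
  "regular \<omega> \<longleftrightarrow> 0 < S 0 \<omega> \<and> strict_mono (\<lambda>n. S n \<omega>) \<and> filterlim (\<lambda>n. S n \<omega>) at_top sequentially"

lemma AE_regular: "AE \<omega> in M. regular \<omega>"
  using arrival_order by (simp add: regular_def)

lemma regular_finite: "regular \<omega> \<Longrightarrow> finite {n. S n \<omega> \<le> t}"
proof -
  assume "regular \<omega>"
  then have "eventually (\<lambda>n. S n \<omega> > t) sequentially"
    by (auto simp: regular_def filterlim_at_top_dense)
  then obtain N where "\<And>n. n \<ge> N \<Longrightarrow> S n \<omega> > t" by (auto simp: eventually_sequentially)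
  then have "{n. S n \<omega> \<le> t} \<subseteq> {..<N}" by (auto simp: not_less[symmetric])
  then show ?thesis by (rule finite_subset) simp
qed

text \<open>Arrival indices up to t form a finite initial segment of the naturals, hence are the
  indices below its cardinality. This turns conditions on times into conditions on the indices of
  \<open>X\<close>.\<close>

lemma regular_arrivals:
  assumes "regular \<omega>"
  shows "S n \<omega> \<le> t \<longleftrightarrow> n < arrivals_upto S t \<omega>"
proof -
  let ?A = "{n. S n \<omega> \<le> t}"
  have down: "m \<in> ?A" if "n \<in> ?A" "m \<le> n" for m n
  proof -
    have "mono (\<lambda>n. S n \<omega>)" using assms by (auto simp: regular_def intro: strict_mono_mono)
    from monoD[OF this that(2)] have "S m \<omega> \<le> S n \<omega>" .
    then show ?thesis using that by simp
  qed
  have fin: "finite ?A" by (rule regular_finite[OF assms])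
  have "n \<in> ?A \<longleftrightarrow> n < card ?A"
  proof
    assume "n \<in> ?A"
    then have "{..n} \<subseteq> ?A" using down by auto
    then have "card {..n} \<le> card ?A" by (intro card_mono fin)
    then show "n < card ?A" by simp
  next
    assume n: "n < card ?A"
    show "n \<in> ?A"
    proof (rule ccontr)
      assume "n \<notin> ?A"
      then have "?A \<subseteq> {..<n}" using down by (force simp: not_less[symmetric])
      then have "card ?A \<le> card {..<n}" by (intro card_mono) auto
      with n show False by simp
    qed
  qed
  then show ?thesis by (simp add: arrivals_upto_def)
qed

lemma regular_arrivals_mono: "regular \<omega> \<Longrightarrow> s \<le> t \<Longrightarrow> arrivals_upto S s \<omega> \<le> arrivals_upto S t \<omega>"
  unfolding arrivals_upto_def by (intro card_mono regular_finite) auto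

lemma regular_arrivals_0: "regular \<omega> \<Longrightarrow> arrivals_upto S 0 \<omega> = 0"
  using regular_arrivals[of \<omega> 0 0] by (auto simp: regular_def not_le)

lemma regular_finite_balls: "regular \<omega> \<Longrightarrow> finite {n. S n \<omega> \<le> t \<and> P n}"
  by (rule finite_subset[OF _ regular_finite]) auto

lemma regular_balls_mono: "regular \<omega> \<Longrightarrow> s \<le> t \<Longrightarrow> \<pi> k s \<omega> \<le> \<pi> k t \<omega>"
  unfolding balls_in_box_def by (intro card_mono regular_finite_balls) auto

lemma regular_finite_occupied: "regular \<omega> \<Longrightarrow> finite {k. 1 \<le> \<pi> k t \<omega>}"
proof -
  assume r: "regular \<omega>"
  have "{k. 1 \<le> \<pi> k t \<omega>} \<subseteq> (\<lambda>n. X n \<omega>) ` {n. S n \<omega> \<le> t}"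
    by (auto simp: balls_in_box_def card_gt_0_iff Suc_le_eq)
  then show ?thesis by (rule finite_subset) (use regular_finite[OF r] in auto)
qed

lemma sum_pmf_le_1: "finite F \<Longrightarrow> sum (pmf p) F \<le> 1"
  by (simp add: measure_measure_pmf_finite[symmetric])

text \<open>Induction on the number of balls, splitting off the last one, \<open>X (a + n)\<close>,
  which is independent of its predecessors; the recursion is that of \<open>multinomial_Suc\<close>.
  The offset a is arbitrary because the blocks between two times start at a random index that is
  frozen later.\<close>

lemma block_counts:
  assumes F: "finite F"
  shows "\<P>(\<omega> in M. \<forall>k\<in>F. (\<Sum>r=a..<a+n. of_bool (X r \<omega> = k)) = c k) = multinomial (pmf p) F n c"
proof (induction n arbitrary: c)
  case 0
  have "{\<omega> \<in> space M. \<forall>k\<in>F. (\<Sum>r=a..<a+0. of_bool (X r \<omega> = k)) = c k} = (if \<forall>k\<in>F. c k = 0 then space M else {})"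
    by auto
  then show ?case by (simp add: multinomial_0 F prob_space del: sum_of_bool_eq)
next
  case (Suc n)
  define Ev where "Ev c = {\<omega>\<in>space M. \<forall>k\<in>F. (\<Sum>r=a..<a+n. of_bool (X r \<omega> = k)) = c k}" for c :: "nat \<Rightarrow> nat"
  let ?A = "{a..<a+n}"
  let ?PA = "PiM ?A (\<lambda>_. count_space UNIV :: nat measure)"
  define XA where "XA d = {x\<in>space ?PA. \<forall>k\<in>F. (\<Sum>r=a..<a+n. of_bool (x r = k)) = d k}" for d :: "nat \<Rightarrow> nat"
  have XAm: "XA d \<in> sets ?PA" for d
  proof -
    have "?PA = count_space (PiE ?A (\<lambda>_. UNIV))" by (rule count_space_PiM_finite) auto
    then show ?thesis by (simp add: XA_def)
  qed
  have 1: "(\<lambda>\<omega>. \<lambda>i\<in>?A. X i \<omega>) -` XA d \<inter> space M = Ev d" for d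
    by (auto simp: XA_def Ev_def space_PiM simp del: sum_of_bool_eq)
  have Evm [measurable]: "Ev d \<in> events" for d
    unfolding 1[symmetric] by (rule measurable_sets[OF _ XAm]) measurable
  have ind: "prob (Ev d \<inter> {\<omega>\<in>space M. X (a + n) \<omega> \<in> B}) = multinomial (pmf p) F n d * measure (measure_pmf p) B" for d B
  proof -
    let ?PB = "PiM {a+n} (\<lambda>_. count_space UNIV :: nat measure)"
    have iv: "indep_var ?PA (\<lambda>\<omega>. \<lambda>i\<in>?A. X i \<omega>) ?PB (\<lambda>\<omega>. \<lambda>i\<in>{a+n}. X i \<omega>)"
      by (rule indep_var_restrict[OF boxes_independent]) auto
    define XB where "XB = {x\<in>space ?PB. x (a + n) \<in> B}"
    have XBm: "XB \<in> sets ?PB"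
    proof -
      have "?PB = count_space (PiE {a+n} (\<lambda>_. UNIV))" by (rule count_space_PiM_finite) auto
      then show ?thesis by (simp add: XB_def)
    qed
    have 2: "(\<lambda>\<omega>. \<lambda>i\<in>{a+n}. X i \<omega>) -` XB \<inter> space M = {\<omega>\<in>space M. X (a + n) \<omega> \<in> B}"
      by (auto simp: XB_def space_PiM)
    have "(\<lambda>\<omega>. (\<lambda>i\<in>?A. X i \<omega>, \<lambda>i\<in>{a+n}. X i \<omega>)) -` (XA d \<times> XB) \<inter> space M
        = ((\<lambda>\<omega>. \<lambda>i\<in>?A. X i \<omega>) -` XA d \<inter> space M) \<inter> ((\<lambda>\<omega>. \<lambda>i\<in>{a+n}. X i \<omega>) -` XB \<inter> space M)" by blast
    with indep_varD[OF iv XAm[of d] XBm]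
    have "prob (Ev d \<inter> {\<omega>\<in>space M. X (a + n) \<omega> \<in> B}) = prob (Ev d) * prob {\<omega>\<in>space M. X (a + n) \<omega> \<in> B}"
      unfolding 1 2 by simp
    also have "prob (Ev d) = multinomial (pmf p) F n d" unfolding Ev_def by (rule Suc.IH)
    also have "prob {\<omega>\<in>space M. X (a + n) \<omega> \<in> B} = measure (distr M (count_space UNIV) (X (a + n))) B"
      by (subst measure_distr) (auto intro!: arg_cong[where f=prob])
    also have "\<dots> = measure (measure_pmf p) B" by (simp add: box_distribution)
    finally show ?thesis .
  qed
  \<comment> \<open>\<open>G l\<close> and \<open>G0\<close> partition the event by the box of the
    last ball; a last ball in box l contradicts c l = 0.\<close>
  define G where "G l = (if c l = 0 then {} else Ev (c(l := c l - 1)) \<inter> {\<omega>\<in>space M. X (a + n) \<omega> \<in> {l}})" for l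
  define G0 where "G0 = Ev c \<inter> {\<omega>\<in>space M. X (a + n) \<omega> \<in> - F}"
  have "{\<omega> \<in> space M. \<forall>k\<in>F. (\<Sum>r=a..<a+Suc n. of_bool (X r \<omega> = k)) = c k} = (\<Union>l\<in>F. G l) \<union> G0" (is "?L = ?R")
  proof (rule set_eqI)
    fix \<omega>
    define cnt where "cnt k = (\<Sum>r=a..<a+n. of_bool (X r \<omega> = k) :: nat)" for k
    define l where "l = X (a + n) \<omega>"
    have cntS: "(\<Sum>r=a..<a+Suc n. of_bool (X r \<omega> = k) :: nat) = cnt k + of_bool (l = k)" for k
      unfolding cnt_def l_def by (simp del: sum_of_bool_eq)
    have L: "\<omega> \<in> ?L \<longleftrightarrow> \<omega> \<in> space M \<and> (\<forall>k\<in>F. cnt k + of_bool (l = k) = c k)"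
      by (simp only: mem_Collect_eq cntS)
    have E: "\<omega> \<in> Ev d \<longleftrightarrow> \<omega> \<in> space M \<and> (\<forall>k\<in>F. cnt k = d k)" for d
      by (simp only: Ev_def mem_Collect_eq cnt_def)
    have G0: "\<omega> \<in> G0 \<longleftrightarrow> \<omega> \<in> space M \<and> (\<forall>k\<in>F. cnt k = c k) \<and> l \<notin> F"
      by (auto simp: G0_def E l_def)
    have Gl: "\<omega> \<in> G j \<longleftrightarrow> \<omega> \<in> space M \<and> l = j \<and> c j \<noteq> 0 \<and> (\<forall>k\<in>F. cnt k = (c(j := c j - 1)) k)" for j
      by (auto simp: G_def E l_def)
    have R: "\<omega> \<in> ?R \<longleftrightarrow> (l \<in> F \<and> \<omega> \<in> G l) \<or> \<omega> \<in> G0"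
      using Gl by auto
    show "\<omega> \<in> ?L \<longleftrightarrow> \<omega> \<in> ?R"
    proof (cases "l \<in> F")
      case True
      have "cnt k + of_bool (l = k) = c k \<longleftrightarrow> (k = l \<longrightarrow> c l \<noteq> 0) \<and> cnt k = (c(l := c l - 1)) k" for k
        by auto
      then show ?thesis unfolding L R Gl G0 using True by blast
    next
      case False
      then have "of_bool (l = k) = (0::nat)" if "k \<in> F" for k using that by auto
      then show ?thesis unfolding L R Gl G0 using False by simp
    qed
  qed
  then have "\<P>(\<omega> in M. \<forall>k\<in>F. (\<Sum>r=a..<a+Suc n. of_bool (X r \<omega> = k)) = c k) = prob ((\<Union>l\<in>F. G l) \<union> G0)" by simp
  also have "\<dots> = prob (\<Union>l\<in>F. G l) + prob G0"
    by (rule finite_measure_Union) (use F in \<open>auto simp: G_def G0_def\<close>)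
  also have "prob (\<Union>l\<in>F. G l) = (\<Sum>l\<in>F. prob (G l))"
    by (rule finite_measure_finite_Union)
       (use F in \<open>auto simp: G_def disjoint_family_on_def split: if_splits\<close>)
  also have "\<dots> = (\<Sum>l\<in>F. if c l = 0 then 0 else pmf p l * multinomial (pmf p) F n (c(l := c l - 1)))"
    by (intro sum.cong refl) (simp add: G_def ind measure_pmf_single del: insert_iff singleton_iff)
  also have "prob G0 = (1 - sum (pmf p) F) * multinomial (pmf p) F n c"
  proof -
    have "measure (measure_pmf p) (- F) = 1 - sum (pmf p) F"
      using measure_pmf.prob_compl[of F p] by (simp add: Compl_eq_Diff_UNIV measure_measure_pmf_finite F)
    then show ?thesis unfolding G0_def ind by simp
  qed
  finally show ?case by (simp only: multinomial_Suc[OF F])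
qed

text \<open>Disjoint index ranges of an independent sequence are independent, and within one range
  \<open>block_counts\<close> applies with its offset.\<close>

lemma consecutive_block_counts:
  fixes a :: "nat \<Rightarrow> nat"
  assumes F: "finite F" and a: "\<And>i. i < m \<Longrightarrow> a i \<le> a (Suc i)"
  shows "\<P>(\<omega> in M. \<forall>i<m. \<forall>k\<in>F. card {n. a i \<le> n \<and> n < a (Suc i) \<and> X n \<omega> = k} = c k i)
    = (\<Prod>i<m. multinomial (pmf p) F (a (Suc i) - a i) (\<lambda>k. c k i))"
proof (cases "m = 0")
  case True
  then show ?thesis by (simp add: prob_space)
next
  case False
  let ?K = "\<lambda>i. {a i..<a (Suc i)}"
  let ?P = "\<lambda>i. PiM (?K i) (\<lambda>_. count_space UNIV :: nat measure)"
  have mono: "a i \<le> a j" if "i \<le> j" "j \<le> m" for i j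
    using that by (induction j rule: dec_induct) (auto intro: order_trans[OF _ a])
  have disj: "disjoint_family_on ?K {..<m}"
  proof (unfold disjoint_family_on_def, intro ballI impI)
    fix i j assume "i \<in> {..<m}" "j \<in> {..<m}" "i \<noteq> j"
    then have "a (Suc i) \<le> a j \<or> a (Suc j) \<le> a i"
      using mono[of "Suc i" j] mono[of "Suc j" i] by (cases "i < j") auto
    then show "?K i \<inter> ?K j = {}" by auto
  qed
  have iv: "indep_vars ?P (\<lambda>i \<omega>. \<lambda>n\<in>?K i. X n \<omega>) {..<m}"
    by (rule indep_vars_restrict[OF boxes_independent _ disj]) auto
  define A where "A i = {x\<in>space (?P i). \<forall>k\<in>F. card {n\<in>?K i. x n = k} = c k i}" for i
  have Am: "A i \<in> sets (?P i)" for i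
  proof -
    have "?P i = count_space (PiE (?K i) (\<lambda>_. UNIV))" by (rule count_space_PiM_finite) auto
    then show ?thesis by (simp add: A_def)
  qed
  have A: "(\<lambda>\<omega>. \<lambda>n\<in>?K i. X n \<omega>) -` A i \<inter> space M
      = {\<omega>\<in>space M. \<forall>k\<in>F. card {n\<in>?K i. X n \<omega> = k} = c k i}" for i
    by (auto simp: A_def space_PiM cong: conj_cong)
  have "{\<omega>\<in>space M. \<forall>i<m. \<forall>k\<in>F. card {n. a i \<le> n \<and> n < a (Suc i) \<and> X n \<omega> = k} = c k i}
      = (\<Inter>i\<in>{..<m}. (\<lambda>\<omega>. \<lambda>n\<in>?K i. X n \<omega>) -` A i \<inter> space M)"
    unfolding A using False by auto
  then have "\<P>(\<omega> in M. \<forall>i<m. \<forall>k\<in>F. card {n. a i \<le> n \<and> n < a (Suc i) \<and> X n \<omega> = k} = c k i)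
      = prob (\<Inter>i\<in>{..<m}. (\<lambda>\<omega>. \<lambda>n\<in>?K i. X n \<omega>) -` A i \<inter> space M)" by (simp only:)
  also have "\<dots> = (\<Prod>i<m. prob ((\<lambda>\<omega>. \<lambda>n\<in>?K i. X n \<omega>) -` A i \<inter> space M))"
    by (rule indep_varsD_finite[OF iv]) (use False Am in auto)
  also have "\<dots> = (\<Prod>i<m. multinomial (pmf p) F (a (Suc i) - a i) (\<lambda>k. c k i))"
  proof (rule prod.cong[OF refl])
    fix i assume "i \<in> {..<m}"
    then have i: "a i + (a (Suc i) - a i) = a (Suc i)" using a by auto
    have "card {n\<in>?K i. X n \<omega> = k} = (\<Sum>r=a i..<a (Suc i). of_bool (X r \<omega> = k))" for \<omega> k
      by (simp add: Int_def)
    then show "prob ((\<lambda>\<omega>. \<lambda>n\<in>?K i. X n \<omega>) -` A i \<inter> space M) = multinomial (pmf p) F (a (Suc i) - a i) (\<lambda>k. c k i)"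
      unfolding A using block_counts[OF F, where a="a i" and n="a (Suc i) - a i" and c="\<lambda>k. c k i"] by (simp only: i)
  qed
  finally show ?thesis .
qed

text \<open>For regular outcomes, the number of balls falling into box k during (t i, t (Suc i)]. It
  is expressed by arrival indices, so that once the arrivals are fixed it depends on
  \<open>X\<close> over a fixed index range.\<close>

definition interval_count :: "(nat \<Rightarrow> real) \<Rightarrow> nat \<times> nat \<Rightarrow> 'a \<Rightarrow> nat" where
  "interval_count t = (\<lambda>(k, i) \<omega>. card {n. arrivals_upto S (t i) \<omega> \<le> n \<and> n < arrivals_upto S (t (Suc i)) \<omega> \<and> X n \<omega> = k})"

lemma interval_count_measurable [measurable]: "interval_count t ki \<in> M \<rightarrow>\<^sub>M count_space UNIV"
proof (cases ki)
  case (Pair k i)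
  have "(\<lambda>\<omega>. card {n. arrivals_upto S (t i) \<omega> \<le> n \<and> n < arrivals_upto S (t (Suc i)) \<omega> \<and> X n \<omega> = k})
      \<in> M \<rightarrow>\<^sub>M count_space UNIV" by measurable
  then show ?thesis by (simp add: Pair interval_count_def)
qed

text \<open>By Fubini the arrival times are frozen first, which gives multinomial counts over
  disjoint index ranges. Then the arrivals are averaged: independent increments factor the
  expectation over i, and each factor is a Poisson mixture of multinomials.\<close>

lemma interval_counts_joint:
  assumes F: "finite F" and t: "strict_mono t" "t 0 = 0"
  shows "\<P>(\<omega> in M. \<forall>ki\<in>F \<times> {..<m}. interval_count t ki \<omega> = c ki)
    = (\<Prod>ki\<in>F \<times> {..<m}. pmf (pois (pmf p (fst ki) * (t (Suc (snd ki)) - t (snd ki)))) (c ki))"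
proof -
  let ?Seq = "PiM UNIV (\<lambda>_. borel) :: (nat \<Rightarrow> real) measure"
  let ?S = "\<lambda>\<omega> n. S n \<omega>" and ?X = "\<lambda>\<omega> n. real (X n \<omega>)"
  define N where "N s i = card {n. s n \<le> t i}" for s :: "nat \<Rightarrow> real" and i
  have N: "N (?S \<omega>) i = arrivals_upto S (t i) \<omega>" for \<omega> i by (simp add: N_def arrivals_upto_def)
  define A where "A = {z\<in>space (?Seq \<Otimes>\<^sub>M ?Seq). \<forall>i\<in>{..<m}. \<forall>k\<in>F.
      card {n. N (fst z) i \<le> n \<and> n < N (fst z) (Suc i) \<and> snd z n = real k} = c (k, i)}"
  have Nm [measurable]: "(\<lambda>z. N (fst z) i) \<in> ?Seq \<Otimes>\<^sub>M ?Seq \<rightarrow>\<^sub>M count_space UNIV" for i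
    unfolding N_def by measurable
  have Am [measurable]: "A \<in> sets (?Seq \<Otimes>\<^sub>M ?Seq)"
    unfolding A_def using F by measurable
  have Sm [measurable]: "?S \<in> M \<rightarrow>\<^sub>M ?Seq" and Xm [measurable]: "?X \<in> M \<rightarrow>\<^sub>M ?Seq"
    using indep_var_rv1[OF boxes_independent_of_arrivals] indep_var_rv2[OF boxes_independent_of_arrivals] by auto
  have joint: "distr M ?Seq ?S \<Otimes>\<^sub>M distr M ?Seq ?X = distr M (?Seq \<Otimes>\<^sub>M ?Seq) (\<lambda>\<omega>. (?S \<omega>, ?X \<omega>))"
    using boxes_independent_of_arrivals by (simp add: indep_var_distribution_eq)
  interpret DX: prob_space "distr M ?Seq ?X" by (rule prob_space_distr) (rule Xm)
  define U where "U i n = multinomial (pmf p) F n (\<lambda>k. c (k, i))" for i n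
  have U0: "0 \<le> U i n" for i n
    unfolding U_def multinomial_def using sum_pmf_le_1[OF F]
    by (auto intro!: mult_nonneg_nonneg divide_nonneg_nonneg prod_nonneg)
  have "{\<omega>\<in>space M. \<forall>ki\<in>F \<times> {..<m}. interval_count t ki \<omega> = c ki} = (\<lambda>\<omega>. (?S \<omega>, ?X \<omega>)) -` A \<inter> space M"
    by (auto simp: A_def N interval_count_def space_pair_measure space_PiM)
  then have "emeasure M {\<omega>\<in>space M. \<forall>ki\<in>F \<times> {..<m}. interval_count t ki \<omega> = c ki}
      = emeasure (distr M (?Seq \<Otimes>\<^sub>M ?Seq) (\<lambda>\<omega>. (?S \<omega>, ?X \<omega>))) A"
    by (simp add: emeasure_distr)
  also have "\<dots> = (\<integral>\<^sup>+s. emeasure (distr M ?Seq ?X) (Pair s -` A) \<partial>distr M ?Seq ?S)"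
    unfolding joint[symmetric] by (rule DX.emeasure_pair_measure_alt) simp
  also have "\<dots> = (\<integral>\<^sup>+\<omega>. emeasure (distr M ?Seq ?X) (Pair (?S \<omega>) -` A) \<partial>M)"
    by (rule nn_integral_distr) (auto intro!: DX.measurable_emeasure_Pair)
  also have "\<dots> = (\<integral>\<^sup>+\<omega>. (\<Prod>i<m. ennreal (U i (arrivals_upto S (t (Suc i)) \<omega> - arrivals_upto S (t i) \<omega>))) \<partial>M)"
  proof (rule nn_integral_cong_AE)
    show "AE \<omega> in M. emeasure (distr M ?Seq ?X) (Pair (?S \<omega>) -` A)
        = (\<Prod>i<m. ennreal (U i (arrivals_upto S (t (Suc i)) \<omega> - arrivals_upto S (t i) \<omega>)))"
      using AE_regular
    proof eventually_elim
      case (elim \<omega>)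
      let ?a = "\<lambda>i. arrivals_upto S (t i) \<omega>"
      \<comment> \<open>Only the arrivals of this outcome are frozen; the boxes are drawn afresh.
        Regularity makes the index ranges consecutive.\<close>
      have "emeasure (distr M ?Seq ?X) (Pair (?S \<omega>) -` A) = emeasure M (?X -` (Pair (?S \<omega>) -` A) \<inter> space M)"
        by (rule emeasure_distr) (use Am in \<open>auto intro: sets_Pair1\<close>)
      also have "?X -` (Pair (?S \<omega>) -` A) \<inter> space M
          = {\<omega>'\<in>space M. \<forall>i<m. \<forall>k\<in>F. card {n. ?a i \<le> n \<and> n < ?a (Suc i) \<and> X n \<omega>' = k} = c (k, i)}"
        by (auto simp: A_def N space_pair_measure space_PiM)
      also have "emeasure M \<dots> = ennreal (\<Prod>i<m. U i (?a (Suc i) - ?a i))"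
        unfolding emeasure_eq_measure U_def
        by (subst consecutive_block_counts[OF F, where c="\<lambda>k i. c (k, i)"])
           (use elim t in \<open>auto intro!: regular_arrivals_mono simp: strict_mono_less_eq\<close>)
      finally show ?case by (simp add: prod_ennreal U0)
    qed
  qed
  also have "\<dots> = (\<Prod>i<m. \<integral>\<^sup>+\<omega>. ennreal (U i (arrivals_upto S (t (Suc i)) \<omega> - arrivals_upto S (t i) \<omega>)) \<partial>M)"
  proof (rule indep_vars_nn_integral)
    have "indep_vars (\<lambda>_. count_space UNIV) (\<lambda>i \<omega>. arrivals_upto S (t (Suc i)) \<omega> - arrivals_upto S (t i) \<omega>) UNIV"
      using t by (intro independent_increments) auto
    from indep_vars_compose2[OF this, of "\<lambda>i n. ennreal (U i n)" "\<lambda>_. borel"]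
    show "indep_vars (\<lambda>_. borel) (\<lambda>i \<omega>. ennreal (U i (arrivals_upto S (t (Suc i)) \<omega> - arrivals_upto S (t i) \<omega>))) {..<m}"
      by (auto intro: indep_vars_subset)
  qed auto
  also have "\<dots> = (\<Prod>i<m. ennreal (\<Prod>k\<in>F. pmf (pois (pmf p k * (t (Suc i) - t i))) (c (k, i))))"
  proof (rule prod.cong[OF refl])
    fix i
    have ti: "0 \<le> t i" "t i < t (Suc i)"
      using t strict_mono_less_eq[OF t(1), of 0 i] strict_mono_less[OF t(1), of i "Suc i"] by auto
    have "(\<integral>\<^sup>+\<omega>. ennreal (U i (arrivals_upto S (t (Suc i)) \<omega> - arrivals_upto S (t i) \<omega>)) \<partial>M)
        = (\<integral>\<^sup>+n. ennreal (U i n) \<partial>distr M (count_space UNIV) (\<lambda>\<omega>. arrivals_upto S (t (Suc i)) \<omega> - arrivals_upto S (t i) \<omega>))"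
      by (subst nn_integral_distr) auto
    also have "\<dots> = (\<integral>\<^sup>+n. ennreal (U i n) \<partial>measure_pmf (poisson_pmf (t (Suc i) - t i)))"
      using poisson_increments[OF ti] by simp
    also have "\<dots> = ennreal (\<Prod>k\<in>F. pmf (pois (pmf p k * (t (Suc i) - t i))) (c (k, i)))"
      unfolding U_def using ti sum_pmf_le_1[OF F] by (intro multinomial_poisson_mixture F) auto
    finally show "(\<integral>\<^sup>+\<omega>. ennreal (U i (arrivals_upto S (t (Suc i)) \<omega> - arrivals_upto S (t i) \<omega>)) \<partial>M) = \<dots>" .
  qed
  also have "\<dots> = ennreal (\<Prod>i<m. \<Prod>k\<in>F. pmf (pois (pmf p k * (t (Suc i) - t i))) (c (k, i)))"
    by (intro prod_ennreal prod_nonneg) auto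
  also have "(\<Prod>i<m. \<Prod>k\<in>F. pmf (pois (pmf p k * (t (Suc i) - t i))) (c (k, i)))
      = (\<Prod>ki\<in>F \<times> {..<m}. pmf (pois (pmf p (fst ki) * (t (Suc (snd ki)) - t (snd ki)))) (c ki))"
    by (subst prod.swap) (simp add: prod.cartesian_product case_prod_beta)
  finally show ?thesis by (simp add: emeasure_eq_measure prod_nonneg)
qed

lemma indep_interval_counts:
  fixes t :: "nat \<Rightarrow> real"
  assumes t: "strict_mono t" "t 0 = 0"
  shows "indep_vars (\<lambda>_. count_space UNIV) (interval_count t) UNIV"
proof (rule indep_vars_finite_subsets)
  fix J :: "(nat \<times> nat) set" assume J: "finite J"
  \<comment> \<open>\<open>insert 0\<close> keeps \<open>Max\<close> defined for empty J.\<close>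
  define m where "m = Suc (Max (insert 0 (snd ` J)))"
  have "J \<subseteq> fst ` J \<times> {..<m}"
  proof
    fix x assume x: "x \<in> J"
    then have "snd x \<le> Max (insert 0 (snd ` J))" using J by (intro Max_ge) auto
    then show "x \<in> fst ` J \<times> {..<m}" using x by (auto simp: m_def mem_Times_iff)
  qed
  moreover have "indep_vars (\<lambda>_. count_space UNIV) (interval_count t) (fst ` J \<times> {..<m})"
    using J by (intro indep_vars_discreteI[OF _ _ interval_counts_joint[OF _ t]]) auto
  ultimately show "indep_vars (\<lambda>_. count_space UNIV) (interval_count t) J"
    by (rule indep_vars_subset[rotated])
qed

lemma distr_interval_count:
  fixes t :: "nat \<Rightarrow> real"
  assumes t: "strict_mono t" "t 0 = 0"
  shows "distr M (count_space UNIV) (interval_count t (k, i)) = measure_pmf (pois (pmf p k * (t (Suc i) - t i)))"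
  using distr_discreteI[OF _ _ interval_counts_joint[of "{k}" t "Suc i", OF _ t], of "(k, i)"] by simp

lemma regular_balls_eq_sum:
  fixes t :: "nat \<Rightarrow> real"
  assumes w: "regular \<omega>" and t: "strict_mono t" "t 0 = 0"
  shows "\<pi> k (t m) \<omega> = (\<Sum>i<m. interval_count t (k, i) \<omega>)"
proof (induction m)
  case 0
  have "{n. S n \<omega> \<le> 0 \<and> X n \<omega> = k} = {}"
    using regular_arrivals[OF w, of _ 0] regular_arrivals_0[OF w] by auto
  then show ?case by (simp only: t(2) balls_in_box_def card.empty lessThan_0 sum.empty)
next
  case (Suc m)
  have "{n. S n \<omega> \<le> t (Suc m) \<and> X n \<omega> = k} = {n. S n \<omega> \<le> t m \<and> X n \<omega> = k} \<union>
      {n. arrivals_upto S (t m) \<omega> \<le> n \<and> n < arrivals_upto S (t (Suc m)) \<omega> \<and> X n \<omega> = k}"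
    using regular_arrivals_mono[OF w, of "t m" "t (Suc m)"] strict_mono_less_eq[OF t(1), of m "Suc m"]
    by (auto simp: regular_arrivals[OF w])
  moreover have "card \<dots> = card {n. S n \<omega> \<le> t m \<and> X n \<omega> = k}
      + card {n. arrivals_upto S (t m) \<omega> \<le> n \<and> n < arrivals_upto S (t (Suc m)) \<omega> \<and> X n \<omega> = k}"
    by (rule card_Un_disjoint) (auto simp: regular_arrivals[OF w])
  ultimately show ?case using Suc by (simp add: balls_in_box_def interval_count_def)
qed

text \<open>Regroups the interval counts by box. Independence of paths along one sequence is enough:
  later uses involve a single time, two times, or one time of a geometric sequence for each
  box.\<close>

lemma indep_box_paths:
  fixes t :: "nat \<Rightarrow> real"
  assumes t: "strict_mono t" "t 0 = 0"
  shows "indep_vars (\<lambda>_. PiM UNIV (\<lambda>_. count_space UNIV)) (\<lambda>k \<omega> m. \<pi> k (t m) \<omega>) UNIV"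
proof (rule indep_vars_cong_AE)
  let ?K = "\<lambda>k::nat. {k} \<times> (UNIV :: nat set)"
  have iv: "indep_vars (\<lambda>k. PiM (?K k) (\<lambda>_. count_space UNIV)) (\<lambda>k \<omega>. restrict (\<lambda>i. interval_count t i \<omega>) (?K k)) UNIV"
    by (rule indep_vars_restrict[OF indep_interval_counts[OF t]]) (auto simp: disjoint_family_on_def)
  have meas: "(\<lambda>x m. \<Sum>i<m. x (k, i)) \<in> PiM (?K k) (\<lambda>_. count_space UNIV) \<rightarrow>\<^sub>M PiM UNIV (\<lambda>_. count_space UNIV :: nat measure)" for k
  proof (rule measurable_PiM_single')
    show "(\<lambda>x. \<Sum>i<m. x (k, i)) \<in> PiM (?K k) (\<lambda>_. count_space UNIV) \<rightarrow>\<^sub>M (count_space UNIV :: nat measure)" for m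
    proof (induction m)
      case (Suc m)
      have "(\<lambda>x. x (k, m)) \<in> PiM (?K k) (\<lambda>_. count_space UNIV) \<rightarrow>\<^sub>M (count_space UNIV :: nat measure)"
        by (rule measurable_component_singleton) auto
      from measurable_compose_countable[OF measurable_compose[OF this measurable_count_space] Suc, of "\<lambda>a b. a + b"]
      show ?case by (simp add: add.commute)
    qed simp
  qed auto
  show "indep_vars (\<lambda>_. PiM UNIV (\<lambda>_. count_space UNIV)) (\<lambda>k \<omega> m. \<Sum>i<m. interval_count t (k, i) \<omega>) UNIV"
    using indep_vars_compose2[OF iv meas] by simp
  show "(\<lambda>\<omega> m. \<pi> k (t m) \<omega>) \<in> M \<rightarrow>\<^sub>M PiM UNIV (\<lambda>_. count_space UNIV)" for k
    by (rule measurable_PiM_single') auto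
  show "AE \<omega> in M. (\<lambda>m. \<Sum>i<m. interval_count t (k, i) \<omega>) = (\<lambda>m. \<pi> k (t m) \<omega>)" for k
    using AE_regular by eventually_elim (simp add: regular_balls_eq_sum t)
qed

lemma distr_balls:
  assumes t: "0 < t"
  shows "distr M (count_space UNIV) (\<pi> k t) = measure_pmf (pois (pmf p k * t))"
proof -
  \<comment> \<open>The laws of interval counts are known along strictly increasing sequences from
    0, so t is embedded in one as its first positive member.\<close>
  define u where "u i = (if i = 0 then 0 else t + real (i - 1))" for i :: nat
  have u: "strict_mono u" "u 0 = 0" "u 1 = t" using t by (auto simp: u_def strict_mono_Suc_iff of_nat_diff)
  have "AE \<omega> in M. \<pi> k t \<omega> = interval_count u (k, 0) \<omega>"
    using AE_regular by eventually_elim (use regular_balls_eq_sum[OF _ u(1,2), of _ k 1] u in simp)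
  then have "distr M (count_space UNIV) (\<pi> k t) = distr M (count_space UNIV) (interval_count u (k, 0))"
    by (intro distr_cong_AE) auto
  also have "\<dots> = measure_pmf (pois (pmf p k * t))"
    using distr_interval_count[OF u(1,2), of k 0] u by simp
  finally show ?thesis .
qed

end

section \<open>Regular variation\<close>

lemma has_bochner_integral_Gamma:
  fixes s :: real
  assumes "0 < s"
  shows "has_bochner_integral lborel (\<lambda>y. indicator {0<..} y * (y powr (s - 1) * exp (- y))) (Gamma s)"
proof (rule has_bochner_integral_nn_integral)
  have "(\<integral>\<^sup>+y. ennreal (indicator {0<..} y * (y powr (s - 1) * exp (- y))) \<partial>lborel)
      = (\<integral>\<^sup>+y. ennreal (indicator {0..} y * y powr (s - 1) / exp y) \<partial>lborel)"
    by (rule nn_integral_cong) (auto simp: indicator_def exp_minus field_simps)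
  then show "(\<integral>\<^sup>+y. ennreal (indicator {0<..} y * (y powr (s - 1) * exp (- y))) \<partial>lborel) = ennreal (Gamma s)"
    using Gamma_conv_nn_integral_real[OF assms] by simp
qed (use assms in \<open>auto intro: less_imp_le Gamma_real_pos\<close>)

lemma power_exp_le_fact:
  fixes y :: real
  assumes "0 \<le> y"
  shows "y ^ i * exp (- y) \<le> fact i"
proof -
  have "(\<lambda>n. y ^ n /\<^sub>R fact n) sums exp y" by (rule exp_converges)
  then have "y ^ i /\<^sub>R fact i \<le> exp y"
    using assms sum_le_suminf[of "\<lambda>n. y ^ n /\<^sub>R fact n" "{i}"] by (auto simp: sums_iff)
  then show ?thesis by (simp add: exp_minus field_simps scaleR_conv_of_real)
qed

lemma asymp_ratio_tendsto:
  fixes f g :: "real \<Rightarrow> real"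
  assumes f: "((\<lambda>t. f t / g t) \<longlongrightarrow> c) at_top" and c: "c \<noteq> 0" and g: "g \<sim>[at_top] h"
    and g0: "eventually (\<lambda>t. g t \<noteq> 0) at_top"
  shows "f \<sim>[at_top] (\<lambda>t. c * h t)"
proof -
  have "((\<lambda>t. f t / (c * g t)) \<longlongrightarrow> 1) at_top"
    using tendsto_mult[OF f tendsto_const[of "1 / c"]] c by (simp add: field_simps)
  then have "f \<sim>[at_top] (\<lambda>t. c * g t)" by (rule asymp_equivI')
  also have "\<dots> \<sim>[at_top] (\<lambda>t. c * h t)" by (intro asymp_equiv_intros g)
  finally show ?thesis .
qed

text \<open>A Poisson weight at j \<ge> 1 stays away from 1 uniformly in the rate: if x \<ge> 1 the
  weight at j + 1 is comparable, otherwise the one at j - 1. This bounds the variance from below by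
  a fixed fraction of the mean.\<close>

lemma pmf_pois_le:
  assumes x: "0 \<le> x" and j: "1 \<le> j"
  shows "pmf (pois x) j \<le> real (j + 1) / real (j + 2)"
proof -
  define w where "w = x ^ j / fact j"
  have w0: "0 \<le> w" using x by (simp add: w_def)
  have ex: "sum (\<lambda>n. x ^ n /\<^sub>R fact n) A \<le> exp x" if "finite A" for A
    using sum_le_suminf[of "\<lambda>n. x ^ n /\<^sub>R fact n" A] exp_converges[of x] x that
    by (auto simp: sums_iff)
  have lb: "w * (1 + 1 / real (j + 1)) \<le> exp x"
  proof (cases "1 \<le> x")
    case True
    have "w * (1 / real (j + 1)) \<le> w * (x / real (j + 1))"
      using True w0 by (intro mult_left_mono divide_right_mono) auto
    also have "\<dots> = x ^ Suc j / fact (Suc j)" by (simp add: w_def field_simps)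
    finally have "w * (1 / real (j + 1)) \<le> x ^ Suc j / fact (Suc j)" .
    moreover have "w + x ^ Suc j / fact (Suc j) \<le> exp x"
      using ex[of "{j, Suc j}"] by (simp add: w_def divide_inverse mult.commute del: fact_Suc power_Suc)
    ultimately show ?thesis unfolding distrib_left mult_1_right by linarith
  next
    case False
    obtain i where i: "j = Suc i" using j by (cases j) auto
    have "w * (1 / real (j + 1)) \<le> w * 1" using w0 by (intro mult_left_mono) auto
    also have "w * 1 \<le> x ^ i / fact i * 1"
    proof -
      have "w = x ^ i / fact i * (x / real (Suc i))" by (simp add: w_def i field_simps)
      also have "\<dots> \<le> x ^ i / fact i * 1" using False x by (intro mult_left_mono) (auto simp: field_simps)
      finally show ?thesis by simp
    qed
    finally have "w * (1 / real (j + 1)) \<le> x ^ i / fact i" by simp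
    moreover have "w + x ^ i / fact i \<le> exp x"
      using ex[of "{i, Suc i}"] by (simp add: w_def i divide_inverse mult.commute del: fact_Suc power_Suc)
    ultimately show ?thesis unfolding distrib_left mult_1_right by linarith
  qed
  have "pmf (pois x) j = w * exp (- x)" using x by (simp add: pmf_pois w_def)
  also have "\<dots> = w / exp x" by (simp add: exp_minus field_simps)
  also have "\<dots> \<le> real (j + 1) / real (j + 2)"
    using lb by (simp add: field_simps)
  finally show ?thesis .
qed

lemma pmf_pois_square:
  assumes x: "0 \<le> x"
  shows "(pmf (pois x) j)\<^sup>2 = fact (2 * j) / (2 ^ (2 * j) * (fact j)\<^sup>2) * pmf (pois (2 * x)) (2 * j)"
  using x by (simp add: pmf_pois power_mult_distrib power_even_eq power_divide exp_double field_simps power2_eq_square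
      exp_add[symmetric] power_add[symmetric] mult_2_right[symmetric])

lemma summable_pmf: "summable (pmf (p :: nat pmf))"
  using pmf_abs_summable[of p UNIV] by (simp add: abs_summable_on_nat_iff' abs_summable_equivalent)

text \<open>Regular variation enters as a limit of ratios, which removes L from the analysis; L
  returns only when the final asymptotics are stated.\<close>

locale regular_rates =
  fixes p :: "nat pmf" and \<alpha> :: real
  assumes infinite_support: "infinite {k. 0 < pmf p k}"
    and \<alpha>: "0 < \<alpha>" "\<alpha> < 1"
    and regular_variation: "\<And>c. 0 < c \<Longrightarrow> ((\<lambda>t. real (rho p (c * t)) / real (rho p t)) \<longlongrightarrow> c powr \<alpha>) at_top"
begin

definition \<rho> :: "real \<Rightarrow> real" where "\<rho> t = real (rho p t)"

text \<open>Each counted box has probability at least 1 / t, and probabilities sum to at most 1. The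
  crude bound \<open>rho_le\<close> later fixes the size of the fine grid.\<close>

lemma finite_boxes: "finite {k. 0 < pmf p k \<and> 1 / pmf p k \<le> t}"
  and rho_le: "0 \<le> t \<Longrightarrow> \<rho> t \<le> t"
proof -
  have bound: "real (card F) \<le> t" if F: "finite F" "F \<subseteq> {k. 0 < pmf p k \<and> 1 / pmf p k \<le> t}" and t: "0 \<le> t" for F t
  proof (cases "t = 0")
    case True
    then have "F = {}" using F(2) by (force simp: divide_le_0_iff)
    then show ?thesis using t by simp
  next
    case False
    then have "real (card F) * (1 / t) = (\<Sum>k\<in>F. 1 / t)" by simp
    also have "\<dots> \<le> sum (pmf p) F" using F(2) False t by (intro sum_mono) (auto simp: field_simps)
    also have "\<dots> \<le> 1" using F(1) by (simp add: measure_measure_pmf_finite[symmetric])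
    finally show ?thesis using False t by (simp add: field_simps)
  qed
  have fin: "finite {k. 0 < pmf p k \<and> 1 / pmf p k \<le> t}" for t
  proof (rule ccontr)
    assume "infinite {k. 0 < pmf p k \<and> 1 / pmf p k \<le> t}"
    then obtain F where F: "finite F" "card F = Suc (nat \<lceil>\<bar>t\<bar>\<rceil>)" "F \<subseteq> {k. 0 < pmf p k \<and> 1 / pmf p k \<le> t}"
      using infinite_arbitrarily_large by blast
    have "F \<subseteq> {k. 0 < pmf p k \<and> 1 / pmf p k \<le> \<bar>t\<bar>}" using F(3) by force
    from bound[OF F(1) this] F(2) show False by linarith
  qed
  show "finite {k. 0 < pmf p k \<and> 1 / pmf p k \<le> t}" by (rule fin)
  show "0 \<le> t \<Longrightarrow> \<rho> t \<le> t" unfolding \<rho>_def rho_def by (rule bound[OF fin]) auto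
qed

lemma rho_mono: "s \<le> t \<Longrightarrow> \<rho> s \<le> \<rho> t"
  unfolding \<rho>_def rho_def of_nat_le_iff by (rule card_mono[OF finite_boxes]) auto

lemma rho_nonneg [simp]: "0 \<le> \<rho> t"
  by (simp add: \<rho>_def)

lemma rho_at_top: "filterlim \<rho> at_top at_top"
  unfolding filterlim_at_top
proof
  fix Z :: real
  obtain F where F: "finite F" "card F = nat \<lceil>Z\<rceil>" "F \<subseteq> {k. 0 < pmf p k}"
    using infinite_arbitrarily_large[OF infinite_support] by blast
  define u where "u = (\<Sum>k\<in>F. 1 / pmf p k)"
  show "\<forall>\<^sub>F t in at_top. Z \<le> \<rho> t"
  proof (rule eventually_mono[OF eventually_ge_at_top[of u]])
    fix t assume t: "u \<le> t"
    have "F \<subseteq> {k. 0 < pmf p k \<and> 1 / pmf p k \<le> t}"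
    proof
      fix k assume k: "k \<in> F"
      then have "1 / pmf p k \<le> u" unfolding u_def using F by (intro member_le_sum) auto
      then show "k \<in> {k. 0 < pmf p k \<and> 1 / pmf p k \<le> t}" using k F(3) t by auto
    qed
    then have "card F \<le> rho p t" unfolding rho_def by (rule card_mono[OF finite_boxes])
    then show "Z \<le> \<rho> t" using F(2) unfolding \<rho>_def by linarith
  qed
qed

lemma rho_pos: "eventually (\<lambda>t. 0 < \<rho> t) at_top"
  using rho_at_top by (simp add: filterlim_at_top_dense)

lemma rho_ratio: "0 < c \<Longrightarrow> ((\<lambda>t. \<rho> (c * t) / \<rho> t) \<longlongrightarrow> c powr \<alpha>) at_top"
  using regular_variation by (simp add: \<rho>_def)

text \<open>Iterating \<rho> (2 x) \<le> 2^b \<rho> x, valid for large x since b > \<alpha>, bounds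
  \<rho> along powers of 2; rounding log 2 (1 / y) up costs one more factor 2^b. This supplies the
  integrable domination near y = 0.\<close>

lemma potter_upper:
  assumes b: "\<alpha> < b"
  shows "eventually (\<lambda>x. \<forall>y. 0 < y \<longrightarrow> y \<le> 1 \<longrightarrow> \<rho> (x / y) \<le> 2 powr b * y powr (- b) * \<rho> x) at_top"
proof -
  have b0: "0 < b" using b \<alpha> by simp
  have "eventually (\<lambda>x. \<rho> (2 * x) / \<rho> x < 2 powr b) at_top"
    by (rule order_tendstoD[OF rho_ratio]) (use b in auto)
  with rho_pos eventually_gt_at_top[of 0]
  have "eventually (\<lambda>x. 0 < x \<and> \<rho> (2 * x) \<le> 2 powr b * \<rho> x) at_top"
    by eventually_elim (auto simp: field_simps)
  then obtain x0 where x0: "\<And>x. x \<ge> x0 \<Longrightarrow> 0 < x \<and> \<rho> (2 * x) \<le> 2 powr b * \<rho> x"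
    by (auto simp: eventually_at_top_linorder)
  have iter: "\<rho> (2 ^ n * x) \<le> (2 powr b) ^ n * \<rho> x" if "x \<ge> x0" for x n
  proof (induction n)
    case (Suc n)
    have "x0 \<le> 2 ^ n * x"
    proof -
      have "0 < x" using x0[OF that] by simp
      then have "1 * x \<le> 2 ^ n * x" by (intro mult_right_mono) auto
      then show ?thesis using that by simp
    qed
    from x0[OF this] have "\<rho> (2 ^ Suc n * x) \<le> 2 powr b * \<rho> (2 ^ n * x)" by (simp add: mult.assoc)
    also have "\<dots> \<le> 2 powr b * ((2 powr b) ^ n * \<rho> x)" using Suc by (intro mult_left_mono) auto
    finally show ?case by simp
  qed simp
  show ?thesis
  proof (rule eventually_mono[OF eventually_ge_at_top[of x0]], intro allI impI)
    fix x y :: real assume x: "x0 \<le> x" and y: "0 < y" "y \<le> 1"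
    define n where "n = nat \<lceil>log 2 (1 / y)\<rceil>"
    have l0: "0 \<le> log 2 (1 / y)" using y by (simp add: zero_le_log_cancel_iff)
    have n: "log 2 (1 / y) \<le> real n" "real n \<le> log 2 (1 / y) + 1" using l0 by (auto simp: n_def)
    have "1 / y = 2 powr (log 2 (1 / y))" using y by simp
    also have "\<dots> \<le> 2 powr (real n)" using n by (intro powr_mono) auto
    finally have "1 / y \<le> 2 ^ n" by (simp add: powr_realpow)
    then have "x / y \<le> 2 ^ n * x" using x0[OF x] mult_right_mono[of "1 / y" "2 ^ n" x] by simp
    then have "\<rho> (x / y) \<le> (2 powr b) ^ n * \<rho> x" by (intro order_trans[OF rho_mono iter[OF x]])
    also have "(2 powr b) ^ n = 2 powr (b * real n)" by (simp add: powr_powr powr_realpow[symmetric])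
    also have "\<dots> * \<rho> x \<le> 2 powr (b * (log 2 (1 / y) + 1)) * \<rho> x"
      using n b0 by (intro mult_right_mono powr_mono mult_left_mono) auto
    also have "2 powr (b * (log 2 (1 / y) + 1)) = 2 powr b * (2 powr (log 2 (1 / y))) powr b"
      by (simp add: powr_powr powr_add[symmetric] algebra_simps)
    also have "2 powr (log 2 (1 / y)) = 1 / y" using y by simp
    also have "(1 / y) powr b = y powr (- b)" using y by (simp add: powr_minus powr_divide field_simps)
    finally show "\<rho> (x / y) \<le> 2 powr b * y powr (- b) * \<rho> x" .
  qed
qed

text \<open>The reverse doubling argument with an exponent below \<alpha>, rounding down. Its
  purpose is that \<rho> exceeds all powers of logarithms and that ln V is comparable to ln
  t.\<close>

lemma rho_lower: "\<exists>C>0. eventually (\<lambda>t. C * t powr (\<alpha> / 2) \<le> \<rho> t) at_top"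
proof -
  define b where "b = \<alpha> / 2"
  have b: "0 < b" "b < \<alpha>" using \<alpha> by (auto simp: b_def)
  have "eventually (\<lambda>x. 2 powr b < \<rho> (2 * x) / \<rho> x) at_top"
    by (rule order_tendstoD[OF rho_ratio]) (use b in auto)
  with rho_pos eventually_gt_at_top[of 0]
  have "eventually (\<lambda>x. 0 < x \<and> 0 < \<rho> x \<and> 2 powr b * \<rho> x \<le> \<rho> (2 * x)) at_top"
    by eventually_elim (auto simp: field_simps)
  then obtain x0 where x0: "\<And>x. x \<ge> x0 \<Longrightarrow> 0 < x \<and> 0 < \<rho> x \<and> 2 powr b * \<rho> x \<le> \<rho> (2 * x)"
    by (auto simp: eventually_at_top_linorder)
  have p0: "0 < x0" "0 < \<rho> x0" using x0[of x0] by auto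
  have iter: "(2 powr b) ^ n * \<rho> x0 \<le> \<rho> (2 ^ n * x0)" for n
  proof (induction n)
    case (Suc n)
    have "1 * x0 \<le> 2 ^ n * x0" using p0 by (intro mult_right_mono) auto
    then have x: "x0 \<le> 2 ^ n * x0" by simp
    have "(2 powr b) ^ Suc n * \<rho> x0 \<le> 2 powr b * \<rho> (2 ^ n * x0)" using Suc by simp
    also have "\<dots> \<le> \<rho> (2 ^ Suc n * x0)" using x0[OF x] by (simp add: mult.assoc)
    finally show ?case .
  qed simp
  have "eventually (\<lambda>t. (\<rho> x0 / (2 * x0) powr b) * t powr b \<le> \<rho> t) at_top"
  proof (rule eventually_mono[OF eventually_ge_at_top[of x0]])
    fix t assume t: "x0 \<le> t"
    define n where "n = nat \<lfloor>log 2 (t / x0)\<rfloor>"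
    have l0: "0 \<le> log 2 (t / x0)" using t p0 by (simp add: zero_le_log_cancel_iff)
    have n: "real n \<le> log 2 (t / x0)" "log 2 (t / x0) \<le> real n + 1" using l0 by (auto simp: n_def)
    have tx: "2 powr (log 2 (t / x0)) = t / x0" using t p0 by simp
    have "2 ^ n = 2 powr (real n)" by (simp add: powr_realpow)
    also have "\<dots> \<le> 2 powr (log 2 (t / x0))" using n by (intro powr_mono) auto
    finally have "2 ^ n * x0 \<le> t" using tx p0 by (simp add: field_simps)
    then have "(2 powr b) ^ n * \<rho> x0 \<le> \<rho> t" by (intro order_trans[OF iter rho_mono])
    moreover have "t powr b / (2 * x0) powr b \<le> (2 powr b) ^ n"
    proof -
      have "t powr b / (2 * x0) powr b = (t / x0 / 2) powr b" using t p0 by (simp add: powr_divide[symmetric] mult.commute)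
      also have "t / x0 / 2 = 2 powr (log 2 (t / x0) - 1)" by (simp add: powr_diff tx)
      also have "\<dots> powr b = 2 powr (b * (log 2 (t / x0) - 1))" by (simp add: powr_powr mult.commute)
      also have "\<dots> \<le> 2 powr (b * real n)" using n b by (intro powr_mono mult_left_mono) auto
      also have "\<dots> = (2 powr b) ^ n" by (simp add: powr_powr powr_realpow[symmetric])
      finally show ?thesis .
    qed
    then have "t powr b / (2 * x0) powr b * \<rho> x0 \<le> (2 powr b) ^ n * \<rho> x0" using p0 by (intro mult_right_mono) auto
    ultimately show "(\<rho> x0 / (2 * x0) powr b) * t powr b \<le> \<rho> t" by (simp add: field_simps)
  qed
  then show ?thesis using p0 unfolding b_def by (intro exI[of _ "\<rho> x0 / (2 * x0) powr (\<alpha> / 2)"]) auto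
qed

text \<open>Stieltjes integration by parts: \<open>\<Sum>k. f (p\<^sub>k t) = \<integral> f'(y) \<rho>(t / y) dy\<close> for \<open>f y = y ^ j * exp (- y)\<close>.\<close>

lemma sums_power_exp:
  assumes j: "1 \<le> j" and t: "0 < t"
  shows "(\<lambda>k. (pmf p k * t) ^ j * exp (- (pmf p k * t))) sums
    (\<integral>y. indicator {0<..} y * ((real j * y ^ (j - 1) - y ^ j) * exp (- y) * \<rho> (t / y)) \<partial>lborel)"
proof -
  define h where "h y = (real j * y ^ (j - 1) - y ^ j) * exp (- y)" for y :: real
  define C where "C = real j * fact (j - 1) + fact j"
  \<comment> \<open>\<open>f k\<close> integrates to the k-th term by the fundamental theorem of
    calculus, while for fixed y > 0 the sum over k counts the boxes with 1 / p_k \<le> t / y, each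
    with weight h y.\<close>
  define f where "f k y = h y * indicator {0..pmf p k * t} y" for k y
  have hb: "\<bar>h y\<bar> \<le> C" if "0 \<le> y" for y
  proof -
    have "h y = real j * (y ^ (j - 1) * exp (- y)) - y ^ j * exp (- y)" by (simp add: h_def algebra_simps)
    also have "\<bar>\<dots>\<bar> \<le> \<bar>real j * (y ^ (j - 1) * exp (- y))\<bar> + \<bar>y ^ j * exp (- y)\<bar>" by (rule abs_triangle_ineq4)
    also have "\<dots> \<le> C"
      unfolding C_def using that power_exp_le_fact[OF that, of j] power_exp_le_fact[OF that, of "j - 1"]
      by (intro add_mono) (auto simp: abs_mult intro!: mult_left_mono)
    finally show ?thesis .
  qed
  have C0: "0 \<le> C" by (simp add: C_def)
  have der: "((\<lambda>y. y ^ j * exp (- y)) has_real_derivative h y) (at y)" for y :: real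
    unfolding h_def by (auto intro!: derivative_eq_intros simp: algebra_simps)
  have cont: "isCont h y" for y
    unfolding h_def by (intro continuous_intros)
  have z0: "0 \<le> pmf p k * t" for k using t by simp
  have FTC: "has_bochner_integral lborel (f k) ((pmf p k * t) ^ j * exp (- (pmf p k * t)) - 0 ^ j * exp (- 0))" for k
    unfolding f_def by (rule has_bochner_integral_FTC_Icc_real[OF z0 der cont])
  \<comment> \<open>The boundary value 0 ^ j vanishes because j \<ge> 1.\<close>
  have int: "integrable lborel (f k)" and inte: "integral\<^sup>L lborel (f k) = (pmf p k * t) ^ j * exp (- (pmf p k * t))" for k
    using FTC[of k] j by (auto simp: has_bochner_integral_iff)
  have nb: "(\<integral>y. norm (f k y) \<partial>lborel) \<le> C * (pmf p k * t)" for k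
  proof -
    have "(\<integral>y. norm (f k y) \<partial>lborel) \<le> (\<integral>y. C * indicator {0..pmf p k * t} y \<partial>lborel)"
    proof (rule integral_mono)
      show "integrable lborel (\<lambda>y. norm (f k y))" using int by (rule integrable_norm)
      show "integrable lborel (\<lambda>y. C * indicator {0..pmf p k * t} y)"
        using z0[of k] by (intro integrable_mult_right integrable_real_indicator) auto
      show "norm (f k y) \<le> C * indicator {0..pmf p k * t} y" for y
        using hb[of y] by (auto simp: f_def indicator_def)
    qed
    also have "\<dots> = C * (pmf p k * t)" using z0[of k] by simp
    finally show ?thesis .
  qed
  \<comment> \<open>At y = 0 all indicators are 1 and the sum over k may diverge, so this null set
    is left out.\<close>
  have ptw: "(\<lambda>k. f k y) sums (indicator {0<..} y * (h y * \<rho> (t / y)))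
      \<and> summable (\<lambda>k. norm (f k y))" if y: "y \<noteq> 0" for y
  proof (cases "0 < y")
    case True
    let ?A = "{k. 0 < pmf p k \<and> 1 / pmf p k \<le> t / y}"
    have eq: "f k y = (if k \<in> ?A then h y else 0)" for k
      using True t z0[of k] pmf_nonneg[of p k]
      by (auto simp: f_def indicator_def field_simps order_le_less)
    have "(\<lambda>k. f k y) sums (\<Sum>k\<in>?A. f k y)"
      by (rule sums_finite[OF finite_boxes]) (auto simp: eq)
    also have "(\<Sum>k\<in>?A. f k y) = indicator {0<..} y * (h y * \<rho> (t / y))"
    proof -
      have "(\<Sum>k\<in>?A. f k y) = (\<Sum>k\<in>?A. h y)" by (intro sum.cong) (auto simp: eq)
      then show ?thesis using True by (simp add: \<rho>_def rho_def)
    qed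
    finally have 1: "(\<lambda>k. f k y) sums (indicator {0<..} y * (h y * \<rho> (t / y)))" .
    have "summable (\<lambda>k. norm (f k y))"
      by (rule summable_finite[OF finite_boxes]) (auto simp: eq)
    with 1 show ?thesis by blast
  next
    case False
    then have "f k y = 0" for k using y by (auto simp: f_def indicator_def)
    then show ?thesis using False by (simp add: indicator_def)
  qed
  have AE0: "AE y in lborel. y \<noteq> (0::real)" by (rule AE_lborel_singleton)
  have AEs: "AE y in lborel. summable (\<lambda>k. norm (f k y))"
    using AE0 by eventually_elim (use ptw in blast)
  \<comment> \<open>The absolute integrals are at most C * p_k * t and the probabilities are
    summable, which justifies exchanging sum and integral.\<close>
  have sums: "summable (\<lambda>k. \<integral>y. norm (f k y) \<partial>lborel)"
    by (rule summable_comparison_test'[of "\<lambda>k. C * (pmf p k * t)" 0])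
       (use nb summable_pmf in \<open>auto intro!: summable_mult summable_mult2 simp: integral_nonneg_AE\<close>)
  have "(\<lambda>k. integral\<^sup>L lborel (f k)) sums (\<integral>y. (\<Sum>k. f k y) \<partial>lborel)"
    by (rule sums_integral[OF int AEs sums])
  also have "(\<integral>y. (\<Sum>k. f k y) \<partial>lborel) = (\<integral>y. indicator {0<..} y * (h y * \<rho> (t / y)) \<partial>lborel)"
  proof (rule integral_cong_AE)
    show "(\<lambda>y. \<Sum>k. f k y) \<in> borel_measurable lborel" using int by measurable
    show m: "(\<lambda>y. indicator {0<..} y * (h y * \<rho> (t / y))) \<in> borel_measurable lborel"
    proof -
      have "mono \<rho>" by (intro monoI rho_mono)
      then have [measurable]: "\<rho> \<in> borel_measurable borel" by (rule borel_measurable_mono)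
      have [measurable]: "h \<in> borel_measurable borel"
        by (intro borel_measurable_continuous_onI continuous_at_imp_continuous_on ballI cont)
      show ?thesis by measurable
    qed
    show "AE y in lborel. (\<Sum>k. f k y) = indicator {0<..} y * (h y * \<rho> (t / y))"
      using AE0 by eventually_elim (use ptw in \<open>auto simp: sums_iff\<close>)
  qed
  finally show ?thesis unfolding inte h_def .
qed

section \<open>Mean and variance as series, and their asymptotics\<close>

definition G :: "nat \<Rightarrow> real \<Rightarrow> real" where
  "G j t = (\<Sum>k. pmf (pois (pmf p k * t)) j)"

lemma sums_G:
  assumes j: "1 \<le> j" and t: "0 < t"
  shows "(\<lambda>k. pmf (pois (pmf p k * t)) j) sums G j t"
    and "G j t = (\<integral>y. indicator {0<..} y * ((real j * y ^ (j - 1) - y ^ j) * exp (- y) * \<rho> (t / y)) \<partial>lborel) / fact j"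
proof -
  have eq: "pmf (pois (pmf p k * t)) j = (pmf p k * t) ^ j * exp (- (pmf p k * t)) / fact j" for k
    using t by (simp add: pmf_pois)
  show "(\<lambda>k. pmf (pois (pmf p k * t)) j) sums G j t"
    and "G j t = (\<integral>y. indicator {0<..} y * ((real j * y ^ (j - 1) - y ^ j) * exp (- y) * \<rho> (t / y)) \<partial>lborel) / fact j"
    using sums_divide[OF sums_power_exp[OF j t], of "fact j"] unfolding G_def eq by (auto simp: sums_iff)
qed

lemma G_nonneg: "1 \<le> j \<Longrightarrow> 0 < t \<Longrightarrow> 0 \<le> G j t"
  using sums_G(1)[of j t] by (auto simp: sums_iff G_def intro: suminf_nonneg)

lemma G_asymptotics:
  assumes j: "1 \<le> j"
  shows "((\<lambda>t. G j t / \<rho> t) \<longlongrightarrow> \<alpha> * Gamma (real j - \<alpha>) / fact j) at_top"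
proof -
  define g where "g s y = indicator {0<..} y * (y powr (s - 1) * exp (- y))" for s y :: real
  have gI: "has_bochner_integral lborel (g s) (Gamma s)" if "0 < s" for s
    unfolding g_def[abs_def] by (rule has_bochner_integral_Gamma[OF that])
  have g0: "0 \<le> g s y" for s y by (simp add: g_def)
  have gm [measurable]: "g s \<in> borel_measurable lborel" for s unfolding g_def by measurable
  have gpow: "g s y * y powr a = g (s + a) y" for s a y
    by (auto simp: g_def indicator_def powr_add[symmetric] algebra_simps)
  \<comment> \<open>b > \<alpha> is required by the Potter bound, and b < 1 \<le> j keeps y powr (j
    - b - 1) integrable at 0.\<close>
  obtain b where b: "\<alpha> < b" "b < 1" using \<alpha> dense by blast
  have h: "indicator {0<..} y * ((real j * y ^ (j - 1) - y ^ j) * exp (- y) * r) = (real j * g (real j) y - g (real j + 1) y) * r" for y r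
    using j by (auto simp: g_def indicator_def powr_realpow[symmetric] of_nat_diff algebra_simps)
  define s where "s t y = (real j * g (real j) y - g (real j + 1) y) * (\<rho> (t / y) / \<rho> t)" for t y
  define w where "w y = 2 powr b * (real j * g (real j - b) y + g (real j + 1 - b) y) + (real j * g (real j) y + g (real j + 1) y)" for y
  define f where "f y = real j * g (real j - \<alpha>) y - g (real j + 1 - \<alpha>) y" for y
  have rm [measurable]: "\<rho> \<in> borel_measurable borel" by (intro borel_measurable_mono monoI rho_mono)
  have Gs: "eventually (\<lambda>t. integral\<^sup>L lborel (s t) / fact j = G j t / \<rho> t) at_top"
    using eventually_gt_at_top[of 0]
  proof eventually_elim
    case (elim t)
    have "integral\<^sup>L lborel (s t) = (\<integral>y. indicator {0<..} y * ((real j * y ^ (j - 1) - y ^ j) * exp (- y) * \<rho> (t / y)) \<partial>lborel) / \<rho> t"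
      unfolding h s_def[abs_def] by (simp add: mult.assoc)
    then show ?case using sums_G(2)[OF j elim] by simp
  qed
  have "((\<lambda>t. integral\<^sup>L lborel (s t)) \<longlongrightarrow> integral\<^sup>L lborel f) at_top"
  proof (rule integral_dominated_convergence_at_top)
    show "f \<in> borel_measurable lborel" unfolding f_def by measurable
    show "s t \<in> borel_measurable lborel" for t unfolding s_def by measurable
    show "integrable lborel w"
      unfolding w_def using j b
      by (intro Bochner_Integration.integrable_add integrable_mult_right has_bochner_integral_iff[THEN iffD1, THEN conjunct1, OF gI]) auto
    show "AE y in lborel. ((\<lambda>t. s t y) \<longlongrightarrow> f y) at_top"
    proof (rule AE_I2)
      fix y :: real
      show "((\<lambda>t. s t y) \<longlongrightarrow> f y) at_top"
      proof (cases "0 < y")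
        case True
        have "((\<lambda>t. \<rho> (1 / y * t) / \<rho> t) \<longlongrightarrow> (1 / y) powr \<alpha>) at_top" using True by (intro rho_ratio) auto
        then have "((\<lambda>t. s t y) \<longlongrightarrow> (real j * g (real j) y - g (real j + 1) y) * (1 / y) powr \<alpha>) at_top"
          unfolding s_def by (intro tendsto_intros) simp
        also have "(1 / y) powr \<alpha> = y powr (- \<alpha>)" using True by (simp add: powr_minus powr_divide field_simps)
        also have "(real j * g (real j) y - g (real j + 1) y) * y powr (- \<alpha>) = f y"
          unfolding f_def left_diff_distrib mult.assoc gpow by simp
        finally show ?thesis .
      next
        case False
        then show ?thesis by (simp add: s_def f_def g_def)
      qed
    qed
    show "\<forall>\<^sub>F t in at_top. AE y in lborel. norm (s t y) \<le> w y"
      using potter_upper[OF b(1)] rho_pos eventually_gt_at_top[of 0]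
    proof eventually_elim
      case (elim t)
      have "norm (s t y) \<le> w y" for y
      proof -
        define u where "u = real j * g (real j) y + g (real j + 1) y"
        have u0: "0 \<le> u" using g0 by (simp add: u_def)
        have up: "u * y powr (- b) = real j * g (real j - b) y + g (real j + 1 - b) y"
          unfolding u_def distrib_right mult.assoc gpow by simp
        have wu: "w y = (2 powr b * y powr (- b) + 1) * u"
          unfolding w_def up[symmetric] u_def[symmetric] by (simp add: algebra_simps)
        have su: "norm (s t y) \<le> u * (\<rho> (t / y) / \<rho> t)"
        proof -
          have "\<bar>real j * g (real j) y - g (real j + 1) y\<bar> \<le> u"
            unfolding u_def using g0[of "real j" y] g0[of "real j + 1" y] by (intro order_trans[OF abs_triangle_ineq4]) simp
          from mult_right_mono[OF this, of "\<rho> (t / y) / \<rho> t"] show ?thesis unfolding s_def by (simp add: abs_mult)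
        qed
        show "norm (s t y) \<le> w y"
        proof (cases "0 < y")
          case True
          \<comment> \<open>Potter's bound serves y \<le> 1 and monotonicity of \<rho> serves y > 1;
            the sum of the two bounds covers both.\<close>
          have "\<rho> (t / y) / \<rho> t \<le> 2 powr b * y powr (- b) + 1"
          proof (cases "y \<le> 1")
            case True
            then have "\<rho> (t / y) / \<rho> t \<le> 2 powr b * y powr (- b)"
              using elim \<open>0 < y\<close> by (simp add: divide_le_eq)
            then show ?thesis by simp
          next
            case False
            then have "\<rho> (t / y) \<le> \<rho> t" using elim by (intro rho_mono) (simp add: field_simps)
            then have "\<rho> (t / y) / \<rho> t \<le> 1" using elim by simp
            then show ?thesis by (simp add: add_increasing)
          qed
          then have "u * (\<rho> (t / y) / \<rho> t) \<le> u * (2 powr b * y powr (- b) + 1)" using u0 by (intro mult_left_mono)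
          then show ?thesis using su unfolding wu by (simp add: mult.commute)
        next
          case False
          then show ?thesis by (simp add: s_def w_def g_def)
        qed
      qed
      then show ?case by simp
    qed
  qed
  also have "integral\<^sup>L lborel f = \<alpha> * Gamma (real j - \<alpha>)"
  proof -
    have "has_bochner_integral lborel f (real j * Gamma (real j - \<alpha>) - Gamma (real j + 1 - \<alpha>))"
      unfolding f_def using j \<alpha>
      by (intro has_bochner_integral_diff has_bochner_integral_mult_right gI) auto
    \<comment> \<open>The functional equation collapses j * Gamma (j - \<alpha>) - Gamma (j + 1 -
      \<alpha>) to \<alpha> * Gamma (j - \<alpha>).\<close>
    moreover have "Gamma (real j + 1 - \<alpha>) = (real j - \<alpha>) * Gamma (real j - \<alpha>)"
    proof -
      have "real j - \<alpha> > 0" using j \<alpha> by linarith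
      then have "real j - \<alpha> \<notin> \<int>\<^sub>\<le>\<^sub>0" by (auto elim!: nonpos_Ints_cases)
      from Gamma_plus1[OF this] show ?thesis by (simp add: algebra_simps)
    qed
    ultimately show ?thesis by (simp add: has_bochner_integral_iff algebra_simps)
  qed
  finally have "((\<lambda>t. integral\<^sup>L lborel (s t) / fact j) \<longlongrightarrow> \<alpha> * Gamma (real j - \<alpha>) / fact j) at_top"
    by (intro tendsto_intros) auto
  then show ?thesis by (rule Lim_transform_eventually) (rule Gs)
qed

definition V :: "nat \<Rightarrow> real \<Rightarrow> real" where
  "V j t = (\<Sum>k. pmf (pois (pmf p k * t)) j * (1 - pmf (pois (pmf p k * t)) j))"

lemma V_eq:
  assumes j: "1 \<le> j" and t: "0 < t"
  shows "V j t = G j t - fact (2 * j) / (2 ^ (2 * j) * (fact j)\<^sup>2) * G (2 * j) (2 * t)"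
proof -
  let ?C = "fact (2 * j) / (2 ^ (2 * j) * (fact j)\<^sup>2) :: real"
  have "(\<lambda>k. pmf (pois (pmf p k * t)) j - ?C * pmf (pois (pmf p k * (2 * t))) (2 * j)) sums (G j t - ?C * G (2 * j) (2 * t))"
    using j t by (intro sums_diff sums_mult sums_G) auto
  moreover have "pmf (pois (pmf p k * t)) j - ?C * pmf (pois (pmf p k * (2 * t))) (2 * j)
      = pmf (pois (pmf p k * t)) j * (1 - pmf (pois (pmf p k * t)) j)" for k
    using pmf_pois_square[of "pmf p k * t" j] t by (simp add: power2_eq_square algebra_simps)
  ultimately show ?thesis by (simp add: V_def sums_iff)
qed

lemma V_lower:
  assumes j: "1 \<le> j" and t: "0 < t"
  shows "G j t / real (j + 2) \<le> V j t"
proof -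
  let ?q = "\<lambda>k. pmf (pois (pmf p k * t)) j"
  have s: "summable ?q" using sums_G[OF j t] by (simp add: sums_iff)
  have "G j t / real (j + 2) = (\<Sum>k. ?q k / real (j + 2))" unfolding G_def by (rule suminf_divide[OF s, symmetric])
  also have "\<dots> \<le> V j t"
    unfolding V_def
  proof (rule suminf_le)
    show "summable (\<lambda>k. ?q k / real (j + 2))" by (rule summable_divide[OF s])
    show "summable (\<lambda>k. ?q k * (1 - ?q k))"
      by (rule summable_comparison_test'[OF s, of 0]) (auto simp: abs_mult pmf_le_1 intro!: mult_left_le)
    fix k
    have "1 / real (j + 2) \<le> 1 - ?q k" using pmf_pois_le[of "pmf p k * t" j] j t by (simp add: field_simps)
    from mult_left_mono[OF this, of "?q k"] show "?q k / real (j + 2) \<le> ?q k * (1 - ?q k)" by simp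
  qed
  finally show ?thesis .
qed

lemma V_asymptotics:
  assumes j: "1 \<le> j"
  shows "((\<lambda>t. V j t / \<rho> t) \<longlongrightarrow> var_const j \<alpha>) at_top"
proof -
  let ?C = "fact (2 * j) / (2 ^ (2 * j) * (fact j)\<^sup>2) :: real"
  have f2: "filterlim (\<lambda>t::real. 2 * t) at_top at_top" by real_asymp
  have "((\<lambda>t. G (2 * j) (2 * t) / \<rho> (2 * t)) \<longlongrightarrow> \<alpha> * Gamma (real (2 * j) - \<alpha>) / fact (2 * j)) at_top"
    by (rule filterlim_compose[OF G_asymptotics f2]) (use j in simp)
  then have "((\<lambda>t. G j t / \<rho> t - ?C * (G (2 * j) (2 * t) / \<rho> (2 * t) * (\<rho> (2 * t) / \<rho> t)))
      \<longlongrightarrow> \<alpha> * Gamma (real j - \<alpha>) / fact j - ?C * (\<alpha> * Gamma (real (2 * j) - \<alpha>) / fact (2 * j) * 2 powr \<alpha>)) at_top"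
    using G_asymptotics[OF j] rho_ratio[of 2] by (intro tendsto_diff tendsto_mult tendsto_const) auto
  also have "\<alpha> * Gamma (real j - \<alpha>) / fact j - ?C * (\<alpha> * Gamma (real (2 * j) - \<alpha>) / fact (2 * j) * 2 powr \<alpha>) = var_const j \<alpha>"
    by (simp add: var_const_def field_simps)
  finally show ?thesis
  proof (rule Lim_transform_eventually)
    have "eventually (\<lambda>t. 0 < \<rho> (2 * t)) at_top" using f2 rho_pos by (rule eventually_compose_filterlim[rotated])
    with rho_pos eventually_gt_at_top[of 0]
    show "eventually (\<lambda>t. G j t / \<rho> t - ?C * (G (2 * j) (2 * t) / \<rho> (2 * t) * (\<rho> (2 * t) / \<rho> t)) = V j t / \<rho> t) at_top"
      by eventually_elim (simp add: V_eq[OF j] diff_divide_distrib)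
  qed
qed

lemma Gamma_pos: "1 \<le> j \<Longrightarrow> 0 < \<alpha> * Gamma (real j - \<alpha>) / fact j"
  using \<alpha> by (auto intro!: divide_pos_pos mult_pos_pos Gamma_real_pos)

text \<open>Positivity is read off from the asymptotics: V \<ge> G / (j + 2) passes to the limits of
  V / \<rho> and G / \<rho>, which avoids comparing Gamma values directly.\<close>

lemma var_const_pos:
  assumes j: "1 \<le> j"
  shows "0 < var_const j \<alpha>"
proof -
  have "\<alpha> * Gamma (real j - \<alpha>) / fact j / real (j + 2) \<le> var_const j \<alpha>"
  proof (rule tendsto_le[OF _ V_asymptotics[OF j] tendsto_divide[OF G_asymptotics[OF j] tendsto_const]])
    show "\<forall>\<^sub>F t in at_top. G j t / \<rho> t / real (j + 2) \<le> V j t / \<rho> t"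
      using rho_pos eventually_gt_at_top[of 0]
    proof eventually_elim
      case (elim t)
      from divide_right_mono[OF V_lower[OF j elim(2)], of "\<rho> t"] show ?case by (simp add: mult.commute)
    qed
  qed auto
  moreover have "0 < \<alpha> * Gamma (real j - \<alpha>) / fact j / real (j + 2)" using Gamma_pos[OF j] by (rule divide_pos_pos) simp
  ultimately show ?thesis by linarith
qed

lemma G_le_rho:
  assumes j: "1 \<le> j"
  shows "\<exists>K>0. eventually (\<lambda>t. G j t \<le> K * \<rho> t) at_top"
proof -
  define K where "K = \<alpha> * Gamma (real j - \<alpha>) / fact j + 1"
  have "0 < K" using Gamma_pos[OF j] by (simp add: K_def)
  moreover have "eventually (\<lambda>t. G j t / \<rho> t < K) at_top"
    by (rule order_tendstoD[OF G_asymptotics[OF j]]) (simp add: K_def)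
  then have "eventually (\<lambda>t. G j t \<le> K * \<rho> t) at_top"
    using rho_pos by eventually_elim (simp add: field_simps)
  ultimately show ?thesis by blast
qed

section \<open>The iterated logarithm of the variance, and the norming function\<close>

lemma ln_V_bounds:
  assumes j: "1 \<le> j"
  shows "eventually (\<lambda>t. \<alpha> / 4 * ln t \<le> ln (V j t) \<and> ln (V j t) \<le> 2 * ln t) at_top"
proof -
  define c where "c = var_const j \<alpha>"
  have c: "0 < c" unfolding c_def by (rule var_const_pos[OF j])
  obtain C where C: "0 < C" "eventually (\<lambda>t. C * t powr (\<alpha> / 2) \<le> \<rho> t) at_top" using rho_lower by blast
  have 1: "eventually (\<lambda>t. c / 2 < V j t / \<rho> t) at_top" "eventually (\<lambda>t. V j t / \<rho> t < 2 * c) at_top"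
    using c by (intro order_tendstoD[OF V_asymptotics[OF j]]; simp add: c_def)+
  \<comment> \<open>Half of the exponent \<alpha> / 2 is given away to absorb the constant c * C /
    2.\<close>
  have 2: "eventually (\<lambda>t. t powr (\<alpha> / 4) \<le> c / 2 * (C * t powr (\<alpha> / 2))) at_top"
  proof -
    have "filterlim (\<lambda>t::real. t powr (\<alpha> / 4)) at_top at_top" using \<alpha> by real_asymp
    then have "eventually (\<lambda>t::real. 2 / (c * C) \<le> t powr (\<alpha> / 4)) at_top" by (simp add: filterlim_at_top)
    then show ?thesis
    proof eventually_elim
      case (elim t)
      have "1 \<le> c / 2 * C * t powr (\<alpha> / 4)" using elim c C by (simp add: field_simps)
      then have "1 * t powr (\<alpha> / 4) \<le> c / 2 * C * t powr (\<alpha> / 4) * t powr (\<alpha> / 4)" by (intro mult_right_mono) auto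
      also have "\<dots> = c / 2 * (C * t powr (\<alpha> / 2))" by (simp add: mult.assoc powr_add[symmetric])
      finally show ?case by simp
    qed
  qed
  have 3: "eventually (\<lambda>t. 2 * c * t \<le> t\<^sup>2) at_top"
    using eventually_ge_at_top[of "2 * c"] eventually_ge_at_top[of 0]
    by eventually_elim (auto simp: power2_eq_square intro: mult_right_mono)
  show ?thesis
    using 1 2 3 C(2) rho_pos eventually_gt_at_top[of 1]
  proof eventually_elim
    case (elim t)
    have "t powr (\<alpha> / 4) \<le> c / 2 * \<rho> t" using elim(3,5) c by (meson half_gt_zero less_imp_le mult_left_mono order_trans)
    also have "\<dots> < V j t" using elim(1,6) by (simp add: field_simps)
    finally have lo: "t powr (\<alpha> / 4) \<le> V j t" by simp
    have "V j t \<le> 2 * c * \<rho> t" using elim(2,6) by (simp add: field_simps)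
    also have "\<dots> \<le> 2 * c * t" using mult_left_mono[OF rho_le[of t], of "2 * c"] less_imp_le[OF c] elim(7) by auto
    also have "\<dots> \<le> t\<^sup>2" using elim by simp
    finally have hi: "V j t \<le> t\<^sup>2" .
    have V0: "0 < V j t" using lo elim by (intro less_le_trans[OF _ lo]) auto
    have "ln (t powr (\<alpha> / 4)) \<le> ln (V j t)" using lo V0 elim by (subst ln_le_cancel_iff) auto
    moreover have "ln (V j t) \<le> ln (t\<^sup>2)" using hi V0 elim by (subst ln_le_cancel_iff) auto
    ultimately show ?case using elim by (simp add: ln_powr ln_realpow)
  qed
qed

text \<open>A double logarithm turns powers of t into additive constants, so the crude two-sided
  bounds on ln V suffice.\<close>

lemma lnln_V:
  assumes j: "1 \<le> j"
  shows "((\<lambda>t. ln (ln (V j t)) / ln (ln t)) \<longlongrightarrow> 1) at_top"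
proof (rule tendsto_sandwich)
  have a: "0 < \<alpha> / 4" using \<alpha> by simp
  have "eventually (\<lambda>t. \<alpha> / 4 * ln t \<le> ln (V j t) \<and> ln (V j t) \<le> 2 * ln t \<and> 1 < ln t) at_top"
    using ln_V_bounds[OF j] filterlim_at_top_dense[THEN iffD1, OF ln_at_top, rule_format, of 1]
    by eventually_elim auto
  then have ev: "eventually (\<lambda>t. ln (\<alpha> / 4) + ln (ln t) \<le> ln (ln (V j t)) \<and> ln (ln (V j t)) \<le> ln 2 + ln (ln t) \<and> 0 < ln (ln t)) at_top"
  proof eventually_elim
    case (elim t)
    have p: "0 < \<alpha> / 4 * ln t" using a elim by (intro mult_pos_pos) auto
    then have q: "0 < ln (V j t)" using elim by linarith
    have "ln (\<alpha> / 4 * ln t) \<le> ln (ln (V j t))" using elim p q by (subst ln_le_cancel_iff) auto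
    moreover have "ln (ln (V j t)) \<le> ln (2 * ln t)" using elim p q by (subst ln_le_cancel_iff) auto
    moreover have "ln (\<alpha> / 4 * ln t) = ln (\<alpha> / 4) + ln (ln t)" using a elim by (subst ln_mult) auto
    moreover have "ln (2 * ln t) = ln 2 + ln (ln t)" using elim by (subst ln_mult) auto
    ultimately show ?case using elim by simp
  qed
  show "eventually (\<lambda>t. (ln (\<alpha> / 4) + ln (ln t)) / ln (ln t) \<le> ln (ln (V j t)) / ln (ln t)) at_top"
    using ev by eventually_elim (auto intro!: divide_right_mono)
  show "eventually (\<lambda>t. ln (ln (V j t)) / ln (ln t) \<le> (ln 2 + ln (ln t)) / ln (ln t)) at_top"
    using ev by eventually_elim (auto intro!: divide_right_mono)
  show "((\<lambda>t::real. (ln (\<alpha> / 4) + ln (ln t)) / ln (ln t)) \<longlongrightarrow> 1) at_top" by real_asymp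
  show "((\<lambda>t::real. (ln 2 + ln (ln t)) / ln (ln t)) \<longlongrightarrow> 1) at_top" by real_asymp
qed

text \<open>An asymptotic substitute for sqrt (V * ln (ln V)). It is built from the monotone
  function \<rho>, so bounds obtained at grid points carry over to later times.\<close>

definition norming :: "nat \<Rightarrow> real \<Rightarrow> real" where
  "norming j t = sqrt (var_const j \<alpha> * \<rho> t * ln (ln t))"

lemma norming_equiv:
  assumes j: "1 \<le> j"
  shows "((\<lambda>t. norming j t / sqrt (V j t * ln (ln (V j t)))) \<longlongrightarrow> 1) at_top"
proof -
  define c where "c = var_const j \<alpha>"
  have c: "0 < c" unfolding c_def by (rule var_const_pos[OF j])
  have "((\<lambda>t. sqrt (c / ((V j t / \<rho> t) * (ln (ln (V j t)) / ln (ln t))))) \<longlongrightarrow> sqrt (c / (c * 1))) at_top"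
    using V_asymptotics[OF j] lnln_V[OF j] c unfolding c_def[symmetric]
    by (intro tendsto_real_sqrt tendsto_divide tendsto_mult tendsto_const) auto
  then have "((\<lambda>t. sqrt (c / ((V j t / \<rho> t) * (ln (ln (V j t)) / ln (ln t))))) \<longlongrightarrow> 1) at_top" using c by simp
  then show ?thesis
  proof (rule Lim_transform_eventually)
    have "eventually (\<lambda>t::real. 0 < ln (ln t)) at_top" by real_asymp
    then show "eventually (\<lambda>t. sqrt (c / ((V j t / \<rho> t) * (ln (ln (V j t)) / ln (ln t)))) = norming j t / sqrt (V j t * ln (ln (V j t)))) at_top"
      using rho_pos
      by eventually_elim (simp add: norming_def c_def[symmetric] real_sqrt_divide[symmetric] field_simps)
  qed
qed

lemma norming_mono:
  assumes j: "1 \<le> j" and "exp 1 \<le> s" "s \<le> t"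
  shows "norming j s \<le> norming j t"
proof -
  have s: "0 < s" using assms(2) exp_gt_zero[of "1::real"] by linarith
  have "1 \<le> ln s" using assms(2) s by (simp add: ln_ge_iff)
  moreover have "ln s \<le> ln t" using s assms(3) by simp
  ultimately have "0 \<le> ln (ln s)" "ln (ln s) \<le> ln (ln t)" by (auto intro: ln_mono)
  then show ?thesis
    unfolding norming_def using var_const_pos[OF j] rho_mono[OF assms(3)]
    by (intro real_sqrt_le_mono mult_mono mult_nonneg_nonneg) auto
qed

end

section \<open>Boxes with at least a given number of balls\<close>

text \<open>The probability of at least j points under the Poisson law, written as an elementary
  function in order to be differentiated.\<close>

definition upper_pois :: "nat \<Rightarrow> real \<Rightarrow> real" where
  "upper_pois j x = 1 - (\<Sum>i<j. x ^ i / fact i * exp (- x))"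

lemma upper_pois_eq_measure:
  assumes "0 \<le> x"
  shows "measure (measure_pmf (pois x)) {j..} = upper_pois j x"
proof -
  have "measure (measure_pmf (pois x)) {j..} = 1 - measure (measure_pmf (pois x)) {..<j}"
    using measure_pmf.prob_compl[of "{..<j}" "pois x"] by (simp add: Compl_eq_Diff_UNIV[symmetric] Compl_lessThan)
  also have "measure (measure_pmf (pois x)) {..<j} = (\<Sum>i<j. x ^ i / fact i * exp (- x))"
    using assms by (simp add: measure_measure_pmf_finite pmf_pois)
  finally show ?thesis by (simp add: upper_pois_def)
qed

lemma upper_pois_deriv:
  "(upper_pois (Suc i) has_real_derivative (x ^ i / fact i * exp (- x))) (at x)"
proof (induction i)
  case 0
  have eq: "upper_pois (Suc 0) = (\<lambda>x. 1 - exp (- x))" by (simp add: upper_pois_def fun_eq_iff)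
  show ?case unfolding eq by (auto intro!: derivative_eq_intros)
next
  case (Suc i)
  have eq: "upper_pois (Suc (Suc i)) = (\<lambda>x. upper_pois (Suc i) x - x ^ Suc i * exp (- x) / fact (Suc i))"
    by (simp add: upper_pois_def fun_eq_iff del: fact_Suc)
  have "x ^ i / fact i * exp (- x) - ((real (Suc i) * x ^ i) * exp (- x) - x ^ Suc i * exp (- x)) / fact (Suc i)
      = x ^ Suc i / fact (Suc i) * exp (- x)"
  proof -
    have "real (Suc i) * x ^ i * exp (- x) / fact (Suc i) = x ^ i / fact i * exp (- x)"
      by (simp add: field_simps del: of_nat_Suc)
    then show ?thesis by (simp add: diff_divide_distrib del: of_nat_Suc fact_Suc)
  qed
  moreover have "(upper_pois (Suc (Suc i)) has_real_derivative
      (x ^ i / fact i * exp (- x) - ((real (Suc i) * x ^ i) * exp (- x) - x ^ Suc i * exp (- x)) / fact (Suc i))) (at x)"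
    unfolding eq using Suc
    by (auto intro!: derivative_eq_intros simp: diff_divide_distrib simp del: fact_Suc power_Suc of_nat_Suc)
  ultimately show ?case by simp
qed

text \<open>The mean value theorem gives a Poisson weight at j - 1 with an intermediate rate z.
  Since z \<le> 2 x, it is compared with rate x at the price of 2^(j - 1), and the factor x raises
  it to the weight at j. Summed over boxes, an increment is thus controlled by the mean
  \<open>G j\<close>.\<close>

lemma upper_pois_increment:
  assumes x: "0 \<le> x" "x \<le> y" "y \<le> 2 * x" and j: "1 \<le> j"
  shows "0 \<le> upper_pois j y - upper_pois j x"
    and "x * (upper_pois j y - upper_pois j x) \<le> (y - x) * (real j * 2 ^ (j - 1) * pmf (pois x) j)"
proof -
  obtain i where i: "j = Suc i" using j by (cases j) auto
  have "\<exists>z. x \<le> z \<and> z \<le> y \<and> upper_pois j y - upper_pois j x = (y - x) * (z ^ i / fact i * exp (- z))"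
  proof (cases "x = y")
    case True
    then show ?thesis by (intro exI[of _ x]) auto
  next
    case False
    then have "x < y" using x by simp
    from MVT2[OF this, of "upper_pois j" "\<lambda>z. z ^ i / fact i * exp (- z)"] upper_pois_deriv[of i]
    show ?thesis unfolding i by (meson less_imp_le)
  qed
  then obtain z where z: "x \<le> z" "z \<le> y" "upper_pois j y - upper_pois j x = (y - x) * (z ^ i / fact i * exp (- z))" by blast
  show "0 \<le> upper_pois j y - upper_pois j x" unfolding z using z x by simp
  have "z ^ i \<le> (2 * x) ^ i" using z x by (intro power_mono) auto
  moreover have "exp (- z) \<le> exp (- x)" using z by simp
  ultimately have "z ^ i * exp (- z) \<le> (2 * x) ^ i * exp (- x)" using x z by (intro mult_mono) auto
  then have "z ^ i / fact i * exp (- z) \<le> (2 * x) ^ i / fact i * exp (- x)"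
    by (simp add: divide_right_mono)
  then have "x * ((y - x) * (z ^ i / fact i * exp (- z))) \<le> x * ((y - x) * ((2 * x) ^ i / fact i * exp (- x)))"
    using x by (intro mult_left_mono) auto
  also have "\<dots> = (y - x) * (real j * 2 ^ (j - 1) * pmf (pois x) j)"
  proof -
    have "real j / fact j = (1 / fact i :: real)" unfolding i by (simp del: of_nat_Suc)
    then have "real j * 2 ^ (j - 1) * pmf (pois x) j = 2 ^ i * x ^ Suc i * (1 / fact i) * exp (- x)"
      using x i by (simp add: pmf_pois mult_ac del: of_nat_Suc fact_Suc) (metis (no_types, opaque_lifting) mult.commute times_divide_eq_right mult.right_neutral)
    then show ?thesis by (simp add: power_mult_distrib mult_ac)
  qed
  finally show "x * (upper_pois j y - upper_pois j x) \<le> (y - x) * (real j * 2 ^ (j - 1) * pmf (pois x) j)" unfolding z .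
qed

text \<open>At least j points require at least one. The bound by the rate makes the series
  \<open>EA\<close> converge.\<close>

lemma upper_pois_le: "0 \<le> x \<Longrightarrow> 1 \<le> j \<Longrightarrow> upper_pois j x \<le> x"
proof -
  assume x: "0 \<le> x" and j: "1 \<le> j"
  have "upper_pois j x \<le> upper_pois 1 x"
    unfolding upper_pois_eq_measure[OF x, symmetric] using j by (intro measure_pmf.finite_measure_mono) auto
  also have "\<dots> = 1 - exp (- x)" by (simp add: upper_pois_def)
  also have "\<dots> \<le> x" using exp_ge_add_one_self[of "- x"] by linarith
  finally show ?thesis .
qed

lemma (in prob_space) two_sided_tail:
  assumes [measurable]: "Z \<in> borel_measurable M"
    and "\<And>b :: real. \<bar>b\<bar> = 1 \<Longrightarrow> \<P>(\<omega> in M. x \<le> b * Z \<omega>) \<le> e"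
  shows "\<P>(\<omega> in M. x \<le> \<bar>Z \<omega>\<bar>) \<le> 2 * e"
proof -
  have "\<P>(\<omega> in M. x \<le> \<bar>Z \<omega>\<bar>) \<le> prob ({\<omega>\<in>space M. x \<le> 1 * Z \<omega>} \<union> {\<omega>\<in>space M. x \<le> - 1 * Z \<omega>})"
    by (rule finite_measure_mono) (auto simp: abs_if split: if_splits)
  also have "\<dots> \<le> \<P>(\<omega> in M. x \<le> 1 * Z \<omega>) + \<P>(\<omega> in M. x \<le> - 1 * Z \<omega>)"
    by (rule measure_Un_le) auto
  also have "\<dots> \<le> e + e"
    by (intro add_mono assms) auto
  finally show ?thesis by simp
qed

locale karlin_lil = poissonized_karlin_scheme M S p X + regular_rates p \<alpha>
  for M :: "'a measure" and S :: "nat \<Rightarrow> 'a \<Rightarrow> real" and p :: "nat pmf" and X :: "nat \<Rightarrow> 'a \<Rightarrow> nat" and \<alpha> :: real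
begin

lemma prob_balls:
  assumes "0 < t"
  shows "\<P>(\<omega> in M. \<pi> k t \<omega> \<in> B) = measure (measure_pmf (pois (pmf p k * t))) B"
proof -
  have "\<P>(\<omega> in M. \<pi> k t \<omega> \<in> B) = measure (distr M (count_space UNIV) (\<pi> k t)) B"
    by (subst measure_distr) (auto intro!: arg_cong[where f=prob])
  then show ?thesis by (simp add: distr_balls[OF assms])
qed

lemma prob_balls_eq: "0 < t \<Longrightarrow> \<P>(\<omega> in M. \<pi> k t \<omega> = j) = pmf (pois (pmf p k * t)) j"
  using prob_balls[of t k "{j}"] by (simp add: measure_pmf_single)

lemma prob_balls_ge: "0 < t \<Longrightarrow> \<P>(\<omega> in M. j \<le> \<pi> k t \<omega>) = upper_pois j (pmf p k * t)"
  using prob_balls[of t k "{j..}"] by (simp add: upper_pois_eq_measure)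

text \<open>The time may depend on the box through n, which is what observing each block of boxes at
  its own time requires.\<close>

lemma indep_occupancy_events:
  fixes t :: "nat \<Rightarrow> real"
  assumes t: "strict_mono t" "t 0 = 0"
  shows "indep_vars (\<lambda>_. count_space UNIV) (\<lambda>k \<omega>. \<pi> k (t (n k)) \<omega> = j) UNIV"
proof (rule indep_vars_compose2[OF indep_box_paths[OF t], of "\<lambda>k x. x (n k) = j"])
  show "(\<lambda>x. x (n k) = j) \<in> PiM UNIV (\<lambda>_. count_space UNIV) \<rightarrow>\<^sub>M count_space UNIV" for k
    by measurable
qed

lemma occupancy:
  assumes t: "0 < t" and j: "1 \<le> j"
  shows "indep_occupancy M (\<lambda>k \<omega>. \<pi> k t \<omega> = j)"
proof unfold_locales
  have "strict_mono (\<lambda>i. real i * t)" using t by (auto simp: strict_mono_def)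
  from indep_occupancy_events[OF this, of "\<lambda>_. 1"]
  show "indep_vars (\<lambda>_. count_space UNIV) (\<lambda>k \<omega>. \<pi> k t \<omega> = j) UNIV" by simp
  show "summable (\<lambda>k. \<P>(\<omega> in M. \<pi> k t \<omega> = j))"
    using sums_G(1)[OF j t] by (simp add: prob_balls_eq[OF t] sums_iff)
qed

lemma occupancy_simps:
  assumes t: "0 < t" and j: "1 \<le> j"
  shows "indep_occupancy.T (\<lambda>k \<omega>. \<pi> k t \<omega> = j) = boxes_with S X j t"
    and "indep_occupancy.m M (\<lambda>k \<omega>. \<pi> k t \<omega> = j) = G j t"
    and "indep_occupancy.v M (\<lambda>k \<omega>. \<pi> k t \<omega> = j) = V j t"
proof -
  interpret O: indep_occupancy M "\<lambda>k \<omega>. \<pi> k t \<omega> = j" by (rule occupancy[OF t j])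
  show "O.T = boxes_with S X j t" by (simp add: O.T_def boxes_with_def fun_eq_iff)
  show "O.m = G j t" by (simp add: O.m_def O.q_def G_def prob_balls_eq t)
  show "O.v = V j t" by (simp add: O.v_def O.q_def V_def prob_balls_eq t)
qed

lemma mean_boxes_eq: "0 < t \<Longrightarrow> 1 \<le> j \<Longrightarrow> mean_boxes M S X j t = G j t"
  using indep_occupancy.expectation_T[OF occupancy, of t j] occupancy_simps[of t j]
  by (simp add: mean_boxes_def)

lemma var_boxes_eq: "0 < t \<Longrightarrow> 1 \<le> j \<Longrightarrow> var_boxes M S X j t = V j t"
  using indep_occupancy.variance_T[OF occupancy, of t j] occupancy_simps[of t j]
  by (simp add: var_boxes_def)

definition K :: "nat \<Rightarrow> real \<Rightarrow> 'a \<Rightarrow> real" where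
  "K j t \<omega> = boxes_with S X j t \<omega> - G j t"

lemma K_measurable [measurable]: "K j t \<in> borel_measurable M"
  unfolding K_def boxes_with_def by measurable

lemma chernoff_K:
  assumes "0 < t" "1 \<le> j" "0 \<le> l" "l \<le> 1" "\<bar>s\<bar> = 1"
  shows "\<P>(\<omega> in M. x \<le> s * K j t \<omega>) \<le> exp (- l * x + l\<^sup>2 / 2 * (1 + 3 * l) * V j t)"
  using indep_occupancy.chernoff[OF occupancy[OF assms(1,2)] assms(3,4,5), of x] assms
  by (simp add: occupancy_simps K_def)

text \<open>Unlike \<^const>\<open>boxes_with\<close>, this count is monotone in \<open>t\<close>.\<close>

definition A :: "nat \<Rightarrow> real \<Rightarrow> 'a \<Rightarrow> real" where
  "A j t \<omega> = real (card {k. j \<le> \<pi> k t \<omega>})"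

definition EA :: "nat \<Rightarrow> real \<Rightarrow> real" where
  "EA j t = (\<Sum>k. upper_pois j (pmf p k * t))"

lemma A_measurable [measurable]: "A j t \<in> borel_measurable M"
  unfolding A_def by measurable

lemma summable_upper: "0 < t \<Longrightarrow> 1 \<le> j \<Longrightarrow> summable (\<lambda>k. upper_pois j (pmf p k * t))"
proof (rule summable_comparison_test'[of "\<lambda>k. pmf p k * t" 0])
  show "summable (\<lambda>k. pmf p k * t)" by (intro summable_mult2 summable_pmf)
  assume t: "0 < t" and j: "1 \<le> j"
  fix k
  have "0 \<le> upper_pois j (pmf p k * t)" using t by (subst upper_pois_eq_measure[symmetric]) auto
  then show "norm (upper_pois j (pmf p k * t)) \<le> pmf p k * t" using upper_pois_le[of "pmf p k * t" j] t j by simp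
qed

lemma regular_finite_A: "regular \<omega> \<Longrightarrow> 1 \<le> j \<Longrightarrow> finite {k. j \<le> \<pi> k t \<omega>}"
  by (rule finite_subset[OF _ regular_finite_occupied[of \<omega> t]]) auto

lemma regular_A_mono: "regular \<omega> \<Longrightarrow> 1 \<le> j \<Longrightarrow> s \<le> t \<Longrightarrow> A j s \<omega> \<le> A j t \<omega>"
  unfolding A_def of_nat_le_iff
  by (rule card_mono[OF regular_finite_A]) (auto intro: order_trans[OF _ regular_balls_mono])

lemma regular_boxes_eq:
  assumes w: "regular \<omega>" and j: "1 \<le> j"
  shows "boxes_with S X j t \<omega> = A j t \<omega> - A (Suc j) t \<omega>"
proof -
  have "{k. j \<le> \<pi> k t \<omega>} = {k. \<pi> k t \<omega> = j} \<union> {k. Suc j \<le> \<pi> k t \<omega>}" by auto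
  moreover have "card ({k. \<pi> k t \<omega> = j} \<union> {k. Suc j \<le> \<pi> k t \<omega>}) = card {k. \<pi> k t \<omega> = j} + card {k. Suc j \<le> \<pi> k t \<omega>}"
    using regular_finite_A[OF w j, of t] calculation by (intro card_Un_disjoint) auto
  ultimately show ?thesis by (simp add: A_def boxes_with_def)
qed

lemma G_eq_EA:
  assumes t: "0 < t" and j: "1 \<le> j"
  shows "G j t = EA j t - EA (Suc j) t"
proof -
  have "(\<lambda>k. upper_pois j (pmf p k * t) - upper_pois (Suc j) (pmf p k * t)) sums (EA j t - EA (Suc j) t)"
    unfolding EA_def using t j by (intro sums_diff summable_sums summable_upper) auto
  moreover have "upper_pois j x - upper_pois (Suc j) x = pmf (pois x) j" if "0 \<le> x" for x
    using that by (simp add: upper_pois_def pmf_pois)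
  ultimately show ?thesis using t unfolding G_def by (simp add: sums_iff)
qed

text \<open>An increment of \<open>A\<close> counts the boxes whose number of balls crosses j. These
  are again independent indicators, so the exponential bounds apply to increments, with a mean at
  most of the order of the relative step (t - s) / s.\<close>

lemma crossing:
  assumes s: "0 < s" "s < t" "t \<le> 2 * s" and j: "1 \<le> j"
  defines "E \<equiv> \<lambda>k \<omega>. \<pi> k s \<omega> < j \<and> j \<le> \<pi> k t \<omega>"
  shows "indep_occupancy M E"
    and "indep_occupancy.m M E = EA j t - EA j s"
    and "regular \<omega> \<Longrightarrow> indep_occupancy.T E \<omega> = A j t \<omega> - A j s \<omega>"
    and "EA j s \<le> EA j t"
    and "EA j t - EA j s \<le> (t - s) / s * (real j * 2 ^ (j - 1) * G j s)"
proof -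
  have pr: "\<P>(\<omega> in M. E k \<omega>) = upper_pois j (pmf p k * t) - upper_pois j (pmf p k * s)" for k
  proof -
    have "\<P>(\<omega> in M. E k \<omega>) = prob ({\<omega>\<in>space M. j \<le> \<pi> k t \<omega>} - {\<omega>\<in>space M. j \<le> \<pi> k s \<omega>})"
      by (intro arg_cong[where f=prob]) (auto simp: E_def)
    also have "\<dots> = prob {\<omega>\<in>space M. j \<le> \<pi> k t \<omega>} - prob ({\<omega>\<in>space M. j \<le> \<pi> k t \<omega>} \<inter> {\<omega>\<in>space M. j \<le> \<pi> k s \<omega>})"
      by (rule finite_measure_Diff') auto
    also have "prob ({\<omega>\<in>space M. j \<le> \<pi> k t \<omega>} \<inter> {\<omega>\<in>space M. j \<le> \<pi> k s \<omega>}) = prob {\<omega>\<in>space M. j \<le> \<pi> k s \<omega>}"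
    proof (rule measure_eq_AE)
      show "AE \<omega> in M. (\<omega> \<in> {\<omega>\<in>space M. j \<le> \<pi> k t \<omega>} \<inter> {\<omega>\<in>space M. j \<le> \<pi> k s \<omega>}) = (\<omega> \<in> {\<omega>\<in>space M. j \<le> \<pi> k s \<omega>})"
        using AE_regular
        by eventually_elim (use regular_balls_mono[of _ s t k] s in \<open>auto intro: order_trans\<close>)
    qed auto
    finally show ?thesis using s by (simp add: prob_balls_ge)
  qed
  have le: "upper_pois j (pmf p k * t) - upper_pois j (pmf p k * s) \<le> (t - s) / s * (real j * 2 ^ (j - 1) * pmf (pois (pmf p k * s)) j)" for k
  proof (cases "pmf p k = 0")
    case True
    then show ?thesis using s by simp
  next
    case False
    then have pk: "0 < pmf p k" using pmf_nonneg[of p k] by simp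
    have st: "pmf p k * s \<le> pmf p k * t" "pmf p k * t \<le> 2 * (pmf p k * s)"
      using s pk by (auto simp: mult.left_commute[of 2])
    from upper_pois_increment(2)[OF _ st j] pk s
    have "pmf p k * (s * (upper_pois j (pmf p k * t) - upper_pois j (pmf p k * s))) \<le> pmf p k * ((t - s) * (real j * 2 ^ (j - 1) * pmf (pois (pmf p k * s)) j))"
      by (simp add: algebra_simps)
    then have "s * (upper_pois j (pmf p k * t) - upper_pois j (pmf p k * s)) \<le> (t - s) * (real j * 2 ^ (j - 1) * pmf (pois (pmf p k * s)) j)"
      using pk by simp
    then show ?thesis using s by (simp add: field_simps)
  qed
  have sms: "(\<lambda>k. upper_pois j (pmf p k * t) - upper_pois j (pmf p k * s)) sums (EA j t - EA j s)"
    unfolding EA_def using s j by (intro sums_diff summable_sums summable_upper) auto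
  show occ: "indep_occupancy M E"
  proof unfold_locales
    \<comment> \<open>Only the entries 0, s and t matter; the rest makes the sequence strictly
      increasing.\<close>
    define u where "u i = (if i = 0 then 0 else if i = 1 then s else t + real i - 2)" for i :: nat
    have u: "strict_mono u" "u 0 = 0" "u 1 = s" "u 2 = t" using s by (auto simp: u_def strict_mono_Suc_iff)
    from indep_vars_compose2[OF indep_box_paths[OF u(1,2)], of "\<lambda>k x. x 1 < j \<and> j \<le> x 2" "\<lambda>_. count_space UNIV"]
    show "indep_vars (\<lambda>_. count_space UNIV) E UNIV" using u by (simp add: E_def)
    show "summable (\<lambda>k. \<P>(\<omega> in M. E k \<omega>))" unfolding pr using sms by (simp add: sums_iff)
  qed
  interpret O: indep_occupancy M E by (rule occ)
  show m: "O.m = EA j t - EA j s" using sms unfolding O.m_def O.q_def pr by (simp add: sums_iff)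
  show "EA j s \<le> EA j t"
    using sms upper_pois_increment(1)[of "pmf p k * s" "pmf p k * t" j for k] 
    by (metis (no_types, lifting) O.v_nonneg O.v_le_m m diff_ge_0_iff_ge order_trans)
  have "EA j t - EA j s \<le> (t - s) / s * (real j * 2 ^ (j - 1) * G j s)"
    by (rule sums_le[OF le sms]) (intro sums_mult sums_G(1) j s(1))
  then show "EA j t - EA j s \<le> (t - s) / s * (real j * 2 ^ (j - 1) * G j s)" .
  show "O.T \<omega> = A j t \<omega> - A j s \<omega>" if w: "regular \<omega>"
  proof -
    have sub: "{k. j \<le> \<pi> k s \<omega>} \<subseteq> {k. j \<le> \<pi> k t \<omega>}" using regular_balls_mono[OF w, of s t] s by (auto intro: order_trans)
    have "{k. E k \<omega>} = {k. j \<le> \<pi> k t \<omega>} - {k. j \<le> \<pi> k s \<omega>}" by (auto simp: E_def)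
    then have "card {k. E k \<omega>} = card {k. j \<le> \<pi> k t \<omega>} - card {k. j \<le> \<pi> k s \<omega>}"
      using card_Diff_subset[OF _ sub] regular_finite_A[OF w j] by simp
    then show ?thesis using card_mono[OF regular_finite_A[OF w j] sub] by (simp add: O.T_def A_def of_nat_diff)
  qed
qed

definition D :: "nat \<Rightarrow> real \<Rightarrow> real \<Rightarrow> 'a \<Rightarrow> real" where
  "D j s t \<omega> = (A j t \<omega> - EA j t) - (A j s \<omega> - EA j s)"

lemma D_measurable [measurable]: "D j s t \<in> borel_measurable M"
  unfolding D_def by measurable

text \<open>The variance is at most the mean, hence at most w. The choice l = x / (4 * w) is optimal
  once 1 + 3 * l is bounded by 4, which is where x \<le> 4 * w enters; the exponent becomes - x^2 /
  (4 w) + x^2 / (8 w).\<close>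

lemma increment_tail:
  assumes s: "0 < s" "s \<le> t" "t \<le> 2 * s" and j: "1 \<le> j"
    and w: "(t - s) / s * (real j * 2 ^ (j - 1) * G j s) \<le> w" "0 < w"
    and x: "0 < x" "x \<le> 4 * w"
  shows "\<P>(\<omega> in M. x \<le> \<bar>D j s t \<omega>\<bar>) \<le> 2 * exp (- (x\<^sup>2 / (8 * w)))"
proof (cases "s = t")
  case True
  then have "{\<omega>\<in>space M. x \<le> \<bar>D j s t \<omega>\<bar>} = {}" using x by (auto simp: D_def)
  then show ?thesis by (simp only: measure_empty) simp
next
  case False
  then have st: "s < t" using s by simp
  define E where "E = (\<lambda>k \<omega>. \<pi> k s \<omega> < j \<and> j \<le> \<pi> k t \<omega>)"
  note cr = crossing[OF s(1) st s(3) j, folded E_def]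
  interpret O: indep_occupancy M E by (rule cr(1))
  define l where "l = x / (4 * w)"
  have l: "0 \<le> l" "l \<le> 1" using x w by (auto simp: l_def field_simps)
  have vw: "0 \<le> O.v" "O.v \<le> w" using O.v_nonneg O.v_le_m cr(2,5) w by auto
  have e: "- l * x + l\<^sup>2 / 2 * (1 + 3 * l) * O.v \<le> - (x\<^sup>2 / (8 * w))"
  proof -
    have "(1 + 3 * l) * O.v \<le> 4 * w" using l vw by (intro mult_mono) auto
    then have "l\<^sup>2 / 2 * ((1 + 3 * l) * O.v) \<le> l\<^sup>2 / 2 * (4 * w)" by (intro mult_left_mono) auto
    moreover have "- l * x + l\<^sup>2 / 2 * (4 * w) = - (x\<^sup>2 / (8 * w))"
      using w by (simp add: l_def power2_eq_square field_simps)
    ultimately show ?thesis by (simp add: mult.assoc)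
  qed
  have one: "\<P>(\<omega> in M. x \<le> b * D j s t \<omega>) \<le> exp (- (x\<^sup>2 / (8 * w)))" if "\<bar>b\<bar> = 1" for b
  proof -
    have "\<P>(\<omega> in M. x \<le> b * D j s t \<omega>) = \<P>(\<omega> in M. x \<le> b * (O.T \<omega> - O.m))"
    proof (rule measure_eq_AE)
      show "AE \<omega> in M. (\<omega> \<in> {\<omega>\<in>space M. x \<le> b * D j s t \<omega>}) = (\<omega> \<in> {\<omega>\<in>space M. x \<le> b * (O.T \<omega> - O.m)})"
        using AE_regular by eventually_elim (simp add: cr D_def algebra_simps)
    qed auto
    also have "\<dots> \<le> exp (- l * x + l\<^sup>2 / 2 * (1 + 3 * l) * O.v)" by (rule O.chernoff[OF l that])
    finally show ?thesis using e by (simp add: order_trans)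
  qed
  show ?thesis by (rule two_sided_tail) (auto intro: one)
qed

end

section \<open>Upper bound\<close>

lemma (in prob_space) borel_cantelli_1:
  assumes [measurable]: "\<And>n. {\<omega>\<in>space M. B n \<omega>} \<in> events"
    and le: "eventually (\<lambda>n. \<P>(\<omega> in M. B n \<omega>) \<le> f n) sequentially" and f: "summable f"
  shows "AE \<omega> in M. eventually (\<lambda>n. \<not> B n \<omega>) sequentially"
proof -
  have "summable (\<lambda>n. \<P>(\<omega> in M. B n \<omega>))"
    by (rule summable_comparison_test_ev[OF _ f]) (use le in simp)
  then have "AE \<omega> in M. eventually (\<lambda>n. \<omega> \<in> space M - {\<omega>\<in>space M. B n \<omega>}) sequentially"
    by (intro borel_cantelli_AE1) (auto simp: emeasure_eq_measure)
  then show ?thesis by (auto elim!: eventually_mono)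
qed

lemma (in prob_space) prob_ex_le:
  fixes c :: real
  assumes "\<And>q. q \<le> Q \<Longrightarrow> {\<omega>\<in>space M. B q \<omega>} \<in> events"
    and "\<And>q. q \<le> Q \<Longrightarrow> \<P>(\<omega> in M. B q \<omega>) \<le> c"
  shows "\<P>(\<omega> in M. \<exists>q\<le>(Q::nat). B q \<omega>) \<le> real (Suc Q) * c"
proof -
  have "{\<omega>\<in>space M. \<exists>q\<le>Q. B q \<omega>} = (\<Union>q\<in>{..Q}. {\<omega>\<in>space M. B q \<omega>})" by auto
  then have "\<P>(\<omega> in M. \<exists>q\<le>Q. B q \<omega>) \<le> (\<Sum>q\<le>Q. \<P>(\<omega> in M. B q \<omega>))"
    using assms(1) by (simp only:) (rule measure_UNION_le; auto)
  also have "\<dots> \<le> (\<Sum>q\<le>Q. c)" using assms(2) by (intro sum_mono) auto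
  finally show ?thesis by simp
qed

context karlin_lil
begin

lemma eventually_lnln: "eventually (\<lambda>t::real. 0 < ln (ln t)) at_top"
  by real_asymp

lemma norming_square: "1 \<le> j \<Longrightarrow> 0 \<le> ln (ln t) \<Longrightarrow> (norming j t)\<^sup>2 = var_const j \<alpha> * \<rho> t * ln (ln t)"
  unfolding norming_def using var_const_pos[of j] by (intro real_sqrt_pow2 mult_nonneg_nonneg) auto

lemma norming_at_top: "1 \<le> j \<Longrightarrow> filterlim (norming j) at_top at_top"
proof -
  assume j: "1 \<le> j"
  have "filterlim (\<lambda>t. sqrt (var_const j \<alpha> * (\<rho> t * ln (ln t)))) at_top at_top"
    by (intro filterlim_compose[OF sqrt_at_top] filterlim_tendsto_pos_mult_at_top[OF tendsto_const var_const_pos[OF j]]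
        filterlim_at_top_mult_at_top rho_at_top) real_asymp
  then show ?thesis by (simp add: norming_def[abs_def] mult.assoc)
qed

text \<open>The norming is of order sqrt (\<rho> * ln (ln t)) and \<rho> exceeds a power of t. The
  square of the logarithm matters because ln t is linear in n along geometric times and the coarse
  grid has n^2 steps.\<close>

lemma norming_small:
  assumes j: "1 \<le> j"
  shows "((\<lambda>t. (ln t)\<^sup>2 * norming j t / \<rho> t) \<longlongrightarrow> 0) at_top"
proof -
  define c where "c = var_const j \<alpha>"
  have c: "0 < c" unfolding c_def by (rule var_const_pos[OF j])
  obtain C where C: "0 < C" "eventually (\<lambda>t. C * t powr (\<alpha> / 2) \<le> \<rho> t) at_top" using rho_lower by blast
  have "((\<lambda>t. (ln t) ^ 4 * c * ln (ln t) / \<rho> t) \<longlongrightarrow> 0) at_top"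
  proof (rule tendsto_sandwich[of "\<lambda>_. 0"])
    show "((\<lambda>t. (ln t) ^ 4 * c * ln (ln t) / (C * t powr (\<alpha> / 2))) \<longlongrightarrow> 0) at_top" using C \<alpha> c by real_asymp
    show "eventually (\<lambda>t. (ln t) ^ 4 * c * ln (ln t) / \<rho> t \<le> (ln t) ^ 4 * c * ln (ln t) / (C * t powr (\<alpha> / 2))) at_top"
      using C(2) eventually_lnln rho_pos eventually_gt_at_top[of 1]
      by eventually_elim (use C(1) c in \<open>auto intro!: divide_left_mono mult_pos_pos mult_nonneg_nonneg\<close>)
    show "eventually (\<lambda>t. 0 \<le> (ln t) ^ 4 * c * ln (ln t) / \<rho> t) at_top"
      using eventually_lnln by eventually_elim (use c in auto)
  qed simp
  from tendsto_real_sqrt[OF this] have "((\<lambda>t. sqrt ((ln t) ^ 4 * c * ln (ln t) / \<rho> t)) \<longlongrightarrow> 0) at_top" by simp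
  then show ?thesis
  proof (rule Lim_transform_eventually)
    show "eventually (\<lambda>t. sqrt ((ln t) ^ 4 * c * ln (ln t) / \<rho> t) = (ln t)\<^sup>2 * norming j t / \<rho> t) at_top"
      using rho_pos eventually_lnln
    proof eventually_elim
      case (elim t)
      have "(ln t) ^ 4 * c * ln (ln t) / \<rho> t = ((ln t)\<^sup>2 / \<rho> t)\<^sup>2 * (c * \<rho> t * ln (ln t))"
        using elim by (simp add: power2_eq_square field_simps eval_nat_numeral)
      also have "sqrt \<dots> = (ln t)\<^sup>2 / \<rho> t * norming j t"
        using elim unfolding norming_def c_def real_sqrt_mult[of "_\<^sup>2"] by simp
      finally show ?case by simp
    qed
  qed
qed

lemma norming_over_rho:
  assumes j: "1 \<le> j"
  shows "((\<lambda>t. norming j t / \<rho> t) \<longlongrightarrow> 0) at_top"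
proof (rule tendsto_sandwich[of "\<lambda>_. 0"])
  have npos: "eventually (\<lambda>t. 0 < norming j t) at_top"
    using norming_at_top[OF j] by (simp add: filterlim_at_top_dense)
  show "((\<lambda>t. (ln t)\<^sup>2 * norming j t / \<rho> t) \<longlongrightarrow> 0) at_top" by (rule norming_small[OF j])
  show "eventually (\<lambda>t. 0 \<le> norming j t / \<rho> t) at_top" using npos by eventually_elim simp
  have "eventually (\<lambda>t::real. 1 \<le> (ln t)\<^sup>2) at_top" by real_asymp
  then show "eventually (\<lambda>t. norming j t / \<rho> t \<le> (ln t)\<^sup>2 * norming j t / \<rho> t) at_top"
    using npos
  proof eventually_elim
    case (elim t)
    have "1 * norming j t \<le> (ln t)\<^sup>2 * norming j t" using elim by (intro mult_right_mono) auto
    then show ?case by (intro divide_right_mono) auto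
  qed
qed simp

text \<open>The point is \<kappa> > 1: along geometric times the bound is of order n^(- \<kappa>),
  hence summable.\<close>

lemma level_tail:
  assumes j: "1 \<le> j" and e: "0 < e"
  shows "\<exists>\<kappa>>1. eventually (\<lambda>t. \<P>(\<omega> in M. (sqrt 2 + e) * norming j t \<le> \<bar>K j t \<omega>\<bar>) \<le> 2 * exp (- (\<kappa> * ln (ln t)))) at_top"
proof -
  define c where "c = var_const j \<alpha>"
  have c: "0 < c" unfolding c_def by (rule var_const_pos[OF j])
  define \<kappa> where "\<kappa> = (sqrt 2 + e)\<^sup>2 / 2"
  have \<kappa>: "1 < \<kappa>" using e by (simp add: \<kappa>_def power2_sum add_pos_pos)
  \<comment> \<open>The Chernoff parameter x / variance, with the variance replaced by its
    asymptotic value c * \<rho>. Then r tends to 1 and the exponent is - \<kappa> (2 - r) ln (ln t);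
    halving the excess of \<kappa> over 1 absorbs the error in r.\<close>
  define l where "l t = (sqrt 2 + e) * norming j t / (c * \<rho> t)" for t
  define r where "r t = V j t / \<rho> t / c * (1 + 3 * l t)" for t
  have l0: "(l \<longlongrightarrow> 0) at_top"
    using tendsto_mult[OF tendsto_const[of "(sqrt 2 + e) / c"] norming_over_rho[OF j]] by (simp add: l_def[abs_def])
  have "(r \<longlongrightarrow> c / c * (1 + 3 * 0)) at_top"
    unfolding r_def using c V_asymptotics[OF j] l0 by (intro tendsto_intros) (auto simp: c_def)
  then have r1: "(r \<longlongrightarrow> 1) at_top" using c by simp
  have ev: "eventually (\<lambda>t. \<P>(\<omega> in M. (sqrt 2 + e) * norming j t \<le> \<bar>K j t \<omega>\<bar>) \<le> 2 * exp (- ((1 + \<kappa>) / 2 * ln (ln t)))) at_top"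
  proof -
    have "eventually (\<lambda>t. r t < 2 - (1 + \<kappa>) / 2 / \<kappa>) at_top"
      by (rule order_tendstoD[OF r1]) (use \<kappa> in \<open>simp add: field_simps\<close>)
    moreover have "eventually (\<lambda>t. l t < 1) at_top" by (rule order_tendstoD[OF l0]) simp
    ultimately show ?thesis using rho_pos eventually_lnln eventually_gt_at_top[of 0]
    proof eventually_elim
      case (elim t)
      define x where "x = (sqrt 2 + e) * norming j t"
      have n2: "(norming j t)\<^sup>2 = c * \<rho> t * ln (ln t)" "0 \<le> norming j t"
        using elim c by (auto simp: norming_def c_def[symmetric])
      have x2: "x\<^sup>2 = 2 * \<kappa> * (c * \<rho> t * ln (ln t))"
        unfolding x_def power_mult_distrib n2 by (simp add: \<kappa>_def)
      have lx: "l t = x / (c * \<rho> t)" by (simp add: l_def x_def)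
      have l1: "0 \<le> l t" "l t \<le> 1" using elim c e n2 by (auto simp: l_def)
      have exponent: "- l t * x + (l t)\<^sup>2 / 2 * (1 + 3 * l t) * V j t = - (\<kappa> * ln (ln t) * (2 - r t))"
      proof -
        have V: "(1 + 3 * l t) * V j t = r t * (c * \<rho> t)" using elim c by (simp add: r_def field_simps)
        have "l t * x = 2 * \<kappa> * ln (ln t)" "(l t)\<^sup>2 * (c * \<rho> t) = 2 * \<kappa> * ln (ln t)"
          using x2 elim c by (auto simp: lx power2_eq_square field_simps)
        then show ?thesis
          by (simp add: mult.assoc V) (simp add: algebra_simps)
      qed
      have "(1 + \<kappa>) / 2 = \<kappa> * ((1 + \<kappa>) / 2 / \<kappa>)" using \<kappa> by simp
      also have "\<dots> \<le> \<kappa> * (2 - r t)" using elim \<kappa> by (intro mult_left_mono) auto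
      finally have "(1 + \<kappa>) / 2 * ln (ln t) \<le> \<kappa> * (2 - r t) * ln (ln t)" using elim by (intro mult_right_mono) auto
      then have ee: "exp (- (\<kappa> * ln (ln t) * (2 - r t))) \<le> exp (- ((1 + \<kappa>) / 2 * ln (ln t)))" by (simp add: mult_ac)
      show ?case
      proof (rule two_sided_tail[of "K j t"])
        fix b :: real assume b: "\<bar>b\<bar> = 1"
        have "\<P>(\<omega> in M. x \<le> b * K j t \<omega>) \<le> exp (- l t * x + (l t)\<^sup>2 / 2 * (1 + 3 * l t) * V j t)"
          using elim j l1 b by (intro chernoff_K) auto
        also have "\<dots> = exp (- (\<kappa> * ln (ln t) * (2 - r t)))" by (simp only: exponent)
        also note ee
        finally show "\<P>(\<omega> in M. (sqrt 2 + e) * norming j t \<le> b * K j t \<omega>) \<le> exp (- ((1 + \<kappa>) / 2 * ln (ln t)))"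
          unfolding x_def .
      qed simp
    qed
  qed
  show ?thesis by (rule exI[of _ "(1 + \<kappa>) / 2"]) (use ev \<kappa> in auto)
qed

text \<open>Restates the bound of \<open>crossing\<close> relative to a base time t, uniformly for s
  in [t, 2 t]: \<open>G\<close> is bounded by a multiple of \<rho>, and \<rho> (2 t) is of the order
  of \<rho> t.\<close>

lemma EA_increment:
  assumes j: "1 \<le> j"
  shows "\<exists>C>0. eventually (\<lambda>t. \<forall>s u. t \<le> s \<longrightarrow> s \<le> 2 * t \<longrightarrow> s \<le> u \<longrightarrow> u \<le> 2 * s \<longrightarrow>
      (u - s) / s * (real j * 2 ^ (j - 1) * G j s) \<le> C * ((u - s) / t) * \<rho> t) at_top"
proof -
  obtain K where K: "0 < K" "eventually (\<lambda>t. G j t \<le> K * \<rho> t) at_top" using G_le_rho[OF j] by blast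
  then obtain t0 where t0: "\<And>t. t \<ge> t0 \<Longrightarrow> G j t \<le> K * \<rho> t" by (auto simp: eventually_at_top_linorder)
  have "eventually (\<lambda>t. \<rho> (2 * t) / \<rho> t < 2 powr \<alpha> + 1) at_top"
    by (rule order_tendstoD[OF rho_ratio]) auto
  then have "eventually (\<lambda>t. \<rho> (2 * t) \<le> (2 powr \<alpha> + 1) * \<rho> t) at_top"
    using rho_pos by eventually_elim (simp add: field_simps)
  then have "eventually (\<lambda>t. \<forall>s u. t \<le> s \<longrightarrow> s \<le> 2 * t \<longrightarrow> s \<le> u \<longrightarrow> u \<le> 2 * s \<longrightarrow>
      (u - s) / s * (real j * 2 ^ (j - 1) * G j s) \<le> (real j * 2 ^ (j - 1) * (K * (2 powr \<alpha> + 1))) * ((u - s) / t) * \<rho> t) at_top"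
    using eventually_ge_at_top[of t0] eventually_gt_at_top[of 0]
  proof eventually_elim
    case (elim t)
    show ?case
    proof (intro allI impI)
      fix s u assume s: "t \<le> s" "s \<le> 2 * t" "s \<le> u" "u \<le> 2 * s"
      have "G j s \<le> K * \<rho> s" using t0 s elim by simp
      also have "\<dots> \<le> K * \<rho> (2 * t)" using K s by (intro mult_left_mono rho_mono) auto
      also have "\<dots> \<le> K * ((2 powr \<alpha> + 1) * \<rho> t)" using K elim by (intro mult_left_mono) auto
      finally have g: "real j * 2 ^ (j - 1) * G j s \<le> real j * 2 ^ (j - 1) * (K * ((2 powr \<alpha> + 1) * \<rho> t))"
        by (intro mult_left_mono) auto
      have "(u - s) / s \<le> (u - s) / t" using s elim by (intro divide_left_mono mult_pos_pos) auto
      then have "(u - s) / s * (real j * 2 ^ (j - 1) * G j s) \<le> (u - s) / t * (real j * 2 ^ (j - 1) * (K * ((2 powr \<alpha> + 1) * \<rho> t)))"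
        by (rule mult_mono[OF _ g]) (use s elim G_nonneg[OF j, of s] in auto)
      then show "(u - s) / s * (real j * 2 ^ (j - 1) * G j s) \<le> (real j * 2 ^ (j - 1) * (K * (2 powr \<alpha> + 1))) * ((u - s) / t) * \<rho> t"
        by (simp add: mult_ac)
    qed
  qed
  moreover have "0 < real j * 2 ^ (j - 1) * (K * (2 powr \<alpha> + 1))"
    using j K by (intro mult_pos_pos add_pos_pos) auto
  ultimately show ?thesis by blast
qed

text \<open>The factor \<open>1 / \<eta>\<close> in the exponent is what makes two grids suffice below.\<close>

lemma oscillation_tail:
  assumes i: "1 \<le> i" and j: "1 \<le> j" and e: "0 < e"
  shows "\<exists>a>0. \<exists>C>0. eventually (\<lambda>t. \<forall>s u \<eta>. t \<le> s \<longrightarrow> s \<le> 2 * t \<longrightarrow> s \<le> u \<longrightarrow> u \<le> s + \<eta> * t \<longrightarrow> 0 < \<eta> \<longrightarrow> \<eta> \<le> 1 \<longrightarrow>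
      norming j t \<le> C * \<eta> * \<rho> t \<longrightarrow>
      \<P>(\<omega> in M. e * norming j t \<le> \<bar>D i s u \<omega>\<bar>) \<le> 2 * exp (- (a / \<eta> * ln (ln t)))) at_top"
proof -
  obtain C where C: "0 < C" and ev: "eventually (\<lambda>t. \<forall>s u. t \<le> s \<longrightarrow> s \<le> 2 * t \<longrightarrow> s \<le> u \<longrightarrow> u \<le> 2 * s \<longrightarrow>
      (u - s) / s * (real i * 2 ^ (i - 1) * G i s) \<le> C * ((u - s) / t) * \<rho> t) at_top"
    using EA_increment[OF i] by blast
  define c where "c = var_const j \<alpha>"
  have c: "0 < c" unfolding c_def by (rule var_const_pos[OF j])
  \<comment> \<open>Comes from x^2 / (8 w) with x = e * norming and w = C * \<eta> * \<rho>. The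
    condition on the norming with constant 4 * C / e is exactly x \<le> 4 * w.\<close>
  define a where "a = e\<^sup>2 * c / (8 * C)"
  have a: "0 < a" using e c C by (simp add: a_def)
  have npos: "eventually (\<lambda>t. 0 < norming j t) at_top" using norming_at_top[OF j] by (simp add: filterlim_at_top_dense)
  have "eventually (\<lambda>t. \<forall>s u \<eta>. t \<le> s \<longrightarrow> s \<le> 2 * t \<longrightarrow> s \<le> u \<longrightarrow> u \<le> s + \<eta> * t \<longrightarrow> 0 < \<eta> \<longrightarrow> \<eta> \<le> 1 \<longrightarrow>
      norming j t \<le> (4 * C / e) * \<eta> * \<rho> t \<longrightarrow>
      \<P>(\<omega> in M. e * norming j t \<le> \<bar>D i s u \<omega>\<bar>) \<le> 2 * exp (- (a / \<eta> * ln (ln t)))) at_top"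
    using ev npos eventually_lnln rho_pos eventually_gt_at_top[of 0]
  proof eventually_elim
    case (elim t)
    show ?case
    proof (intro allI impI)
      fix s u \<eta> assume s: "t \<le> s" "s \<le> 2 * t" "s \<le> u" "u \<le> s + \<eta> * t" and \<eta>: "0 < \<eta>" "\<eta> \<le> 1"
        and n: "norming j t \<le> (4 * C / e) * \<eta> * \<rho> t"
      have "\<eta> * t \<le> 1 * t" using \<eta> elim by (intro mult_right_mono) auto
      then have u2: "u \<le> 2 * s" using s by simp
      have "(u - s) / s * (real i * 2 ^ (i - 1) * G i s) \<le> C * ((u - s) / t) * \<rho> t" using elim(1) s u2 by blast
      also have "\<dots> \<le> C * \<eta> * \<rho> t" using s elim C by (intro mult_right_mono mult_left_mono) (auto simp: field_simps)
      finally have w: "(u - s) / s * (real i * 2 ^ (i - 1) * G i s) \<le> C * \<eta> * \<rho> t" .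
      have "\<P>(\<omega> in M. e * norming j t \<le> \<bar>D i s u \<omega>\<bar>) \<le> 2 * exp (- ((e * norming j t)\<^sup>2 / (8 * (C * \<eta> * \<rho> t))))"
        using s u2 elim C \<eta> e n by (intro increment_tail[OF _ _ _ i w]) (auto simp: field_simps)
      also have "(e * norming j t)\<^sup>2 / (8 * (C * \<eta> * \<rho> t)) = a / \<eta> * ln (ln t)"
        using elim C \<eta> by (simp add: power_mult_distrib norming_square[OF j] a_def c_def field_simps)
      finally show "\<P>(\<omega> in M. e * norming j t \<le> \<bar>D i s u \<omega>\<bar>) \<le> 2 * exp (- (a / \<eta> * ln (ln t)))" .
    qed
  qed
  moreover have "0 < 4 * C / e" using C e by simp
  ultimately show ?thesis using a by blast
qed

section \<open>Control of the monotone counts between geometric times\<close>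

lemma EA_mono: "0 < s \<Longrightarrow> s \<le> t \<Longrightarrow> t \<le> 2 * s \<Longrightarrow> 1 \<le> i \<Longrightarrow> EA i s \<le> EA i t"
  using crossing(4)[of s t i] by (cases "s = t") auto

lemma filterlim_power_at_top: "1 < \<gamma> \<Longrightarrow> filterlim (\<lambda>n. \<gamma> ^ n :: real) at_top sequentially"
  using filterlim_realpow_sequentially_gt1[of \<gamma>] by (simp add: filterlim_at_infinity_imp_filterlim_at_top eventually_sequentially filterlim_at_top_imp_at_infinity)

lemma oscillation_AE:
  assumes i: "1 \<le> i" and j: "1 \<le> j" and e: "0 < e"
  shows "\<exists>h0>0. \<forall>h. 0 < h \<longrightarrow> h \<le> h0 \<longrightarrow> (AE \<omega> in M. eventually (\<lambda>n. \<forall>t. (1 + h) ^ n \<le> t \<longrightarrow> t \<le> (1 + h) ^ Suc n \<longrightarrow>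
      \<bar>D i ((1 + h) ^ n) t \<omega>\<bar> \<le> 3 * e * norming j ((1 + h) ^ n)) sequentially)"
proof -
  obtain a C where a: "0 < a" and C: "0 < C" and osc: "eventually (\<lambda>t. \<forall>s u \<eta>. t \<le> s \<longrightarrow> s \<le> 2 * t \<longrightarrow> s \<le> u \<longrightarrow> u \<le> s + \<eta> * t \<longrightarrow> 0 < \<eta> \<longrightarrow> \<eta> \<le> 1 \<longrightarrow>
      norming j t \<le> C * \<eta> * \<rho> t \<longrightarrow>
      \<P>(\<omega> in M. e * norming j t \<le> \<bar>D i s u \<omega>\<bar>) \<le> 2 * exp (- (a / \<eta> * ln (ln t)))) at_top"
    using oscillation_tail[OF i j e] by blast
  obtain C' where C': "0 < C'" and inc: "eventually (\<lambda>t. \<forall>s u. t \<le> s \<longrightarrow> s \<le> 2 * t \<longrightarrow> s \<le> u \<longrightarrow> u \<le> 2 * s \<longrightarrow>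
      (u - s) / s * (real i * 2 ^ (i - 1) * G i s) \<le> C' * ((u - s) / t) * \<rho> t) at_top"
    using EA_increment[OF i] by blast
  \<comment> \<open>a / h \<ge> 4 makes the coarse-grid bound of order n^(-4), which outweighs the
    n^2 + 1 points.\<close>
  define h0 where "h0 = min 1 (a / 4)"
  have h0: "0 < h0" using a by (simp add: h0_def)
  have main: "AE \<omega> in M. eventually (\<lambda>n. \<forall>t. (1 + h) ^ n \<le> t \<longrightarrow> t \<le> (1 + h) ^ Suc n \<longrightarrow>
      \<bar>D i ((1 + h) ^ n) t \<omega>\<bar> \<le> 3 * e * norming j ((1 + h) ^ n)) sequentially"
    if h: "0 < h" "h \<le> h0" for h
  proof -
    define \<gamma> where "\<gamma> = 1 + h"
    define t where "t n = \<gamma> ^ n" for n :: nat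
    \<comment> \<open>At least \<rho> (t n), so that the mean increment over one fine step stays
      bounded; at most 2 ^ n + 1, so that the number of points is no more than exponential.\<close>
    define N where "N n = nat \<lceil>t n\<rceil>" for n
    \<comment> \<open>\<open>n\<^sup>2\<close> coarse steps from \<open>t n\<close> to \<open>t (Suc n)\<close>, each divided into \<open>N n\<close> fine ones\<close>
    define P where "P n q = t n + h * t n * real q / (real n ^ 2 * real (N n))" for n q
    define l where "l n = ln (ln (t n))" for n
    have h1: "h \<le> 1" "4 \<le> a / h" using h a by (auto simp: h0_def field_simps)
    have g: "1 < \<gamma>" "\<gamma> \<le> 2" using h h1 by (auto simp: \<gamma>_def)
    have lg: "0 < ln \<gamma>" using g by simp
    have t_pos: "0 < t n" "1 \<le> t n" for n using g by (auto simp: t_def)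
    have t_Suc: "t (Suc n) = t n + h * t n" for n by (simp add: t_def \<gamma>_def algebra_simps)
    have t_top: "filterlim t at_top sequentially" unfolding t_def[abs_def] by (rule filterlim_power_at_top[OF g(1)])
    have l_eq: "l n = ln (real n * ln \<gamma>)" for n using g by (simp add: l_def t_def ln_realpow)
    have N: "1 \<le> N n" "t n \<le> real (N n)" "real (N n) \<le> 2 ^ n + 1" for n
    proof -
      show "t n \<le> real (N n)" by (simp add: N_def real_nat_ceiling_ge)
      then show "1 \<le> N n" using t_pos(2)[of n] by linarith
      have "real (N n) \<le> t n + 1" using t_pos(1)[of n] unfolding N_def by linarith
      also have "t n \<le> 2 ^ n" unfolding t_def using g by (intro power_mono) auto
      finally show "real (N n) \<le> 2 ^ n + 1" by simp
    qed
    have P_mono: "P n q \<le> P n r" if "q \<le> r" for n q r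
      unfolding P_def using that h t_pos(1)[of n] by (intro add_left_mono divide_right_mono mult_left_mono) auto
    have P_0: "P n 0 = t n" for n by (simp add: P_def)
    have P_end: "P n (n\<^sup>2 * N n) = t (Suc n)" if "1 \<le> n" for n
      using that N(1)[of n] by (simp add: P_def t_Suc)
    have P_bounds: "t n \<le> P n q" "P n q \<le> 2 * t n" if "1 \<le> n" "q \<le> n\<^sup>2 * N n" for n q
    proof -
      show "t n \<le> P n q" using P_mono[of 0 q n] P_0 by simp
      have "P n q \<le> t n + h * t n" using P_mono[OF that(2), of n] P_end[OF that(1)] t_Suc by simp
      also have "\<dots> \<le> t n + 1 * t n" using h1 t_pos(1)[of n] by (intro add_left_mono mult_right_mono) auto
      finally show "P n q \<le> 2 * t n" by simp
    qed
    have ln_t: "ln (t n) = real n * ln \<gamma>" for n using g by (simp add: t_def ln_realpow)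
    \<comment> \<open>The condition of \<open>oscillation_tail\<close> for the relative distances h
      and h / n^2; the second one calls for the squared logarithm in
      \<open>norming_small\<close>.\<close>
    have ev_n: "eventually (\<lambda>n. norming j (t n) \<le> C * h * \<rho> (t n)) sequentially"
      "eventually (\<lambda>n. norming j (t n) \<le> C * (h / real n ^ 2) * \<rho> (t n)) sequentially"
    proof -
      have "eventually (\<lambda>s. (ln s)\<^sup>2 * norming j s / \<rho> s < C * h * (ln \<gamma>)\<^sup>2) at_top"
        by (rule order_tendstoD[OF norming_small[OF j]]) (use C h lg in auto)
      from eventually_compose_filterlim[OF eventually_conj[OF this rho_pos] t_top] eventually_ge_at_top[of 1]
      have *: "eventually (\<lambda>n. real n ^ 2 * norming j (t n) \<le> C * h * \<rho> (t n) \<and> 1 \<le> n) sequentially"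
      proof eventually_elim
        case (elim n)
        then have "(ln (t n))\<^sup>2 * norming j (t n) / \<rho> (t n) < C * h * (ln \<gamma>)\<^sup>2" "0 < \<rho> (t n)" by auto
        then have "(real n * ln \<gamma>)\<^sup>2 * norming j (t n) < C * h * (ln \<gamma>)\<^sup>2 * \<rho> (t n)"
          unfolding ln_t by (simp only: pos_divide_less_eq)
        then have "(ln \<gamma>)\<^sup>2 * (real n ^ 2 * norming j (t n)) < (ln \<gamma>)\<^sup>2 * (C * h * \<rho> (t n))"
          by (simp add: power_mult_distrib mult_ac)
        then show ?case using lg elim by simp
      qed
      then show "eventually (\<lambda>n. norming j (t n) \<le> C * (h / real n ^ 2) * \<rho> (t n)) sequentially"
        by eventually_elim (simp add: field_simps)
      show "eventually (\<lambda>n. norming j (t n) \<le> C * h * \<rho> (t n)) sequentially"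
        using * eventually_compose_filterlim[OF filterlim_at_top_dense[THEN iffD1, OF norming_at_top[OF j], rule_format, of 0] t_top]
      proof eventually_elim
        case (elim n)
        have "1 ^ 2 * norming j (t n) \<le> real n ^ 2 * norming j (t n)" using elim by (intro mult_right_mono power_mono) auto
        also have "\<dots> \<le> C * h * \<rho> (t n)" using elim by blast
        finally show ?case by simp
      qed
    qed
    have lge: "eventually (\<lambda>n. 1 \<le> l n) sequentially"
      unfolding l_eq using lg by real_asymp
    note osc_t = eventually_compose_filterlim[OF osc t_top]
    define B1 where "B1 n \<omega> \<longleftrightarrow> (\<exists>r\<le>n\<^sup>2. e * norming j (t n) \<le> \<bar>D i (t n) (P n (r * N n)) \<omega>\<bar>)" for n \<omega>
    define B2 where "B2 n \<omega> \<longleftrightarrow> (\<exists>q\<le>n\<^sup>2 * N n. e * norming j (t n) \<le> \<bar>D i (P n (q div N n * N n)) (P n q) \<omega>\<bar>)" for n \<omega>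
    have AE1: "AE \<omega> in M. eventually (\<lambda>n. \<not> B1 n \<omega>) sequentially"
    proof (rule borel_cantelli_1)
      show "{\<omega> \<in> space M. B1 n \<omega>} \<in> events" for n unfolding B1_def by measurable
      have "(\<lambda>n. real (Suc (n\<^sup>2)) * (2 * exp (- (4 * ln (real n * ln \<gamma>))))) \<in> O(\<lambda>n. 1 / real n ^ 2)"
        using lg by real_asymp
      then show "summable (\<lambda>n. real (Suc (n\<^sup>2)) * (2 * exp (- (4 * ln (real n * ln \<gamma>)))))"
        by (rule summable_comparison_test_bigo[rotated]) (use inverse_power_summable[of 2] in \<open>simp add: divide_inverse\<close>)
      show "eventually (\<lambda>n. \<P>(\<omega> in M. B1 n \<omega>) \<le> real (Suc (n\<^sup>2)) * (2 * exp (- (4 * ln (real n * ln \<gamma>))))) sequentially"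
        using osc_t ev_n(1) lge eventually_ge_at_top[of 1]
      proof eventually_elim
        case (elim n)
        show ?case unfolding B1_def
        proof (rule prob_ex_le)
          fix r assume r: "r \<le> n\<^sup>2"
          then have r': "r * N n \<le> n\<^sup>2 * N n" by simp
          have "P n (r * N n) \<le> t n + h * t n" using P_mono[OF r', of n] P_end[OF elim(4)] t_Suc by simp
          then have "\<P>(\<omega> in M. e * norming j (t n) \<le> \<bar>D i (t n) (P n (r * N n)) \<omega>\<bar>) \<le> 2 * exp (- (a / h * ln (ln (t n))))"
            using t_pos[of n] by (intro elim(1)[rule_format, OF _ _ P_bounds(1)[OF elim(4) r'] _ h(1) h1(1) elim(2)]) simp_all
          also have "\<dots> \<le> 2 * exp (- (4 * ln (ln (t n))))"
          proof -
            have "4 * l n \<le> a / h * l n" by (rule mult_right_mono[OF h1(2)]) (use elim(3) in linarith)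
            then have "- (a / h * ln (ln (t n))) \<le> - (4 * ln (ln (t n)))" unfolding l_def by linarith
            then have "exp (- (a / h * ln (ln (t n)))) \<le> exp (- (4 * ln (ln (t n))))" by (simp only: exp_le_cancel_iff)
            then show ?thesis by linarith
          qed
          finally show "\<P>(\<omega> in M. e * norming j (t n) \<le> \<bar>D i (t n) (P n (r * N n)) \<omega>\<bar>) \<le> 2 * exp (- (4 * ln (real n * ln \<gamma>)))"
            by (simp add: ln_t)
        qed measurable
      qed
    qed
    \<comment> \<open>Relative distances are now at most h / n^2, so the exponent grows like n^2 and
      beats the roughly n^2 * 2^n points.\<close>
    have AE2: "AE \<omega> in M. eventually (\<lambda>n. \<not> B2 n \<omega>) sequentially"
    proof (rule borel_cantelli_1)
      show "{\<omega> \<in> space M. B2 n \<omega>} \<in> events" for n unfolding B2_def by measurable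
      have "(\<lambda>n. (real n ^ 2 * (2 ^ n + 1) + 1) * (2 * exp (- (4 * real n ^ 2)))) \<in> O(\<lambda>n. 1 / real n ^ 2)"
        by real_asymp
      then show "summable (\<lambda>n. (real n ^ 2 * (2 ^ n + 1) + 1) * (2 * exp (- (4 * real n ^ 2))))"
        by (rule summable_comparison_test_bigo[rotated]) (use inverse_power_summable[of 2] in \<open>simp add: divide_inverse\<close>)
      show "eventually (\<lambda>n. \<P>(\<omega> in M. B2 n \<omega>) \<le> (real n ^ 2 * (2 ^ n + 1) + 1) * (2 * exp (- (4 * real n ^ 2)))) sequentially"
        using osc_t ev_n(2) lge eventually_ge_at_top[of 1]
      proof eventually_elim
        case (elim n)
        have n2: "1 \<le> real n ^ 2" using elim by simp
        have "\<P>(\<omega> in M. B2 n \<omega>) \<le> real (Suc (n\<^sup>2 * N n)) * (2 * exp (- (4 * real n ^ 2)))" unfolding B2_def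
        proof (rule prob_ex_le)
          fix q assume q: "q \<le> n\<^sup>2 * N n"
          \<comment> \<open>The last coarse point not beyond q, fewer than N n fine steps
            away.\<close>
          define r where "r = q div N n * N n"
          have "q = r + q mod N n" "q mod N n < N n" using N(1)[of n] by (simp_all add: r_def)
          then have r: "r \<le> q" "q \<le> r + N n" by linarith+
          have b: "t n \<le> P n r" "P n r \<le> 2 * t n" using P_bounds[OF elim(4)] r q by (auto simp: order_trans)
          have "P n q \<le> P n (r + N n)" by (rule P_mono[OF r(2)])
          also have "\<dots> = P n r + h / real n ^ 2 * t n"
            using N(1)[of n] elim by (simp add: P_def field_simps)
          finally have Pq: "P n q \<le> P n r + h / real n ^ 2 * t n" .
          have \<eta>: "0 < h / real n ^ 2" "h / real n ^ 2 \<le> 1"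
          proof -
            show "0 < h / real n ^ 2" using h elim(4) by simp
            have "h \<le> real n ^ 2" using h1(1) n2 by linarith
            then show "h / real n ^ 2 \<le> 1" using n2 by (subst divide_le_eq_1_pos) linarith+
          qed
          have "\<P>(\<omega> in M. e * norming j (t n) \<le> \<bar>D i (P n r) (P n q) \<omega>\<bar>) \<le> 2 * exp (- (a / (h / real n ^ 2) * ln (ln (t n))))"
            by (rule elim(1)[rule_format, OF b P_mono[OF r(1)] Pq \<eta> elim(2)])
          also have "\<dots> \<le> 2 * exp (- (4 * real n ^ 2))"
          proof -
            have "4 * real n ^ 2 * 1 \<le> (a / h) * real n ^ 2 * l n"
              using h1(2) elim(3) a h(1) by (intro mult_mono) auto
            then have "- (a / (h / real n ^ 2) * ln (ln (t n))) \<le> - (4 * real n ^ 2)" by (simp add: l_def field_simps)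
            then show ?thesis by simp
          qed
          finally show "\<P>(\<omega> in M. e * norming j (t n) \<le> \<bar>D i (P n (q div N n * N n)) (P n q) \<omega>\<bar>) \<le> 2 * exp (- (4 * real n ^ 2))"
            unfolding r_def .
        qed measurable
        also have "\<dots> \<le> (real n ^ 2 * (2 ^ n + 1) + 1) * (2 * exp (- (4 * real n ^ 2)))"
        proof (rule mult_right_mono)
          have "real n ^ 2 * real (N n) \<le> real n ^ 2 * (2 ^ n + 1)" using N(3) by (intro mult_left_mono) auto
          then show "real (Suc (n\<^sup>2 * N n)) \<le> real n ^ 2 * (2 ^ n + 1) + 1" by simp
        qed simp
        finally show ?case .
      qed
    qed
    \<comment> \<open>The norming tends to infinity, so it eventually dominates the bounded mean
      increment over a fine step.\<close>
    have evC: "eventually (\<lambda>n. C' \<le> e * norming j (t n)) sequentially"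
    proof -
      have "eventually (\<lambda>s. C' / e \<le> norming j s) at_top" using norming_at_top[OF j] by (simp add: filterlim_at_top)
      from eventually_compose_filterlim[OF this t_top] show ?thesis
        by eventually_elim (use e in \<open>simp add: field_simps\<close>)
    qed
    have "AE \<omega> in M. eventually (\<lambda>n. \<forall>s. t n \<le> s \<longrightarrow> s \<le> t (Suc n) \<longrightarrow>
        \<bar>D i (t n) s \<omega>\<bar> \<le> 3 * e * norming j (t n)) sequentially"
      using AE1 AE2 AE_regular
    proof eventually_elim
      case w: (elim \<omega>)
      show ?case
        using w(1,2) evC eventually_compose_filterlim[OF inc t_top] eventually_ge_at_top[of 1]
      proof eventually_elim
        case (elim n)
        have n: "1 \<le> n" by fact
        define Q where "Q = n\<^sup>2 * N n"
        have Q: "1 \<le> Q" using n N(1)[of n] by (simp add: Q_def Suc_le_eq)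
        have pts: "\<bar>D i (t n) (P n q) \<omega>\<bar> \<le> 2 * e * norming j (t n)" if q: "q \<le> Q" for q
        proof -
          have "q div N n \<le> n\<^sup>2" using q N(1)[of n] unfolding Q_def
            by (metis div_le_mono nonzero_mult_div_cancel_right not_one_le_zero)
          then have "\<bar>D i (t n) (P n (q div N n * N n)) \<omega>\<bar> < e * norming j (t n)"
            using elim(1) unfolding B1_def by (meson not_le)
          moreover have "\<bar>D i (P n (q div N n * N n)) (P n q) \<omega>\<bar> < e * norming j (t n)"
            using elim(2) q unfolding B2_def Q_def by (meson not_le)
          moreover have "D i (t n) (P n q) \<omega> = D i (t n) (P n (q div N n * N n)) \<omega> + D i (P n (q div N n * N n)) (P n q) \<omega>"
            by (simp add: D_def)
          ultimately show ?thesis by linarith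
        qed
        show ?case
        proof (intro allI impI)
          fix s assume s: "t n \<le> s" "s \<le> t (Suc n)"
          have "\<exists>q<Q. P n q \<le> s \<and> s \<le> P n (Suc q)"
          proof -
            define q where "q = (LEAST q. s \<le> P n (Suc q))"
            have QQ: "Suc (Q - 1) = Q" using Q by simp
            have ex: "s \<le> P n (Suc (Q - 1))" unfolding QQ using s P_end[OF n] by (simp only: Q_def)
            have 1: "s \<le> P n (Suc q)" unfolding q_def by (rule LeastI) (rule ex)
            have 2: "q \<le> Q - 1" unfolding q_def by (rule Least_le) (rule ex)
            have 3: "P n q \<le> s"
            proof (cases q)
              case 0
              then show ?thesis using P_0 s by simp
            next
              case (Suc r)
              then have "\<not> s \<le> P n (Suc r)" using not_less_Least[of r "\<lambda>q. s \<le> P n (Suc q)"] unfolding q_def by simp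
              then show ?thesis using Suc by simp
            qed
            show ?thesis using 1 2 3 Q by (intro exI[of _ q]) auto
          qed
          then obtain q where q: "q < Q" "P n q \<le> s" "s \<le> P n (Suc q)" by blast
          have bq: "t n \<le> P n q" "P n q \<le> 2 * t n" "P n (Suc q) \<le> 2 * t n"
            using P_bounds[OF n] q(1) unfolding Q_def by auto
          have strict: "P n q < P n (Suc q)" "P n (Suc q) - P n q = h * t n / (real n ^ 2 * real (N n))"
          proof -
            show "P n (Suc q) - P n q = h * t n / (real n ^ 2 * real (N n))"
              by (simp add: P_def diff_divide_distrib[symmetric] algebra_simps)
            moreover have "0 < h * t n / (real n ^ 2 * real (N n))"
              using h t_pos[of n] N(1)[of n] n by (intro divide_pos_pos mult_pos_pos) auto
            ultimately show "P n q < P n (Suc q)" by linarith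
          qed
          have le2: "P n (Suc q) \<le> 2 * P n q" using bq by linarith
          have Pq0: "0 < P n q" using bq t_pos[of n] by linarith
          have "EA i (P n (Suc q)) - EA i (P n q) \<le> (P n (Suc q) - P n q) / P n q * (real i * 2 ^ (i - 1) * G i (P n q))"
            by (rule crossing(5)[OF Pq0 strict(1) le2 i])
          also have "\<dots> \<le> C' * ((P n (Suc q) - P n q) / t n) * \<rho> (t n)"
            using elim(4) bq strict(1) le2 by auto
          also have "\<dots> = C' * (h / real n ^ 2) * (\<rho> (t n) / real (N n))"
            unfolding strict(2) using t_pos[of n] by (simp add: field_simps)
          also have "\<dots> \<le> C' * 1 * 1"
          proof (intro mult_mono)
            have "h * 1 \<le> 1 * real n ^ 2" using h h1 n by (intro mult_mono) auto
            then show "h / real n ^ 2 \<le> 1" using n by (simp add: field_simps)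
            have "\<rho> (t n) \<le> real (N n)" using rho_le[of "t n"] N(2)[of n] t_pos[of n] by linarith
            then show "\<rho> (t n) / real (N n) \<le> 1" using N(1)[of n] by simp
          qed (use C' h in auto)
          finally have dEA: "EA i (P n (Suc q)) - EA i (P n q) \<le> e * norming j (t n)" using elim(3) by simp
          have EAm: "EA i (P n q) \<le> EA i s" "EA i s \<le> EA i (P n (Suc q))"
            using Pq0 q bq by (intro EA_mono i; linarith)+
          have Am: "A i (P n q) \<omega> \<le> A i s \<omega>" "A i s \<omega> \<le> A i (P n (Suc q)) \<omega>"
            by (intro regular_A_mono w(3) i q)+
          have "\<bar>D i (t n) (P n q) \<omega>\<bar> \<le> 2 * e * norming j (t n)" "\<bar>D i (t n) (P n (Suc q)) \<omega>\<bar> \<le> 2 * e * norming j (t n)"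
            using q(1) by (auto intro: pts)
          \<comment> \<open>Between neighbouring fine points both \<open>A\<close> and
            \<open>EA\<close> are monotone: two of the three multiples of e come from the endpoints,
            the third from the mean increment.\<close>
          then show "\<bar>D i (t n) s \<omega>\<bar> \<le> 3 * e * norming j (t n)"
            using dEA EAm Am unfolding D_def by linarith
        qed
      qed
    qed
    then show ?thesis unfolding t_def \<gamma>_def .
  qed
  show ?thesis using h0 main by blast
qed

text \<open>ln (\<gamma>^n) is linear in n, so the terms are a constant times n^(-
  \<kappa>).\<close>

lemma summable_exp_ln_power:
  assumes "1 < \<gamma>" "1 < \<kappa>"
  shows "summable (\<lambda>n. 2 * exp (- (\<kappa> * ln (ln (\<gamma> ^ n)))) :: real)"
proof -
  have lg: "0 < ln \<gamma>" using assms by simp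
  have "summable (\<lambda>n. 2 * (ln \<gamma>) powr (- \<kappa>) * real n powr (- \<kappa>))"
    using assms by (intro summable_mult) (simp add: summable_real_powr_iff)
  then show ?thesis
  proof (rule summable_comparison_test_ev[rotated])
    show "eventually (\<lambda>n. norm (2 * exp (- (\<kappa> * ln (ln (\<gamma> ^ n))))) \<le> 2 * (ln \<gamma>) powr (- \<kappa>) * real n powr (- \<kappa>)) sequentially"
      using eventually_ge_at_top[of 1]
    proof eventually_elim
      case (elim n)
      have "exp (- (\<kappa> * ln (ln (\<gamma> ^ n)))) = (real n * ln \<gamma>) powr (- \<kappa>)"
        using elim lg assms by (simp add: powr_def ln_realpow)
      also have "\<dots> = (ln \<gamma>) powr (- \<kappa>) * real n powr (- \<kappa>)" using lg by (simp add: powr_mult)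
      finally show ?case by simp
    qed
  qed
qed

lemma lil_upper:
  assumes j: "1 \<le> j" and e: "0 < e"
  shows "AE \<omega> in M. eventually (\<lambda>t. \<bar>K j t \<omega>\<bar> \<le> (sqrt 2 + e) * norming j t) at_top"
proof -
  \<comment> \<open>The level at the grid point uses d, and the oscillations of the two counts for j
    and j + 1 use 3 * d each.\<close>
  define d where "d = e / 7"
  have d: "0 < d" using e by (simp add: d_def)
  obtain h1 where h1: "0 < h1" "\<And>h. 0 < h \<Longrightarrow> h \<le> h1 \<Longrightarrow> (AE \<omega> in M. eventually (\<lambda>n. \<forall>t. (1 + h) ^ n \<le> t \<longrightarrow> t \<le> (1 + h) ^ Suc n \<longrightarrow>
      \<bar>D j ((1 + h) ^ n) t \<omega>\<bar> \<le> 3 * d * norming j ((1 + h) ^ n)) sequentially)"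
    using oscillation_AE[OF j j d] by blast
  obtain h2 where h2: "0 < h2" "\<And>h. 0 < h \<Longrightarrow> h \<le> h2 \<Longrightarrow> (AE \<omega> in M. eventually (\<lambda>n. \<forall>t. (1 + h) ^ n \<le> t \<longrightarrow> t \<le> (1 + h) ^ Suc n \<longrightarrow>
      \<bar>D (Suc j) ((1 + h) ^ n) t \<omega>\<bar> \<le> 3 * d * norming j ((1 + h) ^ n)) sequentially)"
    using oscillation_AE[OF _ j d, of "Suc j"] by auto
  \<comment> \<open>One ratio has to serve both counts, which is why \<open>oscillation_AE\<close>
    is stated for all small h.\<close>
  define h where "h = min h1 h2"
  have h: "0 < h" "h \<le> h1" "h \<le> h2" using h1 h2 by (auto simp: h_def)
  define \<gamma> where "\<gamma> = 1 + h"
  have g: "1 < \<gamma>" using h by (simp add: \<gamma>_def)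
  have t_top: "filterlim (\<lambda>n. \<gamma> ^ n) at_top sequentially" by (rule filterlim_power_at_top[OF g])
  obtain \<kappa> where \<kappa>: "1 < \<kappa>" "eventually (\<lambda>t. \<P>(\<omega> in M. (sqrt 2 + d) * norming j t \<le> \<bar>K j t \<omega>\<bar>) \<le> 2 * exp (- (\<kappa> * ln (ln t)))) at_top"
    using level_tail[OF j d] by blast
  have L: "AE \<omega> in M. eventually (\<lambda>n. \<not> (sqrt 2 + d) * norming j (\<gamma> ^ n) \<le> \<bar>K j (\<gamma> ^ n) \<omega>\<bar>) sequentially"
    by (rule borel_cantelli_1[OF _ eventually_compose_filterlim[OF \<kappa>(2) t_top] summable_exp_ln_power[OF g \<kappa>(1)]]) measurable
  have evb: "eventually (\<lambda>n. exp 1 \<le> \<gamma> ^ n \<and> 0 < norming j (\<gamma> ^ n)) sequentially"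
    using eventually_compose_filterlim[OF eventually_ge_at_top[of "exp 1"] t_top]
      eventually_compose_filterlim[OF filterlim_at_top_dense[THEN iffD1, OF norming_at_top[OF j], rule_format, of 0] t_top]
    by eventually_elim auto
  show ?thesis
    using L h1(2)[OF h(1,2)] h2(2)[OF h(1,3)] AE_regular unfolding \<gamma>_def[symmetric]
  proof eventually_elim
    case w: (elim \<omega>)
    have "eventually (\<lambda>n. \<forall>t. \<gamma> ^ n \<le> t \<longrightarrow> t \<le> \<gamma> ^ Suc n \<longrightarrow> \<bar>K j t \<omega>\<bar> \<le> (sqrt 2 + e) * norming j t) sequentially"
      using w(1-3) evb
    proof eventually_elim
      case (elim n)
      show ?case
      proof (intro allI impI)
        fix t assume t: "\<gamma> ^ n \<le> t" "t \<le> \<gamma> ^ Suc n"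
        have p: "0 < \<gamma> ^ n" "0 < t" using g t elim by (auto intro: less_le_trans[of _ "\<gamma> ^ n"])
        have KA: "K j u \<omega> = (A j u \<omega> - EA j u) - (A (Suc j) u \<omega> - EA (Suc j) u)" if "0 < u" for u
          unfolding K_def regular_boxes_eq[OF w(4) j] G_eq_EA[OF that j] by simp
        have "K j t \<omega> = K j (\<gamma> ^ n) \<omega> + D j (\<gamma> ^ n) t \<omega> - D (Suc j) (\<gamma> ^ n) t \<omega>"
          using p by (simp add: KA D_def)
        moreover have "\<bar>D j (\<gamma> ^ n) t \<omega>\<bar> \<le> 3 * d * norming j (\<gamma> ^ n)" "\<bar>D (Suc j) (\<gamma> ^ n) t \<omega>\<bar> \<le> 3 * d * norming j (\<gamma> ^ n)"
          using elim(2,3) t by blast+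
        ultimately have "\<bar>K j t \<omega>\<bar> \<le> (sqrt 2 + d) * norming j (\<gamma> ^ n) + 6 * d * norming j (\<gamma> ^ n)"
          using elim(1) by linarith
        also have "\<dots> = (sqrt 2 + e) * norming j (\<gamma> ^ n)" by (simp add: d_def algebra_simps)
        also have "\<dots> \<le> (sqrt 2 + e) * norming j t"
          using e elim(4) t by (intro mult_left_mono norming_mono j) auto
        finally show "\<bar>K j t \<omega>\<bar> \<le> (sqrt 2 + e) * norming j t" .
      qed
    qed
    then obtain n0 where n0: "\<And>n t. n0 \<le> n \<Longrightarrow> \<gamma> ^ n \<le> t \<Longrightarrow> t \<le> \<gamma> ^ Suc n \<Longrightarrow> \<bar>K j t \<omega>\<bar> \<le> (sqrt 2 + e) * norming j t"
      unfolding eventually_sequentially by blast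
    show ?case
    proof (rule eventually_mono[OF eventually_ge_at_top[of "\<gamma> ^ n0"]])
      fix t assume t: "\<gamma> ^ n0 \<le> t"
      obtain m where m: "t < \<gamma> ^ m" using real_arch_pow[OF g] by blast
      define n where "n = (LEAST n. t < \<gamma> ^ Suc n)"
      have ex: "t < \<gamma> ^ Suc m" using m power_strict_increasing[OF lessI g, of m] by (rule less_trans)
      have 1: "t < \<gamma> ^ Suc n" unfolding n_def by (rule LeastI) (rule ex)
      have 2: "n0 \<le> n"
      proof (rule ccontr)
        assume "\<not> n0 \<le> n"
        then have "\<gamma> ^ Suc n \<le> \<gamma> ^ n0" using g by (intro power_increasing) auto
        with 1 t show False by simp
      qed
      have 3: "\<gamma> ^ n \<le> t"
      proof (cases "n = n0")
        case False
        then obtain r where r: "n = Suc r" using 2 by (cases n) auto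
        then have "\<not> t < \<gamma> ^ Suc r" using not_less_Least[of r "\<lambda>n. t < \<gamma> ^ Suc n"] unfolding n_def by simp
        then show ?thesis using r by simp
      qed (use t in simp)
      show "\<bar>K j t \<omega>\<bar> \<le> (sqrt 2 + e) * norming j t" using 1 by (intro n0[OF 2 3]) simp
    qed
  qed
qed

end

section \<open>Lower bound\<close>

lemma Limsup_eqI_real:
  fixes x :: "real \<Rightarrow> real"
  assumes up: "\<And>e. 0 < e \<Longrightarrow> eventually (\<lambda>t. x t \<le> c + e) at_top"
    and lo: "\<And>e. 0 < e \<Longrightarrow> frequently (\<lambda>t. c - e \<le> x t) at_top"
  shows "Limsup at_top (\<lambda>t. ereal (x t)) = ereal c"
proof (rule antisym)
  show "Limsup at_top (\<lambda>t. ereal (x t)) \<le> ereal c"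
  proof (rule ereal_le_epsilon2)
    fix e :: real assume e: "0 < e"
    have "Limsup at_top (\<lambda>t. ereal (x t)) \<le> ereal (c + e)"
      by (rule Limsup_bounded) (use up[OF e] in simp)
    then show "Limsup at_top (\<lambda>t. ereal (x t)) \<le> ereal c + ereal e" by simp
  qed
  show "ereal c \<le> Limsup at_top (\<lambda>t. ereal (x t))"
  proof (rule ccontr)
    assume "\<not> ?thesis"
    then have "Limsup at_top (\<lambda>t. ereal (x t)) < ereal c" by simp
    then obtain y where y: "Limsup at_top (\<lambda>t. ereal (x t)) < ereal y" "ereal y < ereal c"
      using ereal_dense2 by blast
    from Limsup_lessD[OF y(1)] have "eventually (\<lambda>t. x t < y) at_top" by simp
    moreover have "frequently (\<lambda>t. c - (c - y) \<le> x t) at_top" using y(2) by (intro lo) simp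
    ultimately show False by (simp add: frequently_def not_le)
  qed
qed

lemma frequently_filterlim:
  assumes "frequently (\<lambda>n. P (f n)) F" "filterlim f G F"
  shows "frequently P G"
  using assms eventually_compose_filterlim[of "\<lambda>x. \<not> P x" G f F] by (auto simp: frequently_def)

context karlin_lil
begin

text \<open>Boxes whose expected number of balls at time \<open>t\<close> lies in \<open>[1/a, a)\<close>; they carry almost all of the variance.\<close>

definition block :: "real \<Rightarrow> real \<Rightarrow> nat set" where
  "block a t = {k. 0 < pmf p k \<and> t / a < 1 / pmf p k \<and> 1 / pmf p k \<le> t * a}"

lemma finite_block: "finite (block a t)"
  by (rule finite_subset[OF _ finite_boxes[of "t * a"]]) (auto simp: block_def)

text \<open>A heavy box, 1 / p_k \<le> t / a, contributes at most 1, and \<rho> (t / a) counts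
  those. For a light box y = p_k * t satisfies a * y \<le> 1, and the weight is at most y \<le> 3 y
  exp (- a y), a multiple of the weight at 1 with rate a * y; summing gives the term with
  \<open>G 1 (a * t)\<close>.\<close>

lemma outside_block_sum:
  assumes j: "1 \<le> j" and t: "0 < t" and a: "1 \<le> a"
  shows "(\<Sum>k. if k \<in> block a t then 0 else pmf (pois (pmf p k * t)) j) \<le> 3 / a * G 1 (a * t) + \<rho> (1 / a * t)"
proof -
  let ?q = "\<lambda>k. pmf (pois (pmf p k * t)) j"
  let ?L = "{k. 0 < pmf p k \<and> 1 / pmf p k \<le> 1 / a * t}"
  have fin: "finite ?L" by (rule finite_boxes)
  have sG: "(\<lambda>k. 3 / a * pmf (pois (pmf p k * (a * t))) 1) sums (3 / a * G 1 (a * t))"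
    using t a by (intro sums_mult sums_G) auto
  have "(\<lambda>k. of_bool (k \<in> ?L) :: real) sums (\<Sum>k\<in>?L. of_bool (k \<in> ?L))"
    by (rule sums_finite[OF fin]) auto
  also have "(\<Sum>k\<in>?L. of_bool (k \<in> ?L)) = \<rho> (1 / a * t)" by (simp add: \<rho>_def rho_def)
  finally have sL: "(\<lambda>k. of_bool (k \<in> ?L) :: real) sums \<rho> (1 / a * t)" .
  have le: "(if k \<in> block a t then 0 else ?q k) \<le> 3 / a * pmf (pois (pmf p k * (a * t))) 1 + of_bool (k \<in> ?L)" for k
  proof (cases "k \<in> block a t \<or> k \<in> ?L")
    case True
    then show ?thesis using a pmf_le_1[of "pois (pmf p k * t)" j]
      by (auto intro!: add_nonneg_nonneg add_increasing)
  next
    case False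
    define y where "y = pmf p k * t"
    have y0: "0 \<le> y" using t by (simp add: y_def)
    have y1: "a * y \<le> 1"
    proof (cases "0 < pmf p k")
      case True
      with False have "t * a < 1 / pmf p k" by (auto simp: block_def not_le not_less)
      then show ?thesis using True by (simp add: y_def field_simps)
    next
      case False
      then have "pmf p k = 0" using pmf_nonneg[of p k] by linarith
      then show ?thesis by (simp add: y_def)
    qed
    have yle: "y \<le> 1" using y1 a y0 mult_right_mono[of 1 a y] by linarith
    have "?q k = y ^ j / fact j * exp (- y)" using y0 by (simp add: pmf_pois y_def)
    also have "\<dots> \<le> y / 1 * 1"
    proof (intro mult_mono divide_mono)
      show "y ^ j \<le> y" using power_decreasing[OF j y0 yle] by simp
    qed (use y0 in auto)
    also have "\<dots> = y" by simp
    also have "y \<le> 3 * y * exp (- (a * y))"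
    proof -
      have "exp (-1) \<le> exp (- (a * y))" using y1 by simp
      moreover have "1 \<le> 3 * exp (-1 :: real)" using exp_le by (simp add: exp_minus field_simps)
      ultimately have "1 \<le> 3 * exp (- (a * y))" by linarith
      from mult_left_mono[OF this y0] show ?thesis by (simp add: mult_ac)
    qed
    also have "\<dots> = 3 / a * pmf (pois (pmf p k * (a * t))) 1"
      using y0 a by (simp add: pmf_pois y_def mult_ac)
    finally show ?thesis using False by simp
  qed
  have sq: "summable (\<lambda>k. if k \<in> block a t then 0 else ?q k)"
    by (rule summable_comparison_test'[of ?q 0]) (use sums_G(1)[OF j t] in \<open>auto simp: sums_iff\<close>)
  from suminf_le[OF le sq sums_summable[OF sums_add[OF sG sL]]]
  show ?thesis using sums_unique[OF sums_add[OF sG sL]] by simp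
qed

text \<open>After division by \<rho> the bound tends to a multiple of a^(\<alpha> - 1) plus a^(-
  \<alpha>). Light boxes are negligible because \<alpha> < 1, heavy ones because \<alpha> >
  0.\<close>

lemma outside_block_small:
  assumes j: "1 \<le> j" and d: "0 < d"
  shows "\<exists>a>1. eventually (\<lambda>t. (\<Sum>k. if k \<in> block a t then 0 else pmf (pois (pmf p k * t)) j) \<le> d * \<rho> t) at_top"
proof -
  define g where "g = \<alpha> * Gamma (1 - \<alpha>)"
  have lim: "((\<lambda>t. 3 / a * (G 1 (a * t) / \<rho> (a * t)) * (\<rho> (a * t) / \<rho> t) + \<rho> (1 / a * t) / \<rho> t)
      \<longlongrightarrow> 3 / a * g * a powr \<alpha> + (1 / a) powr \<alpha>) at_top" if a: "1 < a" for a
  proof -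
    have "filterlim (\<lambda>t. a * t) at_top at_top"
      using a by (intro filterlim_tendsto_pos_mult_at_top[OF tendsto_const] filterlim_ident) auto
    from filterlim_compose[OF G_asymptotics[of 1] this]
    have "((\<lambda>t. G 1 (a * t) / \<rho> (a * t)) \<longlongrightarrow> g) at_top" by (simp add: g_def)
    then show ?thesis using a by (intro tendsto_add tendsto_mult tendsto_const rho_ratio) auto
  qed
  have "((\<lambda>a. 3 / a * g * a powr \<alpha> + (1 / a) powr \<alpha>) \<longlongrightarrow> 0) at_top"
  proof -
    have "((\<lambda>a. 3 * g * a powr (\<alpha> - 1) + a powr (- \<alpha>)) \<longlongrightarrow> 3 * g * 0 + 0) at_top"
      using \<alpha> by (intro tendsto_add tendsto_mult tendsto_const tendsto_neg_powr filterlim_ident) auto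
    then have "((\<lambda>a. 3 * g * a powr (\<alpha> - 1) + a powr (- \<alpha>)) \<longlongrightarrow> 0) at_top" by simp
    then show ?thesis
    proof (rule Lim_transform_eventually)
      show "eventually (\<lambda>a. 3 * g * a powr (\<alpha> - 1) + a powr (- \<alpha>) = 3 / a * g * a powr \<alpha> + (1 / a) powr \<alpha>) at_top"
        using eventually_gt_at_top[of 0]
        by eventually_elim (simp add: powr_diff powr_minus powr_divide field_simps)
    qed
  qed
  then have "eventually (\<lambda>a. 3 / a * g * a powr \<alpha> + (1 / a) powr \<alpha> < d) at_top" by (rule order_tendstoD) (rule d)
  with eventually_gt_at_top[of 1] have "eventually (\<lambda>a. 1 < a \<and> 3 / a * g * a powr \<alpha> + (1 / a) powr \<alpha> < d) at_top"
    by eventually_elim simp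
  then obtain a where a: "1 < a" "3 / a * g * a powr \<alpha> + (1 / a) powr \<alpha> < d"
    by (auto dest: eventually_happens)
  have ra: "eventually (\<lambda>t. 0 < \<rho> (a * t)) at_top"
    by (rule eventually_compose_filterlim[OF rho_pos])
       (use a in \<open>intro filterlim_tendsto_pos_mult_at_top[OF tendsto_const] filterlim_ident; auto\<close>)
  have "eventually (\<lambda>t. 3 / a * (G 1 (a * t) / \<rho> (a * t)) * (\<rho> (a * t) / \<rho> t) + \<rho> (1 / a * t) / \<rho> t < d) at_top"
    by (rule order_tendstoD(2)[OF lim[OF a(1)] a(2)])
  then have "eventually (\<lambda>t. (\<Sum>k. if k \<in> block a t then 0 else pmf (pois (pmf p k * t)) j) \<le> d * \<rho> t) at_top"
    using rho_pos ra eventually_gt_at_top[of 0]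
  proof eventually_elim
    case (elim t)
    have "3 / a * (G 1 (a * t) / \<rho> (a * t)) * (\<rho> (a * t) / \<rho> t) + \<rho> (1 / a * t) / \<rho> t
        = (3 / a * G 1 (a * t) + \<rho> (1 / a * t)) / \<rho> t" using elim by (simp add: field_simps)
    then have "3 / a * G 1 (a * t) + \<rho> (1 / a * t) < d * \<rho> t" using elim by (simp add: pos_divide_less_eq)
    moreover have "1 \<le> a" using a by simp
    ultimately show ?case using outside_block_sum[OF j elim(4), of a] by linarith
  qed
  then show ?thesis using a by blast
qed

section \<open>Main part and remainder of the centred count\<close>

definition block_sum :: "nat \<Rightarrow> real \<Rightarrow> real \<Rightarrow> 'a \<Rightarrow> real" where
  "block_sum j a t \<omega> = (\<Sum>k\<in>block a t. of_bool (\<pi> k t \<omega> = j) - pmf (pois (pmf p k * t)) j)"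

definition block_var :: "nat \<Rightarrow> real \<Rightarrow> real \<Rightarrow> real" where
  "block_var j a t = (\<Sum>k\<in>block a t. pmf (pois (pmf p k * t)) j * (1 - pmf (pois (pmf p k * t)) j))"

lemma block_sum_measurable [measurable]: "block_sum j a t \<in> borel_measurable M"
  unfolding block_sum_def by measurable

lemma block_var_nonneg: "0 \<le> block_var j a t"
  unfolding block_var_def by (intro sum_nonneg mult_nonneg_nonneg) (auto simp: pmf_le_1)

lemma block_sum_lower_tail:
  assumes j: "1 \<le> j" and t: "0 < t" and b: "\<bar>b\<bar> = 1"
    and d: "0 < d" "d \<le> 1" and l: "0 < l" "60 * l \<le> d\<^sup>2"
    and large: "ln 4 \<le> l\<^sup>2 * block_var j a t * d\<^sup>2 / 4"
  shows "exp (- (l\<^sup>2 / 2 * block_var j a t * (1 + 3 * d))) / 2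
    \<le> \<P>(\<omega> in M. (1 - d) * l * block_var j a t \<le> b * block_sum j a t \<omega>)"
proof -
  interpret O: indep_occupancy M "\<lambda>k \<omega>. \<pi> k t \<omega> = j" by (rule occupancy[OF t j])
  have q: "O.q k = pmf (pois (pmf p k * t)) j" for k by (simp add: O.q_def prob_balls_eq t)
  have Y: "block_sum j a t \<omega> = O.Y (block a t) \<omega>" for \<omega> by (simp add: block_sum_def O.Y_def q)
  have v: "block_var j a t = (\<Sum>k\<in>block a t. O.q k * (1 - O.q k))" by (simp add: block_var_def q)
  \<comment> \<open>The sign b is moved into the tilting parameter, whose square and absolute value
    it does not change.\<close>
  have lb: "(x * b)\<^sup>2 = x\<^sup>2" "\<bar>x * b\<bar> = \<bar>x\<bar>" for x
    using b by (auto simp: power_mult_distrib abs_mult) (metis power2_abs power_one)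
  show ?thesis
  proof (rule kolmogorov_lower_tail[OF _ _ _ _ block_var_nonneg d l large])
    fix x :: real assume x: "\<bar>x\<bar> \<le> 1"
    have xb: "\<bar>x * b\<bar> \<le> 1" using x by (simp add: lb)
    have eq: "exp (x * (b * block_sum j a t \<omega>)) = exp ((x * b) * O.Y (block a t) \<omega>)" for \<omega> by (simp add: Y mult.assoc)
    show "integrable M (\<lambda>\<omega>. exp (x * (b * block_sum j a t \<omega>)))"
      unfolding eq by (rule O.mgf_integrable[OF finite_block xb])
    show "exp (x\<^sup>2 / 2 * (1 - 3 * \<bar>x\<bar>) * block_var j a t) \<le> expectation (\<lambda>\<omega>. exp (x * (b * block_sum j a t \<omega>)))"
      using O.mgf_lower[OF finite_block xb] unfolding eq v lb by simp
    show "expectation (\<lambda>\<omega>. exp (x * (b * block_sum j a t \<omega>))) \<le> exp (x\<^sup>2 / 2 * (1 + 3 * \<bar>x\<bar>) * block_var j a t)"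
      using O.mgf_upper[OF finite_block xb] unfolding eq v lb by simp
  qed measurable
qed

text \<open>The remainder is itself a count of independent indicators, so Chernoff's bound applies
  to it, and the variance splits along with the count.\<close>

lemma block_remainder:
  fixes a t :: real
  assumes j: "1 \<le> j" and t: "0 < t"
  defines "E \<equiv> \<lambda>k \<omega>. k \<notin> block a t \<and> \<pi> k t \<omega> = j"
  shows "indep_occupancy M E"
    and "regular \<omega> \<Longrightarrow> K j t \<omega> = block_sum j a t \<omega> + (indep_occupancy.T E \<omega> - indep_occupancy.m M E)"
    and "V j t = block_var j a t + indep_occupancy.v M E"
    and "indep_occupancy.m M E = (\<Sum>k. if k \<in> block a t then 0 else pmf (pois (pmf p k * t)) j)"
proof -
  interpret O: indep_occupancy M "\<lambda>k \<omega>. \<pi> k t \<omega> = j" by (rule occupancy[OF t j])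
  let ?q = "\<lambda>k. pmf (pois (pmf p k * t)) j"
  have pr: "\<P>(\<omega> in M. E k \<omega>) = (if k \<in> block a t then 0 else ?q k)" for k
    using t by (simp add: E_def prob_balls_eq)
  have sq: "?q sums G j t" by (rule sums_G(1)[OF j t])
  have sV: "summable (\<lambda>k. ?q k * (1 - ?q k))"
    using O.summable_qq by (simp add: O.q_def prob_balls_eq t)
  show occ: "indep_occupancy M E"
  proof unfold_locales
    from indep_vars_compose2[OF O.indep, of "\<lambda>k x. k \<notin> block a t \<and> x" "\<lambda>_. count_space UNIV"]
    show "indep_vars (\<lambda>_. count_space UNIV) E UNIV" by (simp add: E_def)
    show "summable (\<lambda>k. \<P>(\<omega> in M. E k \<omega>))"
      unfolding pr by (rule summable_comparison_test'[of ?q 0]) (use sq in \<open>auto simp: sums_iff\<close>)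
  qed
  interpret R: indep_occupancy M E by (rule occ)
  have split: "suminf f = (\<Sum>k\<in>block a t. f k) + (\<Sum>k. if k \<in> block a t then 0 else f k)" if f: "summable f" for f :: "nat \<Rightarrow> real"
  proof -
    have "(\<lambda>k. if k \<in> block a t then f k else 0) sums (\<Sum>k\<in>block a t. if k \<in> block a t then f k else 0)"
      by (rule sums_finite[OF finite_block]) auto
    then have 1: "(\<lambda>k. if k \<in> block a t then f k else 0) sums (\<Sum>k\<in>block a t. f k)" by simp
    have "(\<lambda>k. f k - (if k \<in> block a t then f k else 0)) sums (suminf f - (\<Sum>k\<in>block a t. f k))"
      by (intro sums_diff summable_sums f 1)
    moreover have "f k - (if k \<in> block a t then f k else 0) = (if k \<in> block a t then 0 else f k)" for k by simp
    ultimately show ?thesis by (simp add: sums_iff)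
  qed
  show m: "R.m = (\<Sum>k. if k \<in> block a t then 0 else ?q k)" by (simp add: R.m_def R.q_def pr)
  have Rv: "R.v = (\<Sum>k. if k \<in> block a t then 0 else ?q k * (1 - ?q k))"
    unfolding R.v_def R.q_def pr by (intro suminf_cong) simp
  show "V j t = block_var j a t + R.v"
    unfolding V_def Rv block_var_def by (rule split[OF sV])
  show "K j t \<omega> = block_sum j a t \<omega> + (R.T \<omega> - R.m)" if w: "regular \<omega>"
  proof -
    have fin: "finite {k. \<pi> k t \<omega> = j}"
      by (rule finite_subset[OF _ regular_finite_A[OF w j, of t]]) auto
    have "{k. \<pi> k t \<omega> = j} = {k\<in>block a t. \<pi> k t \<omega> = j} \<union> {k. E k \<omega>}" by (auto simp: E_def)
    moreover have "card ({k\<in>block a t. \<pi> k t \<omega> = j} \<union> {k. E k \<omega>}) = card {k\<in>block a t. \<pi> k t \<omega> = j} + card {k. E k \<omega>}"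
      by (rule card_Un_disjoint) (use fin finite_block in \<open>auto simp: E_def intro: finite_subset[OF _ fin]\<close>)
    ultimately have "boxes_with S X j t \<omega> = real (card {k\<in>block a t. \<pi> k t \<omega> = j}) + R.T \<omega>"
      by (simp add: boxes_with_def R.T_def)
    moreover have "real (card {k\<in>block a t. \<pi> k t \<omega> = j}) = (\<Sum>k\<in>block a t. of_bool (\<pi> k t \<omega> = j))"
      using finite_block[of a t] by (simp add: Int_def)
    moreover have "G j t = (\<Sum>k\<in>block a t. ?q k) + R.m"
      using split[OF sums_summable[OF sq]] unfolding G_def m .
    ultimately show ?thesis by (simp add: K_def block_sum_def sum_subtractf)
  qed
qed

text \<open>The intervals (t / a, t * a] do not overlap for times with ratio a^2, so each box
  belongs to at most one block and is observed at one time only. One independent family over the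
  boxes then suffices, regrouped by blocks.\<close>

lemma indep_block_sums:
  fixes a :: real
  assumes a: "1 < a" and j: "1 \<le> j"
  shows "indep_vars (\<lambda>_. count_space UNIV) (\<lambda>n \<omega>. 1 \<le> n \<and> x n \<le> b * block_sum j a ((a\<^sup>2) ^ n) \<omega>) (UNIV :: nat set)"
proof -
  \<comment> \<open>\<open>u 0\<close> must be 0 although the zeroth geometric time is 1; the guard
    1 \<le> n excludes that index.\<close>
  define u where "u n = (if n = 0 then 0 else (a\<^sup>2) ^ n)" for n :: nat
  have a2: "1 < a\<^sup>2" using a by (simp add: one_less_power)
  have "u n < u (Suc n)" for n using a2 a power_strict_increasing[of n "Suc n" "a\<^sup>2"] by (auto simp: u_def)
  then have u: "strict_mono u" "u 0 = 0" by (auto simp: u_def strict_mono_Suc_iff)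
  define B where "B n = (if n = 0 then {} else block a ((a\<^sup>2) ^ n))" for n :: nat
  have finB: "finite (B n)" for n by (simp add: B_def finite_block)
  have disj: "disjoint_family_on B UNIV"
  proof -
    have "B m \<inter> B n = {}" if mn: "m < n" for m n
    proof -
      have "(a\<^sup>2) ^ m * a \<le> (a\<^sup>2) ^ n / a"
      proof -
        have "(a\<^sup>2) ^ m * a * a = (a\<^sup>2) ^ Suc m" by (simp add: power2_eq_square)
        also have "\<dots> \<le> (a\<^sup>2) ^ n" using mn a2 by (intro power_increasing) auto
        finally show ?thesis using a by (simp add: field_simps)
      qed
      then show ?thesis by (auto simp: B_def block_def)
    qed
    then show ?thesis unfolding disjoint_family_on_def by (metis Int_commute linorder_neqE_nat)
  qed
  \<comment> \<open>For boxes in no block \<open>N k\<close> is unspecified, which is harmless as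
    they occur in no \<open>B n\<close>.\<close>
  define N where "N k = (THE n. k \<in> B n)" for k
  have N: "N k = n" if "k \<in> B n" for k n
    unfolding N_def using that disj by (intro the_equality) (auto simp: disjoint_family_on_def)
  have F: "indep_vars (\<lambda>_. count_space UNIV) (\<lambda>k \<omega>. \<pi> k (u (N k)) \<omega> = j) UNIV"
    by (rule indep_occupancy_events[OF u])
  have R: "indep_vars (\<lambda>n. PiM (B n) (\<lambda>_. count_space UNIV :: bool measure)) (\<lambda>n \<omega>. \<lambda>k\<in>B n. \<pi> k (u (N k)) \<omega> = j) UNIV"
    by (rule indep_vars_restrict[OF F _ disj]) auto
  define f where "f n y \<longleftrightarrow> 1 \<le> n \<and> x n \<le> b * (\<Sum>k\<in>B n. of_bool (y k) - pmf (pois (pmf p k * u n)) j)" for n and y :: "nat \<Rightarrow> bool"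
  have fm: "f n \<in> PiM (B n) (\<lambda>_. count_space UNIV :: bool measure) \<rightarrow>\<^sub>M count_space UNIV" for n
  proof -
    have "PiM (B n) (\<lambda>_. count_space UNIV :: bool measure) = count_space (PiE (B n) (\<lambda>_. UNIV))"
      by (rule count_space_PiM_finite[OF finB]) auto
    then show ?thesis by (simp add: measurable_count_space_eq1)
  qed
  have "f n (\<lambda>k\<in>B n. \<pi> k (u (N k)) \<omega> = j) \<longleftrightarrow> 1 \<le> n \<and> x n \<le> b * block_sum j a ((a\<^sup>2) ^ n) \<omega>" for n \<omega>
  proof (cases "n = 0")
    case False
    then have un: "u n = (a\<^sup>2) ^ n" and Bn: "B n = block a ((a\<^sup>2) ^ n)" by (auto simp: u_def B_def)
    have "(\<Sum>k\<in>B n. of_bool ((\<lambda>k\<in>B n. \<pi> k (u (N k)) \<omega> = j) k) - pmf (pois (pmf p k * u n)) j)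
        = (\<Sum>k\<in>B n. of_bool (\<pi> k (u n) \<omega> = j) - pmf (pois (pmf p k * u n)) j)"
      by (intro sum.cong) (simp_all add: N)
    also have "\<dots> = block_sum j a ((a\<^sup>2) ^ n) \<omega>" unfolding un Bn block_sum_def ..
    finally have "(\<Sum>k\<in>B n. of_bool ((\<lambda>k\<in>B n. \<pi> k (u (N k)) \<omega> = j) k) - pmf (pois (pmf p k * u n)) j)
        = block_sum j a ((a\<^sup>2) ^ n) \<omega>" .
    then show ?thesis by (simp add: f_def)
  qed (simp add: f_def)
  with indep_vars_compose2[OF R fm] show ?thesis by simp
qed

text \<open>Collects the three losses of the lower bound: 1 - d from the tilted threshold, sqrt (1 -
  d) from the variance outside the block, and 1 / sqrt (1 + 3 * d) from the exponent of
  \<open>kolmogorov_lower_tail\<close>.\<close>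

lemma block_parameter:
  assumes "0 < (e :: real)"
  shows "\<exists>d. 0 < d \<and> d < 1 \<and> sqrt 2 - e \<le> sqrt 2 * ((1 - d) * sqrt ((1 - d) / (1 + 3 * d)))"
proof -
  have "((\<lambda>d::real. sqrt 2 * ((1 - d) * sqrt ((1 - d) / (1 + 3 * d)))) \<longlongrightarrow> sqrt 2 * ((1 - 0) * sqrt ((1 - 0) / (1 + 3 * 0)))) (at_right 0)"
    by (intro tendsto_intros) auto
  then have "eventually (\<lambda>d::real. sqrt 2 - e < sqrt 2 * ((1 - d) * sqrt ((1 - d) / (1 + 3 * d)))) (at_right 0)"
    by (rule order_tendstoD) (use assms in simp)
  moreover have "eventually (\<lambda>d::real. 0 < d \<and> d < 1) (at_right 0)"
    using eventually_at_right_real[of 0 1] by (simp add: eventually_mono)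
  ultimately have "eventually (\<lambda>d::real. (0 < d \<and> d < 1) \<and> sqrt 2 - e < sqrt 2 * ((1 - d) * sqrt ((1 - d) / (1 + 3 * d)))) (at_right 0)"
    by (auto elim: eventually_elim2)
  from eventually_happens[OF this] show ?thesis by (auto intro: less_imp_le)
qed

text \<open>A small mean outside the block bounds the variance there and, by subtraction from V,
  keeps the block variance large.\<close>

lemma block_var_bounds:
  assumes j: "1 \<le> j" and d: "0 < d" "d < var_const j \<alpha>"
  shows "\<exists>a>1. eventually (\<lambda>t. (var_const j \<alpha> - 2 * d) * \<rho> t \<le> block_var j a t
    \<and> indep_occupancy.v M (\<lambda>k \<omega>. k \<notin> block a t \<and> \<pi> k t \<omega> = j) \<le> d * \<rho> t) at_top"
proof -
  obtain a where a: "1 < a" and ev: "eventually (\<lambda>t. (\<Sum>k. if k \<in> block a t then 0 else pmf (pois (pmf p k * t)) j) \<le> d * \<rho> t) at_top"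
    using outside_block_small[OF j d(1)] by blast
  have "eventually (\<lambda>t. var_const j \<alpha> - d < V j t / \<rho> t) at_top"
    by (rule order_tendstoD[OF V_asymptotics[OF j]]) (use d in simp)
  then have "eventually (\<lambda>t. (var_const j \<alpha> - 2 * d) * \<rho> t \<le> block_var j a t
    \<and> indep_occupancy.v M (\<lambda>k \<omega>. k \<notin> block a t \<and> \<pi> k t \<omega> = j) \<le> d * \<rho> t) at_top"
    using ev rho_pos eventually_gt_at_top[of 0]
  proof eventually_elim
    case (elim t)
    interpret R: indep_occupancy M "\<lambda>k \<omega>. k \<notin> block a t \<and> \<pi> k t \<omega> = j" by (rule block_remainder(1)[OF j elim(4)])
    have v: "R.v \<le> d * \<rho> t" using R.v_le_m block_remainder(4)[OF j elim(4), of a] elim(2) by linarith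
    have "(var_const j \<alpha> - d) * \<rho> t \<le> V j t" using elim(1,3) by (simp add: field_simps)
    then show ?case using v block_remainder(3)[OF j elim(4), of a] by (simp add: algebra_simps)
  qed
  then show ?thesis using a by blast
qed

text \<open>The sign b treats both directions at once. Half of e is spent on the block sums, the
  other half on the remainder.\<close>

lemma lil_lower:
  assumes j: "1 \<le> j" and e: "0 < e" and b: "\<bar>b\<bar> = 1"
  shows "AE \<omega> in M. frequently (\<lambda>t. (sqrt 2 - e) * norming j t \<le> b * K j t \<omega>) at_top"
proof -
  define c where "c = var_const j \<alpha>"
  have c: "0 < c" unfolding c_def by (rule var_const_pos[OF j])
  obtain d where d: "0 < d" "d < 1" and dd: "sqrt 2 - e / 2 \<le> sqrt 2 * ((1 - d) * sqrt ((1 - d) / (1 + 3 * d)))"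
    using block_parameter[of "e / 2"] e by auto
  \<comment> \<open>The first entry gives c - 2 * \<delta> \<ge> c * (1 - d) for the block variance;
    the second makes the tail exponent of the remainder at least 2 * ln (ln s), hence summable along
    t n.\<close>
  define \<delta> where "\<delta> = min (c * d / 2) ((e / 2)\<^sup>2 * c / 16)"
  have \<delta>: "0 < \<delta>" "2 * \<delta> \<le> c * d" "16 * \<delta> \<le> (e / 2)\<^sup>2 * c"
    using c d e by (auto simp: \<delta>_def)
  have "\<delta> < c" using \<delta> c d mult_strict_left_mono[of d 1 c] by linarith
  then obtain a where a: "1 < a" and ev: "eventually (\<lambda>t. (c - 2 * \<delta>) * \<rho> t \<le> block_var j a t
    \<and> indep_occupancy.v M (\<lambda>k \<omega>. k \<notin> block a t \<and> \<pi> k t \<omega> = j) \<le> \<delta> * \<rho> t) at_top"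
    using block_var_bounds[OF j \<delta>(1)] unfolding c_def by blast
  define \<gamma> where "\<gamma> = a\<^sup>2"
  have g: "1 < \<gamma>" using a by (simp add: \<gamma>_def one_less_power)
  have lg: "0 < ln \<gamma>" using g by simp
  define t where "t n = \<gamma> ^ n" for n :: nat
  have t_pos: "0 < t n" for n using g by (simp add: t_def)
  have t_top: "filterlim t at_top sequentially" unfolding t_def[abs_def] by (rule filterlim_power_at_top[OF g])
  define x where "x n = (sqrt 2 - e / 2) * norming j (t n)" for n
  have cd: "0 < c * (1 - d)" using c d by simp
  \<comment> \<open>Calibrated so that with l = \<theta> * sqrt (2 * L / v) the exponent of the
    lower tail is exactly L = ln (ln s): the probabilities then compare with the harmonic
    series.\<close>
  define \<theta> where "\<theta> = 1 / sqrt (1 + 3 * d)"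
  have \<theta>: "0 < \<theta>" "\<theta>\<^sup>2 * (1 + 3 * d) = 1" "\<theta> \<le> 1" using d by (auto simp: \<theta>_def power_divide)
  have main: "eventually (\<lambda>s. exp (- ln (ln s)) / 2 \<le> \<P>(\<omega> in M. (sqrt 2 - e / 2) * norming j s \<le> b * block_sum j a s \<omega>)) at_top"
  proof -
    \<comment> \<open>Since l \<le> 2 * norming / (c * (1 - d) * \<rho>), this is 60 * l \<le> d^2
      expressed by the norming.\<close>
    have "eventually (\<lambda>s. norming j s / \<rho> s < d\<^sup>2 * (c * (1 - d)) / 120) at_top"
      by (rule order_tendstoD[OF norming_over_rho[OF j]]) (use d cd in auto)
    moreover have "eventually (\<lambda>s::real. ln 4 \<le> \<theta>\<^sup>2 * d\<^sup>2 / 2 * ln (ln s)) at_top"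
      using \<theta>(1) d by real_asymp
    ultimately show ?thesis
      using ev eventually_lnln rho_pos eventually_gt_at_top[of 0]
    proof eventually_elim
      case (elim s)
      define L where "L = ln (ln s)"
      define v where "v = block_var j a s"
      have L: "0 < L" using elim by (simp add: L_def)
      have vlo: "c * (1 - d) * \<rho> s \<le> v"
      proof -
        have "c * (1 - d) * \<rho> s \<le> (c - 2 * \<delta>) * \<rho> s" using \<delta> elim by (intro mult_right_mono) (auto simp: algebra_simps)
        then show ?thesis using elim unfolding v_def by linarith
      qed
      have rho_s: "0 < c * (1 - d) * \<rho> s" using cd elim by simp
      then have v: "0 < v" using vlo by linarith
      define l where "l = \<theta> * sqrt (2 * L / v)"
      have l0: "0 < l" using \<theta> L v by (simp add: l_def)
      have l2v: "l\<^sup>2 * v = \<theta>\<^sup>2 * (2 * L)"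
        using L v by (simp add: l_def power_mult_distrib)
      have nsq: "norming j s = sqrt (c * \<rho> s * L)" by (simp add: norming_def c_def L_def)
      have l_small: "60 * l \<le> d\<^sup>2"
      proof -
        have "l \<le> 1 * sqrt (2 * L / v)" unfolding l_def using \<theta> L v by (intro mult_right_mono) auto
        also have "\<dots> \<le> sqrt ((2 * norming j s / (c * (1 - d) * \<rho> s))\<^sup>2)"
        proof -
          have "2 * L / v \<le> 2 * L / (c * (1 - d) * \<rho> s)"
            using L vlo by (intro divide_left_mono mult_pos_pos[OF v rho_s]) auto
          also have "\<dots> \<le> (2 * norming j s / (c * (1 - d) * \<rho> s))\<^sup>2"
          proof -
            have n2: "(norming j s)\<^sup>2 = c * \<rho> s * L" unfolding nsq using c elim L by simp
            have "(2 * norming j s / (c * (1 - d) * \<rho> s))\<^sup>2 = 2 * L / (c * (1 - d) * \<rho> s) * (2 / (1 - d))"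
            proof -
              have gen: "(2 * m / (c * D * r))\<^sup>2 = 2 * L / (c * D * r) * (2 / D)"
                if "m\<^sup>2 = c * r * L" "c \<noteq> 0" "D \<noteq> 0" "r \<noteq> 0" for m c D r :: real
                using that by (simp add: power_divide power_mult_distrib power2_eq_square)
              show ?thesis by (rule gen[OF n2]) (use c d elim(5) in auto)
            qed
            moreover have "1 \<le> 2 / (1 - d)" using d by simp
            moreover have "0 \<le> 2 * L / (c * (1 - d) * \<rho> s)" using L rho_s by simp
            ultimately show ?thesis using mult_left_mono[of 1 "2 / (1 - d)" "2 * L / (c * (1 - d) * \<rho> s)"] by simp
          qed
          finally show ?thesis using real_sqrt_le_mono by (simp only: mult_1_left)
        qed
        also have "\<dots> = 2 * norming j s / (c * (1 - d) * \<rho> s)"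
          using rho_s elim c L by (simp add: nsq)
        also have "\<dots> = 2 / (c * (1 - d)) * (norming j s / \<rho> s)" by simp
        also have "\<dots> \<le> 2 / (c * (1 - d)) * (d\<^sup>2 * (c * (1 - d)) / 120)"
          using elim(1) cd by (intro mult_left_mono) auto
        also have "\<dots> = d\<^sup>2 / 60"
        proof -
          have "2 / y * (z * y / 120) = z / 60" if "0 < y" for y z :: real using that by simp
          from this[OF cd] show ?thesis .
        qed
        finally show ?thesis by simp
      qed
      have large: "ln 4 \<le> l\<^sup>2 * v * d\<^sup>2 / 4" unfolding l2v using elim(2) by (simp add: L_def mult_ac)
      have expo: "l\<^sup>2 / 2 * v * (1 + 3 * d) = L"
      proof -
        have "l\<^sup>2 / 2 * v * (1 + 3 * d) = (l\<^sup>2 * v) * (1 + 3 * d) / 2" by simp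
        also have "\<dots> = \<theta>\<^sup>2 * (1 + 3 * d) * L" unfolding l2v by simp
        finally show ?thesis by (simp add: \<theta>)
      qed
      have thr: "(sqrt 2 - e / 2) * norming j s \<le> (1 - d) * l * v"
      proof -
        have lv: "l * v = \<theta> * sqrt (2 * L * v)"
        proof -
          have "sqrt (2 * L / v) * v = sqrt (2 * L / v) * sqrt (v\<^sup>2)" using v by simp
          also have "\<dots> = sqrt (2 * L * v)" unfolding real_sqrt_mult[symmetric] using v by (simp add: power2_eq_square)
          finally show ?thesis by (simp add: l_def mult.assoc)
        qed
        have "(sqrt 2 - e / 2) * norming j s \<le> sqrt 2 * ((1 - d) * sqrt ((1 - d) / (1 + 3 * d))) * norming j s"
          using dd nsq elim c L by (intro mult_right_mono) auto
        also have "\<dots> = (1 - d) * (\<theta> * sqrt (2 * L * (c * (1 - d) * \<rho> s)))"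
          by (simp add: nsq \<theta>_def real_sqrt_mult real_sqrt_divide mult_ac)
        also have "\<dots> \<le> (1 - d) * (\<theta> * sqrt (2 * L * v))"
          using vlo d \<theta> L by (intro mult_left_mono real_sqrt_le_mono) auto
        also have "\<dots> = (1 - d) * l * v" by (simp add: lv mult.assoc)
        finally show ?thesis .
      qed
      have "exp (- L) / 2 \<le> \<P>(\<omega> in M. (1 - d) * l * v \<le> b * block_sum j a s \<omega>)"
        using block_sum_lower_tail[OF j elim(6) b d(1) less_imp_le[OF d(2)] l0 l_small large[unfolded v_def]] expo
        unfolding v_def[symmetric] by simp
      also have "\<dots> \<le> \<P>(\<omega> in M. (sqrt 2 - e / 2) * norming j s \<le> b * block_sum j a s \<omega>)"
        using thr by (intro finite_measure_mono) auto
      finally show ?case by (simp add: L_def)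
    qed
  qed
  have freq: "AE \<omega> in M. frequently (\<lambda>n. 1 \<le> n \<and> x n \<le> b * block_sum j a (t n) \<omega>) sequentially"
  proof (rule borel_cantelli_2)
    show "indep_vars (\<lambda>_. count_space UNIV) (\<lambda>n \<omega>. 1 \<le> n \<and> x n \<le> b * block_sum j a (t n) \<omega>) UNIV"
      unfolding t_def \<gamma>_def by (rule indep_block_sums[OF a j])
    show "\<not> summable (\<lambda>n. \<P>(\<omega> in M. 1 \<le> n \<and> x n \<le> b * block_sum j a (t n) \<omega>))"
    proof
      assume s: "summable (\<lambda>n. \<P>(\<omega> in M. 1 \<le> n \<and> x n \<le> b * block_sum j a (t n) \<omega>))"
      have "summable (\<lambda>n. 1 / (2 * ln \<gamma>) * inverse (real n))"
      proof (rule summable_comparison_test_ev[OF _ s])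
        show "eventually (\<lambda>n. norm (1 / (2 * ln \<gamma>) * inverse (real n)) \<le> \<P>(\<omega> in M. 1 \<le> n \<and> x n \<le> b * block_sum j a (t n) \<omega>)) sequentially"
          using eventually_compose_filterlim[OF main t_top] eventually_ge_at_top[of 1]
        proof eventually_elim
          case (elim n)
          have "ln (t n) = real n * ln \<gamma>" using g by (simp add: t_def ln_realpow)
          then have "exp (- ln (ln (t n))) = 1 / (real n * ln \<gamma>)" using lg elim(2) by (simp add: exp_minus inverse_eq_divide)
          then have "norm (1 / (2 * ln \<gamma>) * inverse (real n)) = exp (- ln (ln (t n))) / 2"
            using lg by (simp add: field_simps)
          then show ?case using elim by (simp add: x_def)
        qed
      qed
      then have "summable (\<lambda>n. inverse (real n))" using lg by (subst (asm) summable_cmult_iff) auto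
      then show False using not_summable_harmonic[where 'a=real] by simp
    qed
  qed
  have rem_tail: "eventually (\<lambda>s. \<P>(\<omega> in M. e / 2 * norming j s \<le> \<bar>K j s \<omega> - block_sum j a s \<omega>\<bar>) \<le> 2 * exp (- (2 * ln (ln s)))) at_top"
  proof -
    have "eventually (\<lambda>s. norming j s / \<rho> s < 8 * \<delta> / e) at_top"
      by (rule order_tendstoD[OF norming_over_rho[OF j]]) (use \<delta> e in auto)
    then show ?thesis using ev eventually_lnln rho_pos eventually_gt_at_top[of 0]
    proof eventually_elim
      case (elim s)
      define E where "E = (\<lambda>k \<omega>. k \<notin> block a s \<and> \<pi> k s \<omega> = j)"
      note br = block_remainder[OF j elim(5), where a = a, folded E_def]
      interpret R: indep_occupancy M E by (rule br(1))
      define y where "y = e / 2 * norming j s"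
      \<comment> \<open>The same choice as in \<open>increment_tail\<close>, with w = \<delta> *
        \<rho> s.\<close>
      define l where "l = y / (4 * (\<delta> * \<rho> s))"
      have n2: "(norming j s)\<^sup>2 = c * \<rho> s * ln (ln s)" using norming_square[OF j] elim by (simp add: c_def)
      have n0: "0 \<le> norming j s" using elim c by (simp add: norming_def c_def[symmetric])
      have vd: "0 \<le> R.v" "R.v \<le> \<delta> * \<rho> s" using R.v_nonneg elim(2) by (auto simp: E_def)
      have dr: "0 < \<delta> * \<rho> s" using \<delta> elim by simp
      have l: "0 \<le> l" "l \<le> 1"
      proof -
        show "0 \<le> l" using n0 e dr by (simp add: l_def y_def)
        have "norming j s < 8 * \<delta> / e * \<rho> s" using elim(1,4) by (simp add: pos_divide_less_eq)
        then have "y \<le> 4 * (\<delta> * \<rho> s)" using e by (simp add: y_def field_simps)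
        then show "l \<le> 1" using dr by (simp add: l_def)
      qed
      have expo: "- l * y + l\<^sup>2 / 2 * (1 + 3 * l) * R.v \<le> - (2 * ln (ln s))"
      proof -
        have "(1 + 3 * l) * R.v \<le> 4 * (\<delta> * \<rho> s)" using l vd by (intro mult_mono) auto
        then have "l\<^sup>2 / 2 * ((1 + 3 * l) * R.v) \<le> l\<^sup>2 / 2 * (4 * (\<delta> * \<rho> s))" by (intro mult_left_mono) auto
        moreover have "- l * y + l\<^sup>2 / 2 * (4 * (\<delta> * \<rho> s)) = - (y\<^sup>2 / (8 * (\<delta> * \<rho> s)))"
          using dr by (simp add: l_def power2_eq_square field_simps)
        moreover have "2 * ln (ln s) \<le> y\<^sup>2 / (8 * (\<delta> * \<rho> s))"
        proof -
          have "16 * \<delta> * (\<rho> s * ln (ln s)) \<le> (e / 2)\<^sup>2 * c * (\<rho> s * ln (ln s))"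
            using \<delta>(3) elim by (intro mult_right_mono) auto
          then have "2 * ln (ln s) * (8 * (\<delta> * \<rho> s)) \<le> (e / 2)\<^sup>2 * (c * \<rho> s * ln (ln s))" by (simp add: mult_ac)
          also have "\<dots> = y\<^sup>2" unfolding y_def power_mult_distrib n2 ..
          finally have "2 * ln (ln s) * (8 * (\<delta> * \<rho> s)) \<le> y\<^sup>2" .
          then show ?thesis using dr by (simp add: pos_le_divide_eq)
        qed
        ultimately show ?thesis by (simp add: mult.assoc)
      qed
      show ?case unfolding y_def[symmetric]
      proof (rule two_sided_tail)
        fix b' :: real assume b': "\<bar>b'\<bar> = 1"
        have "\<P>(\<omega> in M. y \<le> b' * (K j s \<omega> - block_sum j a s \<omega>)) = \<P>(\<omega> in M. y \<le> b' * (R.T \<omega> - R.m))"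
        proof (rule measure_eq_AE)
          show "AE \<omega> in M. (\<omega> \<in> {\<omega>\<in>space M. y \<le> b' * (K j s \<omega> - block_sum j a s \<omega>)}) = (\<omega> \<in> {\<omega>\<in>space M. y \<le> b' * (R.T \<omega> - R.m)})"
            using AE_regular by eventually_elim (simp add: br(2))
        qed auto
        also have "\<dots> \<le> exp (- l * y + l\<^sup>2 / 2 * (1 + 3 * l) * R.v)" by (rule R.chernoff[OF l b'])
        also have "\<dots> \<le> exp (- (2 * ln (ln s)))" using expo by simp
        finally show "\<P>(\<omega> in M. y \<le> b' * (K j s \<omega> - block_sum j a s \<omega>)) \<le> exp (- (2 * ln (ln s)))" .
      qed measurable
    qed
  qed
  have rem: "AE \<omega> in M. eventually (\<lambda>n. \<not> e / 2 * norming j (t n) \<le> \<bar>K j (t n) \<omega> - block_sum j a (t n) \<omega>\<bar>) sequentially"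
  proof (rule borel_cantelli_1[OF _ eventually_compose_filterlim[OF rem_tail t_top]])
    show "summable (\<lambda>n. 2 * exp (- (2 * ln (ln (t n)))))"
      unfolding t_def by (rule summable_exp_ln_power[OF g]) simp
  qed measurable
  show ?thesis
    using freq rem
  proof eventually_elim
    case (elim \<omega>)
    have "frequently (\<lambda>n. (sqrt 2 - e) * norming j (t n) \<le> b * K j (t n) \<omega>) sequentially"
    proof (rule frequently_elim1[OF frequently_eventually_conj[OF elim(1,2)]])
      fix n
      let ?N = "norming j (t n)" and ?B = "block_sum j a (t n) \<omega>" and ?R = "K j (t n) \<omega> - block_sum j a (t n) \<omega>"
      assume h: "\<not> e / 2 * ?N \<le> \<bar>?R\<bar> \<and> 1 \<le> n \<and> x n \<le> b * ?B"
      have "\<bar>b * ?R\<bar> = \<bar>?R\<bar>" using b by (simp add: abs_mult)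
      then have "- (e / 2 * ?N) \<le> b * ?R" using h by linarith
      moreover have "b * K j (t n) \<omega> = b * ?B + b * ?R" by (simp add: algebra_simps)
      moreover have "(sqrt 2 - e) * ?N = (sqrt 2 - e / 2) * ?N - e / 2 * ?N" by (simp add: algebra_simps)
      ultimately show "(sqrt 2 - e) * ?N \<le> b * K j (t n) \<omega>"
        using h unfolding x_def by linarith
    qed
    then show ?case by (rule frequently_filterlim) (rule t_top)
  qed
qed

text \<open>The cases b = 1 and b = -1 give the upper and the lower limit. Deviations 1 / (m + 1)
  are used so that only countably many null sets are united; R exchanges the norming for the
  variance normalisation.\<close>

lemma limsup_normalized:
  assumes j: "1 \<le> j" and b: "\<bar>b\<bar> = 1"
  shows "AE \<omega> in M. Limsup at_top (\<lambda>t::real. ereal (b * normalized_boxes M S X j t \<omega>)) = ereal (sqrt 2)"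
proof -
  have U: "AE \<omega> in M. \<forall>m::nat. eventually (\<lambda>t. \<bar>K j t \<omega>\<bar> \<le> (sqrt 2 + 1 / real (Suc m)) * norming j t) at_top"
    unfolding AE_all_countable by (intro allI lil_upper j) simp
  have L: "AE \<omega> in M. \<forall>m::nat. frequently (\<lambda>t. (sqrt 2 - 1 / real (Suc m)) * norming j t \<le> b * K j t \<omega>) at_top"
    unfolding AE_all_countable by (intro allI lil_lower j b) simp
  define R where "R t = norming j t / sqrt (V j t * ln (ln (V j t)))" for t
  have R1: "(R \<longlongrightarrow> 1) at_top" unfolding R_def[abs_def] by (rule norming_equiv[OF j])
  have Rpos: "eventually (\<lambda>t. 0 < R t) at_top" by (rule order_tendstoD[OF R1]) simp
  have npos: "eventually (\<lambda>t. 0 < norming j t) at_top"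
    by (rule filterlim_at_top_dense[THEN iffD1, OF norming_at_top[OF j], rule_format])
  have nb: "normalized_boxes M S X j t \<omega> = K j t \<omega> / norming j t * R t" if "0 < t" "0 < norming j t" for t \<omega>
    using that j by (simp add: normalized_boxes_def K_def mean_boxes_eq var_boxes_eq R_def)
  show ?thesis
    using U L
  proof eventually_elim
    case w: (elim \<omega>)
    show ?case
    proof (rule Limsup_eqI_real)
      fix e :: real assume e: "0 < e"
      obtain m where m: "1 / real (Suc m) < e" using nat_approx_posE[OF e] by (metis)
      have "((\<lambda>t. (sqrt 2 + 1 / real (Suc m)) * R t) \<longlongrightarrow> (sqrt 2 + 1 / real (Suc m)) * 1) at_top"
        by (intro tendsto_intros R1)
      then have "eventually (\<lambda>t. (sqrt 2 + 1 / real (Suc m)) * R t < sqrt 2 + e) at_top"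
        by (rule order_tendstoD) (use m in simp)
      then show "eventually (\<lambda>t. b * normalized_boxes M S X j t \<omega> \<le> sqrt 2 + e) at_top"
        using w(1)[rule_format, of m] Rpos npos eventually_gt_at_top[of 0]
      proof eventually_elim
        case (elim t)
        have "b * K j t \<omega> \<le> \<bar>b * K j t \<omega>\<bar>" by simp
        also have "\<dots> \<le> (sqrt 2 + 1 / real (Suc m)) * norming j t" using elim b by (simp add: abs_mult)
        finally have "b * K j t \<omega> / norming j t \<le> sqrt 2 + 1 / real (Suc m)" using elim by (simp only: pos_divide_le_eq)
        then have "b * K j t \<omega> / norming j t * R t \<le> (sqrt 2 + 1 / real (Suc m)) * R t" using elim by (intro mult_right_mono) auto
        then show ?case using elim by (simp add: nb)
      qed
    next
      fix e :: real assume e: "0 < e"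
      obtain m where m: "1 / real (Suc m) < e" using nat_approx_posE[OF e] by (metis)
      have "((\<lambda>t. (sqrt 2 - 1 / real (Suc m)) * R t) \<longlongrightarrow> (sqrt 2 - 1 / real (Suc m)) * 1) at_top"
        by (intro tendsto_intros R1)
      then have "eventually (\<lambda>t. sqrt 2 - e < (sqrt 2 - 1 / real (Suc m)) * R t) at_top"
        by (rule order_tendstoD) (use m in simp)
      then have "eventually (\<lambda>t. (sqrt 2 - 1 / real (Suc m)) * norming j t \<le> b * K j t \<omega> \<longrightarrow> sqrt 2 - e \<le> b * normalized_boxes M S X j t \<omega>) at_top"
        using Rpos npos eventually_gt_at_top[of 0]
      proof eventually_elim
        case (elim t)
        show ?case
        proof
          assume "(sqrt 2 - 1 / real (Suc m)) * norming j t \<le> b * K j t \<omega>"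
          then have "sqrt 2 - 1 / real (Suc m) \<le> b * K j t \<omega> / norming j t" using elim by (simp only: pos_le_divide_eq)
          then have "(sqrt 2 - 1 / real (Suc m)) * R t \<le> b * K j t \<omega> / norming j t * R t" using elim by (intro mult_right_mono) auto
          then show "sqrt 2 - e \<le> b * normalized_boxes M S X j t \<omega>" using elim by (simp add: nb)
        qed
      qed
      then show "frequently (\<lambda>t. sqrt 2 - e \<le> b * normalized_boxes M S X j t \<omega>) at_top"
        by (rule frequently_rev_mp[OF w(2)[rule_format, of m]])
    qed
  qed
qed

end

section \<open>From slow variation to ratios of the counting function, and the conclusion\<close>

lemma regularly_varying_rho:
  assumes \<alpha>: "0 < \<alpha>" and L: "slowly_varying L"
    and eq: "(\<lambda>t. real (rho p t)) \<sim>[at_top] (\<lambda>t. t powr \<alpha> * L t)" and c: "0 < c"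
  shows "((\<lambda>t. real (rho p (c * t)) / real (rho p t)) \<longlongrightarrow> c powr \<alpha>) at_top"
proof -
  have ct: "filterlim (\<lambda>t. c * t) at_top at_top"
    using c by (intro filterlim_tendsto_pos_mult_at_top[OF tendsto_const] filterlim_ident) auto
  have "(\<lambda>t. real (rho p (c * t))) \<sim>[at_top] (\<lambda>t. (c * t) powr \<alpha> * L (c * t))"
    by (rule asymp_equiv_compose'[OF eq ct])
  from asymp_equiv_divide[OF this eq]
  have "(\<lambda>t. real (rho p (c * t)) / real (rho p t)) \<sim>[at_top] (\<lambda>t. ((c * t) powr \<alpha> * L (c * t)) / (t powr \<alpha> * L t))" .
  moreover have "((\<lambda>t. ((c * t) powr \<alpha> * L (c * t)) / (t powr \<alpha> * L t)) \<longlongrightarrow> c powr \<alpha>) at_top"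
  proof -
    have "((\<lambda>t. c powr \<alpha> * (L (c * t) / L t)) \<longlongrightarrow> c powr \<alpha> * 1) at_top"
      using L c by (intro tendsto_intros) (auto simp: slowly_varying_def)
    then have "((\<lambda>t. c powr \<alpha> * (L (c * t) / L t)) \<longlongrightarrow> c powr \<alpha>) at_top" by simp
    then show ?thesis
    proof (rule Lim_transform_eventually)
      show "eventually (\<lambda>t. c powr \<alpha> * (L (c * t) / L t) = ((c * t) powr \<alpha> * L (c * t)) / (t powr \<alpha> * L t)) at_top"
        using eventually_gt_at_top[of 0] by eventually_elim (use c in \<open>simp add: powr_mult\<close>)
    qed
  qed
  ultimately show ?thesis by (rule asymp_equiv_tendsto_transfer[OF asymp_equiv_sym[THEN iffD1]])
qed

theorem theorem1p4:
  fixes M :: "'a measure" and S :: "nat \<Rightarrow> 'a \<Rightarrow> real" and X :: "nat \<Rightarrow> 'a \<Rightarrow> nat"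
    and p :: "nat pmf" and \<alpha> :: real and L :: "real \<Rightarrow> real"
  assumes "poissonized_karlin_scheme M S p X"
    and "0 < \<alpha>" and "\<alpha> < 1"
    and "slowly_varying L"
    and "(\<lambda>t. real (rho p t)) \<sim>[at_top] (\<lambda>t. t powr \<alpha> * L t)"
  shows "\<forall>j\<ge>1.
      (AE \<omega> in M. Limsup at_top (\<lambda>t::real. ereal (normalized_boxes M S X j t \<omega>)) = ereal (sqrt 2)) \<and>
      (AE \<omega> in M. Liminf at_top (\<lambda>t::real. ereal (normalized_boxes M S X j t \<omega>)) = ereal (- sqrt 2)) \<and>
      mean_boxes M S X j \<sim>[at_top]
        (\<lambda>t. \<alpha> * (Gamma (real j - \<alpha>) / fact j) * t powr \<alpha> * L t) \<and>
      var_boxes M S X j \<sim>[at_top] (\<lambda>t. var_const j \<alpha> * t powr \<alpha> * L t) \<and>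
      var_const j \<alpha> > 0"
proof -
  interpret poissonized_karlin_scheme M S p X by (rule assms(1))
  interpret karlin_lil M S p X \<alpha>
    using infinitely_many_boxes regularly_varying_rho[OF assms(2,4,5)] assms(2,3) by unfold_locales auto
  have rL: "\<rho> \<sim>[at_top] (\<lambda>t. t powr \<alpha> * L t)" using assms(5) by (simp add: \<rho>_def[abs_def])
  have r0: "eventually (\<lambda>t. \<rho> t \<noteq> 0) at_top" using rho_pos by eventually_elim simp
  {
    fix j :: nat assume j: "1 \<le> j"
    have sup: "AE \<omega> in M. Limsup at_top (\<lambda>t::real. ereal (normalized_boxes M S X j t \<omega>)) = ereal (sqrt 2)"
      using limsup_normalized[OF j, of 1] by simp
    have inf: "AE \<omega> in M. Liminf at_top (\<lambda>t::real. ereal (normalized_boxes M S X j t \<omega>)) = ereal (- sqrt 2)"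
    proof -
      have "AE \<omega> in M. Limsup at_top (\<lambda>t::real. - ereal (normalized_boxes M S X j t \<omega>)) = ereal (sqrt 2)"
        using limsup_normalized[OF j, of "-1"] by simp
      then show ?thesis
      proof eventually_elim
        case (elim \<omega>)
        then have "- Liminf at_top (\<lambda>t::real. ereal (normalized_boxes M S X j t \<omega>)) = ereal (sqrt 2)"
          unfolding ereal_Limsup_uminus .
        then show ?case by (metis ereal_uminus_uminus uminus_ereal.simps(1))
      qed
    qed
    have mean: "mean_boxes M S X j \<sim>[at_top] (\<lambda>t. \<alpha> * (Gamma (real j - \<alpha>) / fact j) * t powr \<alpha> * L t)"
    proof -
      have "G j \<sim>[at_top] (\<lambda>t. \<alpha> * Gamma (real j - \<alpha>) / fact j * (t powr \<alpha> * L t))"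
        by (rule asymp_ratio_tendsto[OF G_asymptotics[OF j] _ rL r0]) (metis Gamma_pos[OF j] less_irrefl)
      moreover have "eventually (\<lambda>t. G j t = mean_boxes M S X j t) at_top"
        using eventually_gt_at_top[of 0] by eventually_elim (simp add: mean_boxes_eq[OF _ j])
      ultimately show ?thesis by (rule asymp_equiv_transfer) (simp add: mult.assoc)
    qed
    have var: "var_boxes M S X j \<sim>[at_top] (\<lambda>t. var_const j \<alpha> * t powr \<alpha> * L t)"
    proof -
      have "V j \<sim>[at_top] (\<lambda>t. var_const j \<alpha> * (t powr \<alpha> * L t))"
        by (rule asymp_ratio_tendsto[OF V_asymptotics[OF j] _ rL r0]) (use var_const_pos[OF j] in simp)
      moreover have "eventually (\<lambda>t. V j t = var_boxes M S X j t) at_top"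
        using eventually_gt_at_top[of 0] by eventually_elim (simp add: var_boxes_eq[OF _ j])
      ultimately show ?thesis by (rule asymp_equiv_transfer) (simp add: mult.assoc)
    qed
    note conjI[OF sup conjI[OF inf conjI[OF mean conjI[OF var var_const_pos[OF j]]]]]
  }
  then show ?thesis by blast
qed

end
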